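(* $JC(\infty)$ holds if and only if for all $n\in\mathbb{N}$ the affine variety $$W_n'=\{(y,z,A)\in W_n:\ A \text{ is a Druzkowski matrix}\}$$ is connected. In particular, if $W_n$ is connected for every $n\in\mathbb{N}$, then $JC(\infty)$ holds.
   Context: $JC(n)$ is the statement: every polynomial map $F:\mathbb{C}^n\to\mathbb{C}^n$ whose Jacobian matrix is invertible at every point has a polynomial inverse. $JC(\infty)$ is the statement that $JC(n)$ holds for every $n$. For $u,v\in\mathbb{C}^n$, $u*v=(u_1v_1,\ldots,u_nv_n)$ is the coordinatewise product, $u^k$ is the coordinatewise $k$-th power, and $\Delta[u]$ is the diagonal $n\times n$ matrix with $(i,i)$ entry $u_i$. $\mathcal{M}_n$ is the set of complex $n\times n$ matrices. A matrix $A\in\mathcal{M}_n$ is called Druzkowski if the map $F_A(x)=x+(A.x)^3:\mathbb{C}^n\to\mathbb{C}^n$ has Jacobian determinant identically equal to $1$. Define $$W_n=\{(y,z,A)\in\mathbb{C}^n\times\mathbb{C}^n\times\mathcal{M}_n:\ \det(Id+\Delta[(sz+tA.y)^2].A)=1\ \forall s,t\in\mathbb{C},\ z+A.(z^3+z*(A.y)^2)=0\}.$$ *)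

theory Defs
  imports "HOL-Analysis.Derivative" "HOL-Analysis.Function_Topology"
    "Jordan_Normal_Form.Determinant"
begin

text \<open>
  Points of $\mathbb{C}^n$ are the elements of \<open>carrier_vec n\<close>, so that \<open>n\<close> can be quantified
  inside formulas. Functions on $\mathbb{C}^n$ are only ever constrained on \<open>carrier_vec n\<close>. As
  $\mathbb{C}$ is infinite, polynomials are identified with the functions they induce.
\<close>

definition poly_fun :: "nat \<Rightarrow> (complex vec \<Rightarrow> complex) \<Rightarrow> bool" where
  "poly_fun n f \<longleftrightarrow> (\<exists>(E :: (nat \<Rightarrow> nat) set) (c :: (nat \<Rightarrow> nat) \<Rightarrow> complex). finite E \<and>
     (\<forall>x\<in>carrier_vec n. f x = (\<Sum>e\<in>E. c e * (\<Prod>i<n. (x $ i) ^ e i))))"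

definition poly_map :: "nat \<Rightarrow> (complex vec \<Rightarrow> complex vec) \<Rightarrow> bool" where
  "poly_map n F \<longleftrightarrow> (\<forall>x\<in>carrier_vec n. F x \<in> carrier_vec n) \<and>
     (\<forall>i<n. poly_fun n (\<lambda>x. F x $ i))"

text \<open>The \<open>(i, j)\<close> entry is the partial derivative of the \<open>i\<close>-th component in direction \<open>j\<close>.\<close>

definition jacobian :: "nat \<Rightarrow> (complex vec \<Rightarrow> complex vec) \<Rightarrow> complex vec \<Rightarrow> complex mat" where
  "jacobian n F x = mat n n (\<lambda>(i, j). deriv (\<lambda>t. F (x + t \<cdot>\<^sub>v unit_vec n j) $ i) 0)"

definition JC :: "nat \<Rightarrow> bool" where
  "JC n \<longleftrightarrow> (\<forall>F. poly_map n F \<longrightarrow> (\<forall>x\<in>carrier_vec n. invertible_mat (jacobian n F x)) \<longrightarrow>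
     (\<exists>G. poly_map n G \<and> (\<forall>x\<in>carrier_vec n. G (F x) = x \<and> F (G x) = x)))"

definition JC_infinity :: bool where
  "JC_infinity \<longleftrightarrow> (\<forall>n. JC n)"

definition cw_mult :: "complex vec \<Rightarrow> complex vec \<Rightarrow> complex vec" (infixl "*\<^sub>c" 70) where
  "u *\<^sub>c v = vec (dim_vec u) (\<lambda>i. u $ i * v $ i)"

definition cw_pow :: "complex vec \<Rightarrow> nat \<Rightarrow> complex vec" (infixr "^\<^sub>c" 80) where
  "u ^\<^sub>c k = map_vec (\<lambda>a. a ^ k) u"

definition diag_of_vec :: "complex vec \<Rightarrow> complex mat" ("\<Delta>[_]") where
  "\<Delta>[u] = mat_diag (dim_vec u) (\<lambda>i. u $ i)"

definition cubic_linear :: "complex mat \<Rightarrow> complex vec \<Rightarrow> complex vec" where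
  "cubic_linear A x = x + (A *\<^sub>v x) ^\<^sub>c 3"

definition druzkowski :: "nat \<Rightarrow> complex mat \<Rightarrow> bool" where
  "druzkowski n A \<longleftrightarrow> A \<in> carrier_mat n n \<and>
     (\<forall>x\<in>carrier_vec n. det (jacobian n (cubic_linear A) x) = 1)"

definition W :: "nat \<Rightarrow> (complex vec \<times> complex vec \<times> complex mat) set" where
  "W n = {(y, z, A). y \<in> carrier_vec n \<and> z \<in> carrier_vec n \<and> A \<in> carrier_mat n n \<and>
     (\<forall>s t. det (1\<^sub>m n + \<Delta>[(s \<cdot>\<^sub>v z + t \<cdot>\<^sub>v (A *\<^sub>v y)) ^\<^sub>c 2] * A) = 1) \<and>
     z + A *\<^sub>v (z ^\<^sub>c 3 + z *\<^sub>c (A *\<^sub>v y) ^\<^sub>c 2) = 0\<^sub>v n}"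

definition W' :: "nat \<Rightarrow> (complex vec \<times> complex vec \<times> complex mat) set" where
  "W' n = {(y, z, A) \<in> W n. druzkowski n A}"

text \<open>
  The Zariski topology on $\mathbb{C}^N$: the non-vanishing loci of single polynomials are closed
  under finite intersections, hence form a base, and the closed sets are the common zero loci of
  sets of polynomials.
\<close>

definition zariski :: "nat \<Rightarrow> complex vec topology" where
  "zariski N = topology_generated_by {{x \<in> carrier_vec N. f x \<noteq> 0} | f. poly_fun N f}"

text \<open>
  Identification of $\mathbb{C}^n \times \mathbb{C}^n \times \mathcal{M}_n$ with
  $\mathbb{C}^{2n + n^2}$, the matrix being listed row by row.
\<close>

definition flatten :: "nat \<Rightarrow> complex vec \<times> complex vec \<times> complex mat \<Rightarrow> complex vec" where
  "flatten n = (\<lambda>(y, z, A). y @\<^sub>v z @\<^sub>v vec (n * n) (\<lambda>k. A $$ (k div n, k mod n)))"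

text \<open>
  Connectedness of a set of triples as a subspace of affine space with the Zariski topology. For
  complex affine varieties this agrees with connectedness in the Euclidean topology.
\<close>

definition variety_connected ::
    "nat \<Rightarrow> (complex vec \<times> complex vec \<times> complex mat) set \<Rightarrow> bool" where
  "variety_connected n V \<longleftrightarrow> connectedin (zariski (2 * n + n * n)) (flatten n ` V)"

end

theory Submission
  imports "HOL-Complex_Analysis.Complex_Analysis"
    "HOL-Computational_Algebra.Fundamental_Theorem_Algebra" Defs
begin

no_notation Finite_Cartesian_Product.vec_nth (infixl "$" 90)
no_notation fps_nth (infixl "$" 75)

text \<open>
  If \<open>A\<close> is Druzkowski, the substitution \<open>x = m \<plusminus> w\<close> with \<open>y = \<surd>3 m\<close> and \<open>z = A w\<close> turns a
  collision of \<open>F\<^sub>A\<close> into a point \<open>(y, z, A)\<close> of \<open>W'\<close> with \<open>z \<noteq> 0\<close>. The polynomial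
  \<open>det (Id + \<Delta>[(A y)\<^sup>2 + z\<^sup>2] A)\<close> is \<open>1\<close> on the points of \<open>W\<close> with \<open>z = 0\<close> and \<open>0\<close> on the others, so
  connectedness forces \<open>z = 0\<close>; conversely the points \<open>(y, 0, A)\<close> form a cone. Hence \<open>W'\<close> is
  connected for all \<open>n\<close> iff all Druzkowski maps are injective.

  The reductions of Bass, Connell and Wright and of Druzkowski show that then every polynomial map
  with invertible Jacobian matrix is injective. Such a map \<open>F\<close> has a polynomial inverse: counting
  dimensions, each \<open>x\<^sub>i\<close> is algebraic over the components of \<open>F\<close>, so \<open>F\<close> is proper over the
  complement of a hypersurface \<open>q = 0\<close>, which therefore lies in the image, and \<open>q x\<^sub>i\<close> is a
  polynomial in \<open>F\<close>. A reduced denominator of \<open>x\<^sub>i\<close> is a polynomial that does not vanish on the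
  image of \<open>F\<close>; its composition with \<open>F\<close> has no zeros, so it is constant.
\<close>

section \<open>Polynomial functions in finitely many variables\<close>

text \<open>The reductions carry injectivity and not invertibility: a collision lifts to the
  enlarged map by an explicit choice of the new coordinates, whereas an inverse would have to be
  pulled back through each enlargement. The price is the step from injective to invertible. There
  the inverse is at first a mere function over \<open>q \<noteq> 0\<close>. Properness makes it
  continuous, the invertible derivative makes it holomorphic along lines, and polynomial growth
  makes \<open>q x_i\<close> a polynomial in \<open>F\<close>. The denominator is removed without
  factorisation in several variables: along parallel lines \<open>y + t v\<close>, with
  \<open>v\<close> chosen so that \<open>q\<close> is monic in \<open>t\<close> up to a constant,
  one works in \<open>C[y][t]\<close> with pseudo-division, and a denominator of least degree in
  \<open>t\<close> stands for a reduced one. If it vanished at a point of the image, so would its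
  numerator, and this would persist for all nearby \<open>y\<close> because roots depend
  continuously on the coefficients; a Bezout identity with right side \<open>\<gamma>(y)\<close>,
  not identically zero, forbids that.\<close>

inductive poly_deg :: "'i set \<Rightarrow> nat \<Rightarrow> (('i \<Rightarrow> complex) \<Rightarrow> complex) \<Rightarrow> bool" for I where
  poly_deg_const: "poly_deg I d (\<lambda>x. c)"
| poly_deg_var: "i \<in> I \<Longrightarrow> 1 \<le> d \<Longrightarrow> poly_deg I d (\<lambda>x. x i)"
| poly_deg_add: "poly_deg I d f \<Longrightarrow> poly_deg I d g \<Longrightarrow> poly_deg I d (\<lambda>x. f x + g x)"
| poly_deg_mult: "poly_deg I a f \<Longrightarrow> poly_deg I b g \<Longrightarrow> poly_deg I (a + b) (\<lambda>x. f x * g x)"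

lemma poly_deg_mono: "poly_deg I d f \<Longrightarrow> d \<le> d' \<Longrightarrow> poly_deg I d' f"
proof (induction arbitrary: d' rule: poly_deg.induct)
  case (poly_deg_mult a f b g)
  then have "poly_deg I (a + (d' - a)) (\<lambda>x. f x * g x)"
    by (intro poly_deg.poly_deg_mult) auto
  then show ?case using poly_deg_mult by simp
qed (auto intro: poly_deg.intros)

lemma poly_deg_cmult: "poly_deg I d f \<Longrightarrow> poly_deg I d (\<lambda>x. c * f x)"
  using poly_deg_mult[OF poly_deg_const[of I 0 c]] by simp

lemma poly_deg_uminus: "poly_deg I d f \<Longrightarrow> poly_deg I d (\<lambda>x. - f x)"
  using poly_deg_cmult[of I d f "-1"] by simp

lemma poly_deg_diff: "poly_deg I d f \<Longrightarrow> poly_deg I d g \<Longrightarrow> poly_deg I d (\<lambda>x. f x - g x)"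
  using poly_deg_add[OF _ poly_deg_uminus, of I d f g] by simp

lemma poly_deg_sum: "(\<And>a. a \<in> A \<Longrightarrow> poly_deg I d (f a)) \<Longrightarrow> poly_deg I d (\<lambda>x. \<Sum>a\<in>A. f a x)"
  by (induction A rule: infinite_finite_induct) (auto intro: poly_deg.intros)

lemma poly_deg_mult_le: "poly_deg I a f \<Longrightarrow> poly_deg I b g \<Longrightarrow> a + b \<le> d \<Longrightarrow> poly_deg I d (\<lambda>x. f x * g x)"
  using poly_deg_mono poly_deg_mult by blast

lemma poly_deg_power: "poly_deg I d f \<Longrightarrow> poly_deg I (k * d) (\<lambda>x. f x ^ k)"
proof (induction k)
  case (Suc k)
  then show ?case using poly_deg_mult[of I d f "k * d"] by simp
qed (auto intro: poly_deg.intros)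

lemma poly_deg_prod:
  "(\<And>a. a \<in> A \<Longrightarrow> poly_deg I (d a) (f a)) \<Longrightarrow> poly_deg I (\<Sum>a\<in>A. d a) (\<lambda>x. \<Prod>a\<in>A. f a x)"
  by (induction A rule: infinite_finite_induct) (auto intro: poly_deg.intros)

lemma poly_deg_subst:
  "poly_deg I d f \<Longrightarrow> (\<And>i. i \<in> I \<Longrightarrow> poly_deg J k (g i)) \<Longrightarrow> poly_deg J (d * k) (\<lambda>x. f (\<lambda>i. g i x))"
proof (induction rule: poly_deg.induct)
  case (poly_deg_var i d)
  then show ?case using poly_deg_mono[of J k "g i" "d * k"] by simp
next
  case (poly_deg_mult a f b g)
  then show ?case by (simp add: add_mult_distrib poly_deg.poly_deg_mult)
qed (auto intro: poly_deg.intros)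

lemma poly_deg_cong: "poly_deg I d f \<Longrightarrow> (\<And>i. i \<in> I \<Longrightarrow> x i = y i) \<Longrightarrow> f x = f y"
  by (induction rule: poly_deg.induct) auto

lemma poly_deg_0: "poly_deg I d f \<Longrightarrow> d = 0 \<Longrightarrow> f x = f y"
  by (induction rule: poly_deg.induct) auto

text \<open>Polynomials are functions on total assignments over an arbitrary index type, because the
  reductions introduce variables of new types; only coordinates in \<open>I\<close> matter, see
  \<open>polyfn_cong\<close>. In \<open>poly_deg I d f\<close> the number \<open>d\<close> is merely
  an upper bound for the degree.\<close>

definition polyfn :: "'i set \<Rightarrow> (('i \<Rightarrow> complex) \<Rightarrow> complex) \<Rightarrow> bool" where
  "polyfn I f \<longleftrightarrow> (\<exists>d. poly_deg I d f)"

lemma polyfn_I: "poly_deg I d f \<Longrightarrow> polyfn I f"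
  by (auto simp: polyfn_def)

lemma polyfn_const [intro, simp]: "polyfn I (\<lambda>x. c)"
  by (auto simp: polyfn_def intro: poly_deg_const)

lemma polyfn_var [intro, simp]: "i \<in> I \<Longrightarrow> polyfn I (\<lambda>x. x i)"
  by (auto simp: polyfn_def intro: poly_deg_var)

lemma polyfn_add [intro]: "polyfn I f \<Longrightarrow> polyfn I g \<Longrightarrow> polyfn I (\<lambda>x. f x + g x)"
proof -
  assume "polyfn I f" "polyfn I g"
  then obtain a b where "poly_deg I a f" "poly_deg I b g" by (auto simp: polyfn_def)
  then have "poly_deg I (max a b) (\<lambda>x. f x + g x)" by (intro poly_deg_add) (auto elim: poly_deg_mono)
  then show ?thesis by (auto simp: polyfn_def)
qed

lemma polyfn_mult [intro]: "polyfn I f \<Longrightarrow> polyfn I g \<Longrightarrow> polyfn I (\<lambda>x. f x * g x)"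
proof -
  assume "polyfn I f" "polyfn I g"
  then obtain a b where "poly_deg I a f" "poly_deg I b g" by (auto simp: polyfn_def)
  then have "poly_deg I (a + b) (\<lambda>x. f x * g x)" by (rule poly_deg_mult)
  then show ?thesis by (auto simp: polyfn_def)
qed

lemma polyfn_induct [consumes 1, case_names const var add mult]:
  assumes "polyfn I f"
    and "\<And>c. P (\<lambda>x. c)" "\<And>i. i \<in> I \<Longrightarrow> P (\<lambda>x. x i)"
    and "\<And>f g. polyfn I f \<Longrightarrow> P f \<Longrightarrow> polyfn I g \<Longrightarrow> P g \<Longrightarrow> P (\<lambda>x. f x + g x)"
    and "\<And>f g. polyfn I f \<Longrightarrow> P f \<Longrightarrow> polyfn I g \<Longrightarrow> P g \<Longrightarrow> P (\<lambda>x. f x * g x)"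
  shows "P f"
proof -
  obtain d where "poly_deg I d f" using assms(1) by (auto simp: polyfn_def)
  then show ?thesis
    by (induction rule: poly_deg.induct) (auto intro: assms(2-) polyfn_I)
qed

lemma polyfn_uminus [intro]: "polyfn I f \<Longrightarrow> polyfn I (\<lambda>x. - f x)"
  using poly_deg_uminus polyfn_def by blast

lemma polyfn_diff [intro]: "polyfn I f \<Longrightarrow> polyfn I g \<Longrightarrow> polyfn I (\<lambda>x. f x - g x)"
  using polyfn_add[OF _ polyfn_uminus, of I f g] by simp

lemma polyfn_sum [intro]: "(\<And>a. a \<in> A \<Longrightarrow> polyfn I (f a)) \<Longrightarrow> polyfn I (\<lambda>x. \<Sum>a\<in>A. f a x)"
  by (induction A rule: infinite_finite_induct) auto

lemma polyfn_prod [intro]: "(\<And>a. a \<in> A \<Longrightarrow> polyfn I (f a)) \<Longrightarrow> polyfn I (\<lambda>x. \<Prod>a\<in>A. f a x)"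
  by (induction A rule: infinite_finite_induct) auto

lemma polyfn_power [intro]: "polyfn I f \<Longrightarrow> polyfn I (\<lambda>x. f x ^ k)"
  using poly_deg_power polyfn_def by blast

lemma polyfn_subst: "polyfn I f \<Longrightarrow> (\<And>i. i \<in> I \<Longrightarrow> polyfn J (g i)) \<Longrightarrow> polyfn J (\<lambda>x. f (\<lambda>i. g i x))"
  by (induction rule: polyfn_induct) auto

lemma polyfn_cong: "polyfn I f \<Longrightarrow> (\<And>i. i \<in> I \<Longrightarrow> x i = y i) \<Longrightarrow> f x = f y"
  by (auto simp: polyfn_def dest: poly_deg_cong)

lemma polyfn_PD_common:
  assumes "finite A" "\<And>a. a \<in> A \<Longrightarrow> polyfn I (f a)"
  shows "\<exists>d. \<forall>a\<in>A. poly_deg I d (f a)"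
  using assms
proof (induction A rule: finite_induct)
  case (insert a A)
  obtain d where "\<forall>a\<in>A. poly_deg I d (f a)" using insert by blast
  moreover obtain d' where "poly_deg I d' (f a)" using insert.prems[of a] by (auto simp: polyfn_def)
  ultimately have "\<forall>b\<in>insert a A. poly_deg I (max d d') (f b)" by (auto intro: poly_deg_mono)
  then show ?case by blast
qed auto

lemma polyfn_continuous_on: "polyfn I f \<Longrightarrow> continuous_on UNIV f"
  by (induction rule: polyfn_induct) (auto intro!: continuous_intros)

lemma polyfn_tendsto:
  assumes "polyfn I f" "\<And>i. i \<in> I \<Longrightarrow> ((\<lambda>s. X s i) \<longlongrightarrow> x i) A"
  shows "((\<lambda>s. f (X s)) \<longlongrightarrow> f x) A"
  using assms by (induction rule: polyfn_induct) (auto intro!: tendsto_intros)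

text \<open>Restriction to lines is the device by which identities and root arguments in several
  variables are reduced to univariate polynomials.\<close>

lemma poly_deg_line:
  "poly_deg I d f \<Longrightarrow> \<exists>p. degree p \<le> d \<and> (\<forall>s. f (\<lambda>i. x i + s * v i) = poly p s)"
proof (induction rule: poly_deg.induct)
  case (poly_deg_const d c)
  show ?case by (intro exI[of _ "[:c:]"]) auto
next
  case (poly_deg_var i d)
  then show ?case by (intro exI[of _ "[:x i, v i:]"]) auto
next
  case (poly_deg_add d f g)
  then obtain p q where "degree p \<le> d" "\<forall>s. f (\<lambda>i. x i + s * v i) = poly p s"
    "degree q \<le> d" "\<forall>s. g (\<lambda>i. x i + s * v i) = poly q s" by blast
  then show ?case by (intro exI[of _ "p + q"]) (auto intro: degree_add_le)
next
  case (poly_deg_mult a f b g)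
  then obtain p q where "degree p \<le> a" "\<forall>s. f (\<lambda>i. x i + s * v i) = poly p s"
    "degree q \<le> b" "\<forall>s. g (\<lambda>i. x i + s * v i) = poly q s" by blast
  then show ?case
    by (intro exI[of _ "p * q"]) (auto intro: order_trans[OF degree_mult_le])
qed

lemma polyfn_line: "polyfn I f \<Longrightarrow> \<exists>p. \<forall>s. f (\<lambda>i. x i + s * v i) = poly p s"
  unfolding polyfn_def using poly_deg_line by metis

lemma poly_eq_infinite:
  fixes p q :: "'a::idom poly"
  assumes "infinite S" "\<And>s. s \<in> S \<Longrightarrow> poly p s = poly q s"
  shows "p = q"
proof (rule ccontr)
  assume "p \<noteq> q"
  then have "finite {s. poly (p - q) s = 0}" by (intro poly_roots_finite) auto
  moreover have "S \<subseteq> {s. poly (p - q) s = 0}" using assms(2) by auto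
  ultimately show False using assms(1) finite_subset by blast
qed

text \<open>On the line through a point where \<open>f\<close> and a point where \<open>g\<close> does not vanish, both
  restrict to nonzero univariate polynomials.\<close>
lemma polyfn_common_nonzero:
  assumes f: "polyfn I f" "f y \<noteq> 0" and g: "polyfn I g" "g z \<noteq> 0"
  shows "\<exists>x. f x \<noteq> 0 \<and> g x \<noteq> 0"
proof -
  define l where "l = (\<lambda>s i. y i + s * (z i - y i))"
  obtain p q where p: "\<And>s. f (l s) = poly p s" and q: "\<And>s. g (l s) = poly q s"
    unfolding l_def using polyfn_line[OF f(1)] polyfn_line[OF g(1)] by metis
  have "l 0 = y" "l 1 = z" by (auto simp: l_def)
  then have "poly p 0 \<noteq> 0" "poly q 1 \<noteq> 0" using f g p[of 0] q[of 1] by auto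
  then have "p * q \<noteq> 0" by auto
  then have "finite {s. poly (p * q) s = 0}" using poly_roots_finite by blast
  then have "\<exists>s. poly (p * q) s \<noteq> 0"
    by (metis (mono_tags, lifting) UNIV_eq_I infinite_UNIV_char_0 mem_Collect_eq)
  then show ?thesis using p q by (metis mult_eq_0_iff poly_mult)
qed

lemma polyfn_zero_prod:
  assumes "polyfn I f" "polyfn I g" "\<And>x. f x * g x = 0" "f y \<noteq> 0"
  shows "g x = 0"
  using polyfn_common_nonzero[OF assms(1,4,2)] assms(3) by (metis mult_eq_0_iff)

text \<open>On the line from \<open>y0\<close> through \<open>y\<close> the function is a univariate
  polynomial with infinitely many zeros near \<open>s = 0\<close>, so it also vanishes at
  \<open>s = 1\<close>.\<close>

lemma polyfn_zero_on_box:
  assumes "finite I" "polyfn I f" "\<epsilon> > 0"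
    and z: "\<And>y. (\<And>i. i \<in> I \<Longrightarrow> cmod (y i - y0 i) < \<epsilon>) \<Longrightarrow> f y = 0"
  shows "f y = 0"
proof -
  define l where "l = (\<lambda>s i. y0 i + s * (y i - y0 i))"
  obtain p where p: "\<And>s. f (l s) = poly p s"
    unfolding l_def using polyfn_line[OF assms(2)] by metis
  \<comment> \<open>\<open>M\<close> exceeds every coordinate distance, so parameters with
    \<open>cmod s < \<epsilon> / M\<close> stay in the box.\<close>
  define M where "M = 1 + (\<Sum>i\<in>I. cmod (y i - y0 i))"
  have M1: "M \<ge> 1" by (auto simp: M_def intro: sum_nonneg)
  have M: "cmod (y i - y0 i) < M" if "i \<in> I" for i
    using member_le_sum[of i I "\<lambda>i. cmod (y i - y0 i)"] assms(1) that by (auto simp: M_def)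
  have "poly p s = 0" if "s \<in> ball 0 (\<epsilon> / M)" for s
  proof -
    have "cmod (l s i - y0 i) < \<epsilon>" if "i \<in> I" for i
    proof -
      have "cmod (l s i - y0 i) = cmod s * cmod (y i - y0 i)" by (simp add: l_def norm_mult)
      also have "\<dots> \<le> cmod s * M" using M[OF that] by (intro mult_left_mono) auto
      also have "\<dots> < \<epsilon>" using \<open>s \<in> _\<close> M1 by (simp add: field_simps)
      finally show ?thesis .
    qed
    then show ?thesis using z p by metis
  qed
  moreover have "infinite (ball (0::complex) (\<epsilon> / M))"
    using M1 assms(3) by (intro uncountable_infinite uncountable_ball) auto
  ultimately have "p = 0" using poly_eq_infinite[of "ball 0 (\<epsilon> / M)" p 0] by simp
  moreover have "l 1 = y" by (auto simp: l_def)
  ultimately show ?thesis using p[of 1] by simp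
qed

text \<open>On the line through \<open>x\<close> and \<open>y\<close> the restriction has no root,
  so by the fundamental theorem of algebra it has degree 0.\<close>

lemma polyfn_nonvanishing_const:
  assumes "polyfn I f" "\<And>x. f x \<noteq> 0"
  shows "f x = f y"
proof -
  define l where "l = (\<lambda>s i. x i + s * (y i - x i))"
  obtain p where p: "\<And>s. f (l s) = poly p s"
    unfolding l_def using polyfn_line[OF assms(1)] by metis
  have "degree p = 0"
    using alg_closed_imp_poly_has_root[of p] p assms(2) by (metis gr0I)
  then have "f (l 0) = f (l 1)" unfolding p by (auto elim: degree_eq_zeroE)
  then show ?thesis by (simp add: l_def)
qed

section \<open>Polynomial growth bounds\<close>

definition pnorm :: "'i set \<Rightarrow> ('i \<Rightarrow> complex) \<Rightarrow> real" where
  "pnorm I x = (\<Sum>i\<in>I. cmod (x i))"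

lemma pnorm_nonneg [simp]: "0 \<le> pnorm I x"
  by (auto simp: pnorm_def intro: sum_nonneg)

lemma pnorm_ge: "finite I \<Longrightarrow> i \<in> I \<Longrightarrow> cmod (x i) \<le> pnorm I x"
  unfolding pnorm_def by (rule member_le_sum) auto

text \<open>One constant serves both as factor and as exponent.\<close>
definition poly_bdd :: "'i set \<Rightarrow> (('i \<Rightarrow> complex) \<Rightarrow> bool) \<Rightarrow> (('i \<Rightarrow> complex) \<Rightarrow> real) \<Rightarrow> bool" where
  "poly_bdd I P f \<longleftrightarrow> (\<exists>m::nat. \<forall>x. P x \<longrightarrow> f x \<le> m * (1 + pnorm I x) ^ m)"

lemma poly_bddI:
  assumes "\<And>x. P x \<Longrightarrow> f x \<le> C * (1 + pnorm I x) ^ m"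
  shows "poly_bdd I P f"
proof -
  define k where "k = max m (nat \<lceil>C\<rceil>)"
  have "f x \<le> k * (1 + pnorm I x) ^ k" if "P x" for x
  proof -
    have "C \<le> k" unfolding k_def by (simp add: le_nat_iff of_nat_max) linarith
    then have "C * (1 + pnorm I x) ^ m \<le> k * (1 + pnorm I x) ^ m"
      by (intro mult_right_mono) auto
    also have "\<dots> \<le> k * (1 + pnorm I x) ^ k"
      by (intro mult_left_mono power_increasing) (auto simp: k_def)
    finally show ?thesis using assms[OF that] by linarith
  qed
  then show ?thesis unfolding poly_bdd_def by blast
qed

lemma poly_bdd_mono: "poly_bdd I P g \<Longrightarrow> (\<And>x. P x \<Longrightarrow> f x \<le> g x) \<Longrightarrow> poly_bdd I P f"
  unfolding poly_bdd_def by (meson order_trans)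

lemma poly_bdd_const: "poly_bdd I P (\<lambda>x. c)"
  by (rule poly_bddI[where C = c and m = 0]) auto

lemma poly_bdd_add:
  assumes "poly_bdd I P f" "poly_bdd I P g"
  shows "poly_bdd I P (\<lambda>x. f x + g x)"
proof -
  obtain m k :: nat where m: "\<And>x. P x \<Longrightarrow> f x \<le> m * (1 + pnorm I x) ^ m"
    and k: "\<And>x. P x \<Longrightarrow> g x \<le> k * (1 + pnorm I x) ^ k"
    using assms unfolding poly_bdd_def by metis
  show ?thesis
  proof (rule poly_bddI)
    fix x assume "P x"
    have "f x + g x \<le> m * (1 + pnorm I x) ^ m + k * (1 + pnorm I x) ^ k"
      using m k \<open>P x\<close> by (simp add: add_mono)
    also have "\<dots> \<le> m * (1 + pnorm I x) ^ (m + k) + k * (1 + pnorm I x) ^ (m + k)"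
      by (intro add_mono mult_left_mono power_increasing) auto
    finally show "f x + g x \<le> (m + k) * (1 + pnorm I x) ^ (m + k)"
      by (simp add: algebra_simps)
  qed
qed

lemma poly_bdd_mult:
  assumes "poly_bdd I P f" "poly_bdd I P g" "\<And>x. 0 \<le> f x" "\<And>x. 0 \<le> g x"
  shows "poly_bdd I P (\<lambda>x. f x * g x)"
proof -
  obtain m k :: nat where m: "\<And>x. P x \<Longrightarrow> f x \<le> m * (1 + pnorm I x) ^ m"
    and k: "\<And>x. P x \<Longrightarrow> g x \<le> k * (1 + pnorm I x) ^ k"
    using assms unfolding poly_bdd_def by metis
  show ?thesis
  proof (rule poly_bddI)
    fix x assume "P x"
    have "f x * g x \<le> (m * (1 + pnorm I x) ^ m) * (k * (1 + pnorm I x) ^ k)"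
      using m k \<open>P x\<close> assms(3,4) by (intro mult_mono) auto
    then show "f x * g x \<le> (m * k) * (1 + pnorm I x) ^ (m + k)"
      by (simp add: algebra_simps power_add)
  qed
qed

lemma poly_bdd_sum:
  "(\<And>a. a \<in> A \<Longrightarrow> poly_bdd I P (f a)) \<Longrightarrow> poly_bdd I P (\<lambda>x. \<Sum>a\<in>A. f a x)"
  by (induction A rule: infinite_finite_induct) (auto intro: poly_bdd_const poly_bdd_add)

lemma poly_bdd_power:
  "poly_bdd I P f \<Longrightarrow> (\<And>x. 0 \<le> f x) \<Longrightarrow> poly_bdd I P (\<lambda>x. f x ^ k)"
  by (induction k) (auto intro!: poly_bdd_const poly_bdd_mult)

lemma polyfn_poly_bdd: "finite I \<Longrightarrow> polyfn I f \<Longrightarrow> poly_bdd I P (\<lambda>x. cmod (f x))"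
proof (rotate_tac, induction rule: polyfn_induct)
  case (var i)
  show ?case
  proof (rule poly_bddI[where C = 1 and m = 1])
    show "cmod (x i) \<le> 1 * (1 + pnorm I x) ^ 1" for x
      using pnorm_ge[of I i x] var by simp
  qed
next
  case (add f g)
  then have "poly_bdd I P (\<lambda>x. cmod (f x) + cmod (g x))" by (intro poly_bdd_add) auto
  then show ?case by (rule poly_bdd_mono) (rule norm_triangle_ineq)
next
  case (mult f g)
  then show ?case unfolding norm_mult by (intro poly_bdd_mult) auto
qed (auto intro: poly_bdd_const)

section \<open>Directional derivatives\<close>

definition dir_deriv :: "(('i \<Rightarrow> complex) \<Rightarrow> complex) \<Rightarrow> ('i \<Rightarrow> complex) \<Rightarrow> ('i \<Rightarrow> complex) \<Rightarrow> complex" where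
  "dir_deriv f x v = deriv (\<lambda>s. f (\<lambda>i. x i + s * v i)) 0"

lemma polyfn_has_dd:
  assumes "polyfn I f"
  shows "((\<lambda>s. f (\<lambda>i. x i + s * v i)) has_field_derivative dir_deriv f x v) (at 0)"
proof -
  obtain p where "\<And>s. f (\<lambda>i. x i + s * v i) = poly p s" using polyfn_line[OF assms] by metis
  then show ?thesis
    unfolding dir_deriv_def by (simp add: DERIV_imp_deriv[OF poly_DERIV] poly_DERIV)
qed

lemma ddI: "((\<lambda>s. f (\<lambda>i. x i + s * v i)) has_field_derivative D) (at 0) \<Longrightarrow> dir_deriv f x v = D"
  unfolding dir_deriv_def by (rule DERIV_imp_deriv)

lemma dir_deriv_const [simp]: "dir_deriv (\<lambda>x. c) x v = 0"
  by (rule ddI) auto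

lemma dir_deriv_var [simp]: "dir_deriv (\<lambda>x. x i) x v = v i"
  by (rule ddI) (auto intro!: derivative_eq_intros)

lemma dir_deriv_add: "polyfn I f \<Longrightarrow> polyfn I g \<Longrightarrow> dir_deriv (\<lambda>x. f x + g x) x v = dir_deriv f x v + dir_deriv g x v"
  by (rule ddI) (auto intro!: derivative_eq_intros polyfn_has_dd)

lemma dir_deriv_diff: "polyfn I f \<Longrightarrow> polyfn I g \<Longrightarrow> dir_deriv (\<lambda>x. f x - g x) x v = dir_deriv f x v - dir_deriv g x v"
  by (rule ddI) (auto intro!: derivative_eq_intros polyfn_has_dd)

lemma dir_deriv_mult: "polyfn I f \<Longrightarrow> polyfn I g \<Longrightarrow> dir_deriv (\<lambda>x. f x * g x) x v = dir_deriv f x v * g x + f x * dir_deriv g x v"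
  by (rule ddI) (auto intro!: derivative_eq_intros polyfn_has_dd)

lemma dir_deriv_cmult: "polyfn I g \<Longrightarrow> dir_deriv (\<lambda>x. c * g x) x v = c * dir_deriv g x v"
  by (rule ddI) (auto intro!: derivative_eq_intros polyfn_has_dd)

lemma dir_deriv_sum: "(\<And>a. a \<in> A \<Longrightarrow> polyfn I (f a)) \<Longrightarrow> dir_deriv (\<lambda>x. \<Sum>a\<in>A. f a x) x v = (\<Sum>a\<in>A. dir_deriv (f a) x v)"
  by (rule ddI) (auto intro!: derivative_eq_intros polyfn_has_dd)

text \<open>Hadamard's expansion, by induction with
  \<open>f g - f0 g0 = (f - f0) g + f0 (g - g0)\<close>. Being an exact identity, it yields
  linearity of the directional derivative in \<open>v\<close> and, for the inverse map, an exact
  linear system for the difference quotients.\<close>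

lemma polyfn_hadamard:
  assumes "finite I" "polyfn I f"
  shows "\<exists>D. (\<forall>i. polyfn I (D i)) \<and> (\<forall>x. f x - f x0 = (\<Sum>i\<in>I. (x i - x0 i) * D i x))"
  using assms(2)
proof (induction rule: polyfn_induct)
  case (const c)
  show ?case by (intro exI[of _ "\<lambda>i x. 0"]) auto
next
  case (var k)
  show ?case
  proof (intro exI[of _ "\<lambda>i x. if i = k then 1 else 0"] conjI allI)
    show "x k - x0 k = (\<Sum>i\<in>I. (x i - x0 i) * (if i = k then 1 else 0))" for x
      using var assms(1) by (simp add: if_distrib cong: if_cong)
  qed auto
next
  case (add f g)
  then obtain D E where "\<forall>i. polyfn I (D i)" "\<forall>x. f x - f x0 = (\<Sum>i\<in>I. (x i - x0 i) * D i x)"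
    "\<forall>i. polyfn I (E i)" "\<forall>x. g x - g x0 = (\<Sum>i\<in>I. (x i - x0 i) * E i x)" by (elim exE conjE) blast
  then show ?case
    by (intro exI[of _ "\<lambda>i x. D i x + E i x"])
      (auto simp: algebra_simps sum.distrib sum_subtractf)
next
  case (mult f g)
  obtain D where D: "\<And>i. polyfn I (D i)" "\<And>x. f x - f x0 = (\<Sum>i\<in>I. (x i - x0 i) * D i x)"
    using mult.IH(1) by blast
  obtain E where E: "\<And>i. polyfn I (E i)" "\<And>x. g x - g x0 = (\<Sum>i\<in>I. (x i - x0 i) * E i x)"
    using mult.IH(2) by blast
  show ?case
  proof (intro exI[of _ "\<lambda>i x. D i x * g x + f x0 * E i x"] conjI allI)
    show "polyfn I (\<lambda>x. D i x * g x + f x0 * E i x)" for i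
      by (intro polyfn_add polyfn_mult D E mult polyfn_const)
    fix x
    have "f x * g x - f x0 * g x0 = (f x - f x0) * g x + f x0 * (g x - g x0)"
      by (simp add: algebra_simps)
    also have "\<dots> = (\<Sum>i\<in>I. (x i - x0 i) * (D i x * g x + f x0 * E i x))"
      unfolding D(2) E(2) sum_distrib_left sum_distrib_right sum.distrib[symmetric]
      by (intro sum.cong) (auto simp: algebra_simps)
    finally show "f x * g x - f x0 * g x0 = (\<Sum>i\<in>I. (x i - x0 i) * (D i x * g x + f x0 * E i x))" .
  qed
qed

lemma dir_deriv_hadamard:
  assumes "finite I" "\<And>i. polyfn I (D i)" "\<And>x. f x - f x0 = (\<Sum>i\<in>I. (x i - x0 i) * D i x)"
  shows "dir_deriv f x0 v = (\<Sum>i\<in>I. v i * D i x0)"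
proof (rule ddI)
  have *: "f (\<lambda>i. x0 i + s * v i) = f x0 + s * (\<Sum>i\<in>I. v i * D i (\<lambda>i. x0 i + s * v i))" for s
    using assms(3)[of "\<lambda>i. x0 i + s * v i"]
    by (simp add: sum_distrib_left algebra_simps)
  show "((\<lambda>s. f (\<lambda>i. x0 i + s * v i)) has_field_derivative (\<Sum>i\<in>I. v i * D i x0)) (at 0)"
    unfolding * by (auto intro!: derivative_eq_intros polyfn_has_dd[OF assms(2)])
qed

lemma dir_deriv_linear:
  assumes "finite I" "polyfn I f"
  shows "dir_deriv f x v = (\<Sum>i\<in>I. v i * dir_deriv f x (\<lambda>j. if j = i then 1 else 0))"
proof -
  obtain D where D: "\<And>i. polyfn I (D i)" "\<And>y. f y - f x = (\<Sum>i\<in>I. (y i - x i) * D i y)"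
    using polyfn_hadamard[OF assms, of x] by blast
  show ?thesis
    unfolding dir_deriv_hadamard[OF assms(1) D]
    using assms(1) by (intro sum.cong refl) (simp add: if_distrib[of "\<lambda>a. a * _"] cong: if_cong)
qed

text \<open>Trivial kernel of the derivative at every point; for finite \<open>I\<close> this is
  invertibility of the Jacobian matrix. Coordinates outside \<open>I\<close> carry no information,
  hence the conclusion only on \<open>I\<close>, here and in \<open>Inj\<close>.\<close>

definition Keller :: "'i set \<Rightarrow> ('i \<Rightarrow> ('i \<Rightarrow> complex) \<Rightarrow> complex) \<Rightarrow> bool" where
  "Keller I F \<longleftrightarrow> (\<forall>x v. (\<forall>r\<in>I. dir_deriv (F r) x v = 0) \<longrightarrow> (\<forall>i\<in>I. v i = 0))"

definition Inj :: "'i set \<Rightarrow> ('i \<Rightarrow> ('i \<Rightarrow> complex) \<Rightarrow> complex) \<Rightarrow> bool" where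
  "Inj I F \<longleftrightarrow> (\<forall>x y. (\<forall>r\<in>I. F r x = F r y) \<longrightarrow> (\<forall>i\<in>I. x i = y i))"

section \<open>Reduction to degree three\<close>

lemma KellerD: "Keller I F \<Longrightarrow> (\<And>r. r \<in> I \<Longrightarrow> dir_deriv (F r) x v = 0) \<Longrightarrow> i \<in> I \<Longrightarrow> v i = 0"
  unfolding Keller_def by blast

lemma InjD: "Inj I F \<Longrightarrow> (\<And>r. r \<in> I \<Longrightarrow> F r x = F r y) \<Longrightarrow> i \<in> I \<Longrightarrow> x i = y i"
  unfolding Inj_def by blast

text \<open>An enumeration of \<open>I\<close> turns the array into a square matrix; its trivial
  kernel makes the determinant nonzero, and the adjugate divided by the determinant is an inverse on
  both sides.\<close>

lemma lin_inverse:
  fixes m :: "'i \<Rightarrow> 'i \<Rightarrow> complex"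
  assumes "finite I"
    and inj: "\<And>v. (\<forall>i\<in>I. (\<Sum>j\<in>I. m i j * v j) = 0) \<Longrightarrow> \<forall>j\<in>I. v j = 0"
  shows "\<exists>m'. (\<forall>i\<in>I. \<forall>k\<in>I. (\<Sum>j\<in>I. m' i j * m j k) = of_bool (i = k)) \<and>
    (\<forall>i\<in>I. \<forall>k\<in>I. (\<Sum>j\<in>I. m i j * m' j k) = of_bool (i = k))"
proof -
  define n where "n = card I"
  have "\<exists>e. bij_betw e {0..<n} I"
    unfolding n_def by (rule ex_bij_betw_nat_finite[OF assms(1)])
  then obtain e where e: "bij_betw e {0..<n} I" by blast
  define g where "g = the_inv_into {0..<n} e"
  have ge: "g (e a) = a" if "a < n" for a
    using e that by (simp add: g_def bij_betw_def the_inv_into_f_f)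
  have eg: "e (g i) = i" "g i < n" if "i \<in> I" for i
    using e that by (auto simp: bij_betw_def ge)
  have g_eq: "g i = g k \<longleftrightarrow> i = k" if "i \<in> I" "k \<in> I" for i k
    using eg that by metis
  have sumI: "(\<Sum>j\<in>I. h j) = (\<Sum>a = 0..<n. h (e a))" for h :: "'i \<Rightarrow> complex"
    using sum.reindex_bij_betw[OF e] by metis
  define M where "M = Matrix.mat n n (\<lambda>(a, b). m (e a) (e b))"
  have M: "M \<in> carrier_mat n n" by (simp add: M_def)
  have "Determinant.det M \<noteq> 0"
  proof
    assume "Determinant.det M = 0"
    then obtain v where v: "v \<in> carrier_vec n" "v \<noteq> 0\<^sub>v n" "mult_mat_vec M v = 0\<^sub>v n"
      using det_0_iff_vec_prod_zero[OF M] by blast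
    have "(\<Sum>j\<in>I. m i j * vec_index v (g j)) = 0" if "i \<in> I" for i
    proof -
      have "vec_index (mult_mat_vec M v) (g i) = 0" using v(3) eg that by simp
      then have "(\<Sum>b = 0..<n. m i (e b) * vec_index v b) = 0"
        using v(1) eg that by (simp add: M_def scalar_prod_def)
      then show ?thesis unfolding sumI by (simp add: ge)
    qed
    then have "\<forall>j\<in>I. vec_index v (g j) = 0"
      using inj[of "\<lambda>j. vec_index v (g j)"] by blast
    then have "vec_index v a = 0" if "a < n" for a
    proof -
      have "e a \<in> I" using bij_betwE[OF e] that by auto
      then have "vec_index v (g (e a)) = 0" using \<open>\<forall>j\<in>I. _ j\<close> by blast
      then show ?thesis by (simp add: ge[OF that])
    qed
    then have "v = 0\<^sub>v n" using v(1) by (intro eq_vecI) auto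
    then show False using v(2) by blast
  qed
  define N where "N = (1 / Determinant.det M) \<cdot>\<^sub>m adj_mat M"
  have N: "N \<in> carrier_mat n n" using adj_mat(1)[OF M] by (simp add: N_def)
  have MN: "M * N = 1\<^sub>m n" "N * M = 1\<^sub>m n"
    using adj_mat[OF M] M \<open>Determinant.det M \<noteq> 0\<close>
    by (auto simp: N_def mult_smult_distrib[OF M] mult_smult_assoc_mat)
  show ?thesis
  proof (intro exI[of _ "\<lambda>i j. N $$ (g i, g j)"] conjI ballI)
    fix i k assume ik: "i \<in> I" "k \<in> I"
    have "(N * M) $$ (g i, g k) = of_bool (i = k)" "(M * N) $$ (g i, g k) = of_bool (i = k)"
      unfolding MN using eg ik g_eq by auto
    then show "(\<Sum>j\<in>I. N $$ (g i, g j) * m j k) = of_bool (i = k)"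
      "(\<Sum>j\<in>I. m i j * N $$ (g j, g k)) = of_bool (i = k)"
      using M N eg ik by (auto simp: sumI ge scalar_prod_def M_def)
  qed
qed

lemma dir_deriv_sum2:
  assumes "\<And>a b. a \<in> A \<Longrightarrow> b \<in> B \<Longrightarrow> polyfn I (f a b)"
  shows "dir_deriv (\<lambda>x. \<Sum>a\<in>A. \<Sum>b\<in>B. f a b x) x v = (\<Sum>a\<in>A. \<Sum>b\<in>B. dir_deriv (f a b) x v)"
  using assms by (subst dir_deriv_sum[where I = I]) (auto intro!: polyfn_sum dir_deriv_sum[where I = I] sum.cong)

text \<open>Each nonconstant monomial gives up one variable, and its cofactor has degree lower by
  one. For a product, \<open>f g = c c' + sum x_i (q_i g + c q'_i)\<close>; a factor with degree
  bound 0 is constant and is treated separately, since its bound cannot drop.\<close>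

lemma poly_deg_Suc_decomp:
  assumes "finite I"
  shows "poly_deg I d f \<Longrightarrow> d = Suc d' \<Longrightarrow>
    \<exists>c q. (\<forall>i. poly_deg I d' (q i)) \<and> (\<forall>x. f x = c + (\<Sum>i\<in>I. x i * q i x))"
proof (induction arbitrary: d' rule: poly_deg.induct)
  case (poly_deg_const d c)
  show ?case by (intro exI[of _ c] exI[of _ "\<lambda>i x. 0"]) (auto intro: poly_deg.poly_deg_const)
next
  case (poly_deg_var k d)
  show ?case
    using poly_deg_var assms
    by (intro exI[of _ 0] exI[of _ "\<lambda>i x. if i = k then 1 else 0"])
      (auto simp: if_distrib intro: poly_deg.poly_deg_const cong: if_cong)
next
  case (poly_deg_add d f g)
  obtain c q where q: "\<And>i. poly_deg I d' (q i)" "\<And>x. f x = c + (\<Sum>i\<in>I. x i * q i x)"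
    using poly_deg_add.IH(1) poly_deg_add.prems by blast
  obtain c' q' where q': "\<And>i. poly_deg I d' (q' i)" "\<And>x. g x = c' + (\<Sum>i\<in>I. x i * q' i x)"
    using poly_deg_add.IH(2) poly_deg_add.prems by blast
  show ?case
    by (intro exI[of _ "c + c'"] exI[of _ "\<lambda>i x. q i x + q' i x"])
      (auto simp: q' q(2) distrib_left sum.distrib intro: poly_deg.poly_deg_add q)
next
  case (poly_deg_mult a f b g)
  have g: "\<exists>c q. (\<forall>i. poly_deg I d' (q i)) \<and> (\<forall>x. g x = c + (\<Sum>i\<in>I. x i * q i x))"
  proof (cases b)
    case 0
    then show ?thesis
      using poly_deg_0[OF poly_deg_mult.hyps(2) 0, of _ undefined]
      by (intro exI[of _ "g undefined"] exI[of _ "\<lambda>i x. 0"]) (auto intro: poly_deg.poly_deg_const)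
  next
    case (Suc b')
    then obtain c q where "\<And>i. poly_deg I b' (q i)" "\<And>x. g x = c + (\<Sum>i\<in>I. x i * q i x)"
      using poly_deg_mult.IH(2) by blast
    moreover have "b' \<le> d'" using Suc poly_deg_mult.prems by simp
    ultimately show ?thesis by (meson poly_deg_mono)
  qed
  show ?case
  proof (cases a)
    case 0
    obtain c q where q: "\<And>i. poly_deg I d' (q i)" "\<And>x. g x = c + (\<Sum>i\<in>I. x i * q i x)"
      using g by blast
    have f: "f x = f undefined" for x using poly_deg_0[OF poly_deg_mult.hyps(1) 0] .
    have "f x * g x = f undefined * c + (\<Sum>i\<in>I. x i * (f undefined * q i x))" for x
      unfolding q(2) by (subst f) (simp add: distrib_left sum_distrib_left mult.left_commute)
    then show ?thesis
      by (intro exI[of _ "f undefined * c"] exI[of _ "\<lambda>i x. f undefined * q i x"])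
        (auto intro: poly_deg_cmult q(1))
  next
    case (Suc a')
    then obtain c q where q: "\<And>i. poly_deg I a' (q i)" "\<And>x. f x = c + (\<Sum>i\<in>I. x i * q i x)"
      using poly_deg_mult.IH(1) by blast
    obtain c' q' where q': "\<And>i. poly_deg I d' (q' i)" "\<And>x. g x = c' + (\<Sum>i\<in>I. x i * q' i x)"
      using g by blast
    have "a' + b = d'" using Suc poly_deg_mult.prems by simp
    then have "poly_deg I d' (\<lambda>x. q i x * g x + c * q' i x)" for i
      using poly_deg_mult.hyps(2) q(1) q'(1) by (intro poly_deg_add poly_deg_cmult) (metis poly_deg.poly_deg_mult)+
    moreover have "f x * g x = c * c' + (\<Sum>i\<in>I. x i * (q i x * g x + c * q' i x))" for x
    proof -
      have "f x * g x = c * g x + (\<Sum>i\<in>I. x i * q i x) * g x"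
        unfolding q(2) by (simp add: distrib_right)
      also have "c * g x = c * c' + (\<Sum>i\<in>I. x i * (c * q' i x))"
        unfolding q'(2) by (simp add: distrib_left sum_distrib_left mult.left_commute)
      finally show ?thesis
        by (simp add: distrib_left sum.distrib sum_distrib_right mult.assoc)
    qed
    ultimately show ?thesis
      by (intro exI[of _ "c * c'"] exI[of _ "\<lambda>i x. q i x * g x + c * q' i x"]) blast
  qed
qed

lemma poly_deg_Suc_Suc_decomp:
  assumes "finite I" "poly_deg I (Suc (Suc d)) f"
  shows "\<exists>c b q. (\<forall>i k. poly_deg I d (q i k)) \<and>
    (\<forall>x. f x = c + (\<Sum>i\<in>I. b i * x i) + (\<Sum>i\<in>I. \<Sum>k\<in>I. x i * x k * q i k x))"
proof -
  obtain c q where q: "\<And>i. poly_deg I (Suc d) (q i)" "\<And>x. f x = c + (\<Sum>i\<in>I. x i * q i x)"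
    using poly_deg_Suc_decomp[OF assms refl] by blast
  define P where "P i b p \<longleftrightarrow> (\<forall>k. poly_deg I d (p k)) \<and> (\<forall>x. q i x = b + (\<Sum>k\<in>I. x k * p k x))"
    for i b p
  have "\<exists>b p. P i b p" for i
    unfolding P_def by (rule poly_deg_Suc_decomp[OF assms(1) q(1) refl])
  then obtain b p where "\<And>i. P i (b i) (p i)" by metis
  then have p: "\<And>i k. poly_deg I d (p i k)" "\<And>i x. q i x = b i + (\<Sum>k\<in>I. x k * p i k x)"
    unfolding P_def by blast+
  have "f x = c + (\<Sum>i\<in>I. b i * x i) + (\<Sum>i\<in>I. \<Sum>k\<in>I. x i * x k * p i k x)" for x
    unfolding q(2) p(2) by (simp add: distrib_left sum.distrib sum_distrib_left mult_ac)
  then show ?thesis using p(1) by blast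
qed

text \<open>The index type is a parameter because every reduction deduces the claim at one type from
  the claim at a larger one.\<close>

definition Keller_inj :: "'i itself \<Rightarrow> nat \<Rightarrow> bool" where
  "Keller_inj _ d \<longleftrightarrow>
    (\<forall>(I :: 'i set) F. finite I \<longrightarrow> (\<forall>r\<in>I. poly_deg I d (F r)) \<longrightarrow> Keller I F \<longrightarrow> Inj I F)"

lemma Keller_injD:
  "Keller_inj TYPE('i) d \<Longrightarrow> finite I \<Longrightarrow> (\<And>r. r \<in> I \<Longrightarrow> poly_deg I d (F r)) \<Longrightarrow> Keller I F \<Longrightarrow> Inj (I :: 'i set) F"
  unfolding Keller_inj_def by blast

text \<open>Finite index sets embed into \<open>nat\<close>, so the claim at \<open>nat\<close>
  serves all index types. This lets the degree step, which asks for the claim at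
  \<open>nat ext\<close>, be iterated.\<close>

lemma Keller_inj_reindex:
  assumes "Keller_inj TYPE(nat) d"
  shows "Keller_inj TYPE('i) d"
  unfolding Keller_inj_def
proof (intro allI impI)
  fix I :: "'i set" and F
  assume fin: "finite I" and F: "\<forall>r\<in>I. poly_deg I d (F r)" and K: "Keller I F"
  obtain \<phi> :: "'i \<Rightarrow> nat" where \<phi>: "inj_on \<phi> I"
    using finite_imp_inj_to_nat_seg[OF fin] by blast
  define \<psi> where "\<psi> = the_inv_into I \<phi>"
  have \<psi>: "\<psi> (\<phi> i) = i" if "i \<in> I" for i
    using \<phi> that by (simp add: \<psi>_def the_inv_into_f_f)
  define G where "G k x = F (\<psi> k) (\<lambda>i. x (\<phi> i))" for k and x :: "nat \<Rightarrow> complex"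
  have "poly_deg (\<phi> ` I) d (G k)" if "k \<in> \<phi> ` I" for k
  proof -
    have "poly_deg I d (F (\<psi> k))" using that \<psi> F by auto
    then have "poly_deg (\<phi> ` I) (d * 1) (\<lambda>x. F (\<psi> k) (\<lambda>i. x (\<phi> i)))"
      by (rule poly_deg_subst) (auto intro: poly_deg_var)
    then show ?thesis unfolding G_def by simp
  qed
  moreover have "Keller (\<phi> ` I) G"
    unfolding Keller_def
  proof (intro allI impI)
    fix x v :: "nat \<Rightarrow> complex"
    assume *: "\<forall>r\<in>\<phi> ` I. dir_deriv (G r) x v = 0"
    have "dir_deriv (F r) (\<lambda>i. x (\<phi> i)) (\<lambda>i. v (\<phi> i)) = 0" if "r \<in> I" for r
      using * that \<psi> by (auto simp: G_def dir_deriv_def)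
    then have "v (\<phi> i) = 0" if "i \<in> I" for i
      using KellerD[OF K, of "\<lambda>i. x (\<phi> i)" "\<lambda>i. v (\<phi> i)"] that by blast
    then show "\<forall>i\<in>\<phi> ` I. v i = 0" by blast
  qed
  ultimately have "Inj (\<phi> ` I) G"
    using fin by (intro Keller_injD[OF assms]) auto
  show "Inj I F"
    unfolding Inj_def
  proof (intro allI impI)
    fix x y assume xy: "\<forall>r\<in>I. F r x = F r y"
    have G: "G (\<phi> r) (\<lambda>k. z (\<psi> k)) = F r z" if "r \<in> I" for r z
      using poly_deg_cong[OF F[rule_format, OF that], of "\<lambda>i. z (\<psi> (\<phi> i))" z] that \<psi> by (simp add: G_def)
    have "x (\<psi> k) = y (\<psi> k)" if "k \<in> \<phi> ` I" for k
      by (rule InjD[OF \<open>Inj (\<phi> ` I) G\<close>, of "\<lambda>k. x (\<psi> k)" "\<lambda>k. y (\<psi> k)"])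
        (use that G xy in auto)
    then show "\<forall>i\<in>I. x i = y i" using \<psi> by force
  qed
qed

datatype 'i ext = Old 'i | Quad 'i 'i | Cofac 'i 'i 'i

text \<open>Degree reduction of Bass, Connell and Wright: \<open>F \<times> id\<close> is composed with the automorphism
  adding \<open>x\<^sub>i x\<^sub>k\<close> and \<open>q\<^sub>r\<^sub>i\<^sub>k(x)\<close> to new variables and with one subtracting their products.\<close>
lemma Keller_inj_Suc:
  assumes KI: "Keller_inj TYPE('i ext) d" and d: "3 \<le> d"
  shows "Keller_inj TYPE('i) (Suc d)"
  unfolding Keller_inj_def
proof (intro allI impI)
  fix I :: "'i set" and F
  assume fin: "finite I" and F: "\<forall>r\<in>I. poly_deg I (Suc d) (F r)" and K: "Keller I F"
  define P where "P r c b q \<longleftrightarrow> (\<forall>i k. poly_deg I (d - 1) (q i k)) \<and>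
    (\<forall>x. F r x = c + (\<Sum>i\<in>I. b i * x i) + (\<Sum>i\<in>I. \<Sum>k\<in>I. x i * x k * q i k x))" for r c b q
  have "\<exists>c b q. P r c b q" if "r \<in> I" for r
    unfolding P_def using poly_deg_Suc_Suc_decomp[OF fin, of "d - 1"] F that d by simp
  then obtain c b q where "\<And>r. r \<in> I \<Longrightarrow> P r (c r) (b r) (q r)" by metis
  then have q: "\<And>r i k. r \<in> I \<Longrightarrow> poly_deg I (d - 1) (q r i k)"
    and Fq: "\<And>r x. r \<in> I \<Longrightarrow> F r x = c r + (\<Sum>i\<in>I. b r i * x i) +
      (\<Sum>i\<in>I. \<Sum>k\<in>I. x i * x k * q r i k x)"
    unfolding P_def by blast+
  define J where "J = Old ` I \<union> (\<lambda>(i, k). Quad i k) ` (I \<times> I) \<union> (\<lambda>(r, i, k). Cofac r i k) ` (I \<times> I \<times> I)"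
  have finJ: "finite J" using fin by (simp add: J_def)
  have J: "Old i \<in> J \<longleftrightarrow> i \<in> I" "Quad i k \<in> J \<longleftrightarrow> i \<in> I \<and> k \<in> I"
    "Cofac r i k \<in> J \<longleftrightarrow> r \<in> I \<and> i \<in> I \<and> k \<in> I" for r i k
    by (auto simp: J_def image_iff)
  \<comment> \<open>\<open>G (Old r)\<close> is \<open>F_r\<close> minus the sum of the products
    \<open>(x_Quad + x_i x_k) (x_Cofac + q_rik)\<close>, expanded. The terms
    \<open>x_i x_k q_rik\<close>, which alone may reach degree \<open>d + 1\<close>, cancel; apart
    from the affine part, degrees at most \<open>2\<close>, \<open>1 + (d - 1)\<close> and
    \<open>3\<close> remain, whence the hypothesis \<open>3 \<le> d\<close>.\<close>
  define G where "G e = (case e of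
      Old r \<Rightarrow> (\<lambda>x. c r + (\<Sum>i\<in>I. b r i * x (Old i)) - (\<Sum>i\<in>I. \<Sum>k\<in>I.
        x (Quad i k) * x (Cofac r i k) + x (Quad i k) * q r i k (\<lambda>i. x (Old i)) +
        x (Old i) * x (Old k) * x (Cofac r i k)))
    | Quad i k \<Rightarrow> (\<lambda>x. x (Quad i k) + x (Old i) * x (Old k))
    | Cofac r i k \<Rightarrow> (\<lambda>x. x (Cofac r i k) + q r i k (\<lambda>i. x (Old i))))" for e
  have G_Old: "G (Old r) = (\<lambda>x. F r (\<lambda>i. x (Old i)) - (\<Sum>i\<in>I. \<Sum>k\<in>I. G (Quad i k) x * G (Cofac r i k) x))"
    if "r \<in> I" for r
    unfolding Fq[OF that] G_def
    by (rule ext) (simp add: sum.distrib distrib_left distrib_right add_ac)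
  have old: "poly_deg J e (\<lambda>x. f (\<lambda>i. x (Old i)))" if "poly_deg I e f" for f e
  proof -
    have "poly_deg J (e * 1) (\<lambda>x. f (\<lambda>i. x (Old i)))"
      using that by (rule poly_deg_subst) (auto simp: J intro: poly_deg_var)
    then show ?thesis by simp
  qed
  have v: "poly_deg J 1 (\<lambda>x. x j)" if "j \<in> J" for j
    using that by (rule poly_deg_var) (rule order_refl)
  have v2: "poly_deg J 2 (\<lambda>x. x j * x k)" if "j \<in> J" "k \<in> J" for j k
    by (rule poly_deg_mult_le[OF v v]) (use that in auto)
  have PDG: "\<forall>j\<in>J. poly_deg J d (G j)"
  proof
    fix j assume "j \<in> J"
    show "poly_deg J d (G j)"
    proof (cases j)
      case (Old r)
      then have r: "r \<in> I" using \<open>j \<in> J\<close> J by simp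
      have "poly_deg J d (\<lambda>x. x (Quad i k) * x (Cofac r i k))" if "i \<in> I" "k \<in> I" for i k
        by (rule poly_deg_mult_le[OF v v]) (use that r J d in auto)
      moreover have "poly_deg J d (\<lambda>x. x (Quad i k) * q r i k (\<lambda>i. x (Old i)))" if "i \<in> I" "k \<in> I" for i k
        by (rule poly_deg_mult_le[OF v old[OF q]]) (use that r J d in auto)
      moreover have "poly_deg J d (\<lambda>x. x (Old i) * x (Old k) * x (Cofac r i k))" if "i \<in> I" "k \<in> I" for i k
        by (rule poly_deg_mult_le[OF v2 v]) (use that r J d in auto)
      moreover have "poly_deg J d (\<lambda>x. b r i * x (Old i))" if "i \<in> I" for i
        by (rule poly_deg_cmult, rule poly_deg_var) (use that J d in auto)
      ultimately show ?thesis
        unfolding Old G_def by (simp, intro poly_deg_diff poly_deg_add poly_deg_sum poly_deg_const) auto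
    next
      case (Quad i k)
      have "poly_deg J d (\<lambda>x. x (Old i) * x (Old k))"
        by (rule poly_deg_mult_le[OF v v]) (use Quad J \<open>j \<in> J\<close> d in auto)
      moreover have "poly_deg J d (\<lambda>x. x (Quad i k))"
        by (rule poly_deg_var) (use Quad J \<open>j \<in> J\<close> d in auto)
      ultimately show ?thesis unfolding Quad G_def by (simp add: poly_deg_add)
    next
      case (Cofac r i k)
      then have "poly_deg J d (\<lambda>x. q r i k (\<lambda>i. x (Old i)))"
        using poly_deg_mono[OF old[OF q]] J \<open>j \<in> J\<close> by simp
      moreover have "poly_deg J d (\<lambda>x. x (Cofac r i k))"
        by (rule poly_deg_var) (use Cofac J \<open>j \<in> J\<close> d in auto)
      ultimately show ?thesis unfolding Cofac G_def by (simp add: poly_deg_add)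
    qed
  qed
  have PFG: "polyfn J (G j)" if "j \<in> J" for j using PDG that polyfn_I by blast
  have PFold: "polyfn J (\<lambda>x. F r (\<lambda>i. x (Old i)))" if "r \<in> I" for r
    using old F that polyfn_I by blast
  have "Keller J G"
    unfolding Keller_def
  proof (intro allI impI)
    fix x w
    assume dG: "\<forall>r\<in>J. dir_deriv (G r) x w = 0"
    have "dir_deriv (F r) (\<lambda>i. x (Old i)) (\<lambda>i. w (Old i)) = 0" if r: "r \<in> I" for r
    proof -
      \<comment> \<open>Both factors of each product have derivative zero by \<open>dG\<close>, so
        the product rule leaves only the derivative of \<open>F r\<close>.\<close>
      have "dir_deriv (G (Old r)) x w = dir_deriv (\<lambda>x. F r (\<lambda>i. x (Old i))) x w -
          (\<Sum>i\<in>I. \<Sum>k\<in>I. dir_deriv (G (Quad i k)) x w * G (Cofac r i k) x + G (Quad i k) x * dir_deriv (G (Cofac r i k)) x w)"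
      proof -
        have "polyfn J (\<lambda>x. G (Quad i k) x * G (Cofac r i k) x)" if "i \<in> I" "k \<in> I" for i k
          using that r J by (intro polyfn_mult PFG) auto
        moreover have "dir_deriv (\<lambda>x. G (Quad i k) x * G (Cofac r i k) x) x w =
            dir_deriv (G (Quad i k)) x w * G (Cofac r i k) x + G (Quad i k) x * dir_deriv (G (Cofac r i k)) x w"
          if "i \<in> I" "k \<in> I" for i k
          using that r J by (intro dir_deriv_mult[where I = J] PFG) auto
        ultimately show ?thesis
          unfolding G_Old[OF r] using PFold[OF r]
          by (simp add: dir_deriv_diff[where I = J] dir_deriv_sum2[where I = J] polyfn_sum)
      qed
      then have "dir_deriv (\<lambda>x. F r (\<lambda>i. x (Old i))) x w = 0"
        using dG r J by simp
      then show ?thesis by (simp add: dir_deriv_def)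
    qed
    then have w: "w (Old i) = 0" if "i \<in> I" for i
      using KellerD[OF K, of "\<lambda>i. x (Old i)" "\<lambda>i. w (Old i)"] that by blast
    show "\<forall>j\<in>J. w j = 0"
    proof
      fix j assume "j \<in> J"
      show "w j = 0"
      proof (cases j)
        case (Old r)
        then show ?thesis using w \<open>j \<in> J\<close> J by simp
      next
        case (Quad i k)
        have "dir_deriv (G j) x w = w (Quad i k) + (w (Old i) * x (Old k) + x (Old i) * w (Old k))"
          unfolding Quad G_def using Quad \<open>j \<in> J\<close> J
          by (simp add: dir_deriv_add[where I = J] dir_deriv_mult[where I = J] polyfn_mult)
        then show ?thesis using Quad \<open>j \<in> J\<close> J w dG by auto
      next
        case (Cofac r i k)
        have Q: "polyfn J (\<lambda>x. q r i k (\<lambda>i. x (Old i)))" "polyfn I (q r i k)"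
          using old[OF q] q Cofac \<open>j \<in> J\<close> J polyfn_I by metis+
        have "dir_deriv (G j) x w = w (Cofac r i k) + dir_deriv (\<lambda>x. q r i k (\<lambda>i. x (Old i))) x w"
          unfolding Cofac G_def using Cofac \<open>j \<in> J\<close> J Q by (simp add: dir_deriv_add[where I = J])
        also have "dir_deriv (\<lambda>x. q r i k (\<lambda>i. x (Old i))) x w =
            dir_deriv (q r i k) (\<lambda>i. x (Old i)) (\<lambda>i. w (Old i))"
          by (simp add: dir_deriv_def)
        also have "\<dots> = 0" by (subst dir_deriv_linear[OF fin Q(2)]) (simp add: w)
        finally show ?thesis using Cofac \<open>j \<in> J\<close> dG by auto
      qed
    qed
  qed
  then have inj: "Inj J G" using finJ PDG by (intro Keller_injD[OF KI]) auto
  show "Inj I F"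
    unfolding Inj_def
  proof (intro allI impI)
    fix x y assume xy: "\<forall>r\<in>I. F r x = F r y"
    \<comment> \<open>The new coordinates are chosen to make all \<open>Quad\<close> and
      \<open>Cofac\<close> components vanish; then the \<open>Old\<close> components reproduce
      \<open>F\<close>.\<close>
    define l where "l = (\<lambda>x e. case e of Old i \<Rightarrow> x i | Quad i k \<Rightarrow> - x i * x k | Cofac r i k \<Rightarrow> - q r i k x)"
    have l0: "G (Quad i k) (l z) = 0" "G (Cofac r i k) (l z) = 0" for r i k z
      by (auto simp: G_def l_def)
    then have "G (Old r) (l z) = F r z" if "r \<in> I" for r z
      unfolding G_Old[OF that] by (simp add: l_def)
    then have "\<forall>j\<in>J. G j (l x) = G j (l y)"
      using xy l0 by (auto simp: J_def)
    then have "l x (Old i) = l y (Old i)" if "i \<in> I" for i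
      using InjD[OF inj, of "l x" "l y"] J(1) that by blast
    then show "\<forall>i\<in>I. x i = y i" by (simp add: l_def)
  qed
qed

lemma Keller_inj_all_degrees:
  assumes "Keller_inj TYPE(nat) 3"
  shows "Keller_inj TYPE(nat) d"
proof (cases "3 \<le> d")
  case True
  then show ?thesis
    by (induction d rule: dec_induct) (auto intro: assms Keller_inj_Suc Keller_inj_reindex)
next
  case False
  then have "poly_deg I 3 f" if "poly_deg I d f" for I and f :: "(nat \<Rightarrow> complex) \<Rightarrow> complex"
    using poly_deg_mono[OF that] by simp
  then show ?thesis unfolding Keller_inj_def by (auto intro: Keller_injD[OF assms])
qed

section \<open>Reduction to cubic linear maps\<close>

text \<open>Cubic forms written as sums of cubes of linear forms: each such cube can become a
  coordinate of its own in a cubic linear map of larger dimension.\<close>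

inductive cubes :: "'i set \<Rightarrow> (('i \<Rightarrow> complex) \<Rightarrow> complex) \<Rightarrow> bool" for I where
  cubes_0: "cubes I (\<lambda>x. 0)"
| cubes_step: "cubes I f \<Longrightarrow> cubes I (\<lambda>x. f x + c * (\<Sum>i\<in>I. l i * x i) ^ 3)"

lemma cubes_add: "cubes I g \<Longrightarrow> cubes I f \<Longrightarrow> cubes I (\<lambda>x. f x + g x)"
proof (induction rule: cubes.induct)
  case (cubes_step g c l)
  then show ?case
    using cubes.cubes_step[of I "\<lambda>x. f x + g x" c l] by (simp add: add.assoc)
qed simp

lemma cubes_cmult: "cubes I f \<Longrightarrow> cubes I (\<lambda>x. a * f x)"
proof (induction rule: cubes.induct)
  case (cubes_step f c l)
  then show ?case
    using cubes.cubes_step[of I "\<lambda>x. a * f x" "a * c" l] by (simp add: distrib_left mult.assoc)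
qed (simp add: cubes_0)

lemma cubes_sum: "(\<And>a. a \<in> A \<Longrightarrow> cubes I (f a)) \<Longrightarrow> cubes I (\<lambda>x. \<Sum>a\<in>A. f a x)"
  by (induction A rule: infinite_finite_induct) (simp_all add: cubes_0 cubes_add)

lemma cubes_cube: "cubes I (\<lambda>x. c * (\<Sum>i\<in>I. l i * x i) ^ 3)"
  using cubes_step[OF cubes_0, of I c l] by simp

text \<open>Polarisation: \<open>24 a b c = (a + b + c)^3 - (a + b - c)^3 - (a - b + c)^3 - (- a + b
  + c)^3\<close>. The coefficients of \<open>L\<close> are sums of \<open>of_bool\<close> terms
  because the three indices may coincide.\<close>

lemma cubes_triple:
  assumes "finite I" "i \<in> I" "j \<in> I" "k \<in> I"
  shows "cubes I (\<lambda>x. x i * x j * x k)"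
proof -
  define L where "L = (\<lambda>(a :: complex) b c (x :: 'a \<Rightarrow> complex).
    \<Sum>n\<in>I. (a * of_bool (n = i) + b * of_bool (n = j) + c * of_bool (n = k)) * x n)"
  have L: "L a b c x = a * x i + b * x j + c * x k" for a b c x
  proof -
    have "L a b c x = (\<Sum>n\<in>I. (if n = i then a * x n else 0) + (if n = j then b * x n else 0) +
        (if n = k then c * x n else 0))"
      unfolding L_def by (intro sum.cong refl) (auto simp: algebra_simps)
    then show ?thesis using assms by (simp add: sum.distrib)
  qed
  have polar: "x i * x j * x k = (1 / 24) * L 1 1 1 x ^ 3 + (- 1 / 24) * L 1 1 (- 1) x ^ 3 +
      (- 1 / 24) * L 1 (- 1) 1 x ^ 3 + (- 1 / 24) * L (- 1) 1 1 x ^ 3" for x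
    unfolding L by (simp add: power3_eq_cube field_simps)
  have "cubes I (\<lambda>x. c * L a b d x ^ 3)" for a b c d
    unfolding L_def by (rule cubes_cube)
  then show ?thesis unfolding polar by (intro cubes_add)
qed

text \<open>The summand with index \<open>0\<close> vanishes; it serves to make the matrix \<open>B\<close> in the Druzkowski
  reduction surjective.\<close>
lemma cubes_repr:
  "cubes I f \<Longrightarrow> \<exists>n b (L :: nat \<Rightarrow> 'i \<Rightarrow> complex). b 0 = 1 \<and> L 0 = (\<lambda>_. 0) \<and>
    (\<forall>x. f x = (\<Sum>j\<le>(n::nat). b j * (\<Sum>i\<in>I. L j i * x i) ^ 3))"
proof (induction rule: cubes.induct)
  case cubes_0
  show ?case by (intro exI[of _ 0] exI[of _ "\<lambda>_. 1"] exI[of _ "\<lambda>_ _. 0"]) simp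
next
  case (cubes_step f c l)
  then obtain n b and L :: "nat \<Rightarrow> 'i \<Rightarrow> complex" where *: "b 0 = 1" "L 0 = (\<lambda>_. 0)"
    "\<And>x. f x = (\<Sum>j\<le>n. b j * (\<Sum>i\<in>I. L j i * x i) ^ 3)" by blast
  show ?case
    by (intro exI[of _ "Suc n"] exI[of _ "b(Suc n := c)"] exI[of _ "L(Suc n := l)"])
      (simp add: *)
qed

definition Cubic_inj :: "'i itself \<Rightarrow> bool" where
  "Cubic_inj _ \<longleftrightarrow> (\<forall>(I :: 'i set) H. finite I \<longrightarrow> (\<forall>r\<in>I. cubes I (H r)) \<longrightarrow>
    Keller I (\<lambda>r x. x r + H r x) \<longrightarrow> Inj I (\<lambda>r x. x r + H r x))"

lemma Cubic_injD:
  "Cubic_inj TYPE('i) \<Longrightarrow> finite I \<Longrightarrow> (\<And>r. r \<in> I \<Longrightarrow> cubes I (H r)) \<Longrightarrow>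
    Keller I (\<lambda>r x. x r + H r x) \<Longrightarrow> Inj (I :: 'i set) (\<lambda>r x. x r + H r x)"
  unfolding Cubic_inj_def by blast

datatype 'i hom = HX 'i | HY 'i | HT

text \<open>The homogeneous map is \<open>G(x, y, t) = (x + t Q(x) - t^2 y, y + C(x), t)\<close>.
  Eliminating \<open>y\<close> leaves \<open>x + t Q(x) + t^2 C(x)\<close>, which up to constants is
  \<open>F(t x) / t\<close> for \<open>t \<noteq> 0\<close> and the identity for
  \<open>t = 0\<close>. So the Keller property is inherited for every \<open>t\<close>, and
  \<open>F\<close> reappears at \<open>t = 1\<close>.\<close>

lemma cubic_homogenize:
  fixes I :: "'i set" and m :: "'i \<Rightarrow> 'i \<Rightarrow> 'i \<Rightarrow> complex"
    and p :: "'i \<Rightarrow> 'i \<Rightarrow> 'i \<Rightarrow> 'i \<Rightarrow> complex"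
  assumes CI: "Cubic_inj TYPE('i hom)" and fin: "finite I"
    and Q: "\<And>r x. Q r x = (\<Sum>i\<in>I. \<Sum>k\<in>I. m r i k * (x i * x k))"
    and C: "\<And>r x. C r x = (\<Sum>i\<in>I. \<Sum>k\<in>I. \<Sum>l\<in>I. p r i k l * (x i * x k * x l))"
    and F: "\<And>r x. r \<in> I \<Longrightarrow> F r x = c r + x r + Q r x + C r x"
    and K: "Keller I F"
  shows "Inj I F"
proof -
  define J where "J = HX ` I \<union> HY ` I \<union> {HT}"
  have finJ: "finite J" using fin by (simp add: J_def)
  have J: "HX i \<in> J \<longleftrightarrow> i \<in> I" "HY i \<in> J \<longleftrightarrow> i \<in> I" "HT \<in> J" for i
    by (auto simp: J_def)
  have Q_scale: "Q r (\<lambda>i. s * x i) = s^2 * Q r x" and C_scale: "C r (\<lambda>i. s * x i) = s^3 * C r x"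
    for r s x
    unfolding Q C by (simp_all add: sum_distrib_left power2_eq_square power3_eq_cube mult_ac)
  define H where "H e = (case e of
      HX r \<Rightarrow> (\<lambda>x. x HT * Q r (\<lambda>i. x (HX i)) - x HT * x HT * x (HY r))
    | HY r \<Rightarrow> (\<lambda>x. C r (\<lambda>i. x (HX i)))
    | HT \<Rightarrow> (\<lambda>x. 0))" for e
  have H3: "cubes J (H j)" if "j \<in> J" for j
  proof (cases j)
    case (HX r)
    have "H j = (\<lambda>x. (\<Sum>i\<in>I. \<Sum>k\<in>I. m r i k * (x HT * x (HX i) * x (HX k))) + (- 1) * (x HT * x HT * x (HY r)))"
      unfolding HX H_def by (rule ext) (simp add: Q sum_distrib_left mult_ac)
    moreover have "cubes J \<dots>"
      using J that HX by (intro cubes_add cubes_sum cubes_cmult cubes_triple finJ) auto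
    ultimately show ?thesis by simp
  next
    case (HY r)
    have "H j = (\<lambda>x. (\<Sum>i\<in>I. \<Sum>k\<in>I. \<Sum>l\<in>I. p r i k l * (x (HX i) * x (HX k) * x (HX l))))"
      unfolding HY H_def by (rule ext) (simp add: C)
    moreover have "cubes J \<dots>"
      using J that HY by (intro cubes_sum cubes_cmult cubes_triple finJ) auto
    ultimately show ?thesis by simp
  next
    case HT
    then show ?thesis by (simp add: H_def cubes_0)
  qed
  have PFQ: "polyfn I (Q r)" and PFC: "polyfn I (C r)" for r
    unfolding Q[abs_def] C[abs_def] by (intro polyfn_sum polyfn_mult polyfn_const polyfn_var; assumption)+
  have PFF: "polyfn I (F r)" if "r \<in> I" for r
    unfolding F[OF that, abs_def] using that PFQ PFC by (intro polyfn_add) auto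
  have PFXQ: "polyfn J (\<lambda>x. Q r (\<lambda>i. x (HX i)))" and PFXC: "polyfn J (\<lambda>x. C r (\<lambda>i. x (HX i)))" for r
    by (rule polyfn_subst[OF PFQ] polyfn_subst[OF PFC], simp add: J)+
  define G where "G = (\<lambda>r x. x r + H r x)"
  have "Keller J G"
    unfolding Keller_def
  proof (intro allI impI)
    fix x w
    assume dG: "\<forall>r\<in>J. dir_deriv (G r) x w = 0"
    define x' w' t where "x' = (\<lambda>i. x (HX i))" and "w' = (\<lambda>i. w (HX i))" and "t = x HT"
    have wT: "w HT = 0" using dG J(3) by (auto simp: G_def H_def)
    have wY: "w (HY r) = - dir_deriv (C r) x' w'" if "r \<in> I" for r
    proof -
      have "dir_deriv (G (HY r)) x w = w (HY r) + dir_deriv (\<lambda>x. C r (\<lambda>i. x (HX i))) x w"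
        unfolding G_def H_def using that J PFXC by (simp add: dir_deriv_add[where I = J])
      also have "dir_deriv (\<lambda>x. C r (\<lambda>i. x (HX i))) x w = dir_deriv (C r) x' w'"
        by (simp add: dir_deriv_def x'_def w'_def)
      finally show ?thesis using dG that J by (simp add: eq_neg_iff_add_eq_0)
    qed
    have wX: "w' r + t * dir_deriv (Q r) x' w' + t^2 * dir_deriv (C r) x' w' = 0" if "r \<in> I" for r
    proof -
      have "dir_deriv (G (HX r)) x w = w (HX r) + ((w HT * Q r x' + t * dir_deriv (\<lambda>x. Q r (\<lambda>i. x (HX i))) x w) -
          ((w HT * t + t * w HT) * x (HY r) + t * t * w (HY r)))"
        unfolding G_def H_def x'_def t_def using that J PFXQ
        by (simp add: dir_deriv_add[where I = J] dir_deriv_diff[where I = J] dir_deriv_mult[where I = J] polyfn_mult polyfn_diff)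
      also have "dir_deriv (\<lambda>x. Q r (\<lambda>i. x (HX i))) x w = dir_deriv (Q r) x' w'"
        by (simp add: dir_deriv_def x'_def w'_def)
      finally show ?thesis
        using dG that J by (simp add: wT wY w'_def power2_eq_square add.assoc)
    qed
    have w'0: "w' i = 0" if "i \<in> I" for i
    proof (cases "t = 0")
      case True
      then show ?thesis using wX[OF that] by simp
    next
      case False
      \<comment> \<open>By homogeneity the derivatives of \<open>Q\<close> and \<open>C\<close> at
        \<open>t x'\<close> acquire the factors \<open>t\<close> and \<open>t^2\<close> seen in
        \<open>wX\<close>, so \<open>w'\<close> lies in the kernel of the derivative of
        \<open>F\<close> at \<open>t x'\<close>.\<close>
      have "dir_deriv (F r) (\<lambda>i. t * x' i) w' = 0" if "r \<in> I" for r
      proof -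
        have arg: "(\<lambda>i. t * x' i + s * w' i) = (\<lambda>i. t * (x' i + (s / t) * w' i))" for s
          using False by (auto simp: field_simps)
        have D: "((\<lambda>s. f (\<lambda>i. x' i + (s / t) * w' i)) has_field_derivative dir_deriv f x' w' / t) (at 0)"
          if "polyfn I f" for f
          using DERIV_chain2[of "\<lambda>s. f (\<lambda>i. x' i + s * w' i)" "dir_deriv f x' w'" "\<lambda>s. s / t" 0 "1 / t"]
            polyfn_has_dd[OF that, of x' w'] DERIV_cdivide[OF DERIV_ident, of t 0] by simp
        have "dir_deriv (Q r) (\<lambda>i. t * x' i) w' = t * dir_deriv (Q r) x' w'"
          by (rule ddI, unfold arg Q_scale, rule DERIV_cong[OF DERIV_cmult[OF D[OF PFQ]]])
            (use False in \<open>simp add: power2_eq_square\<close>)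
        moreover have "dir_deriv (C r) (\<lambda>i. t * x' i) w' = t^2 * dir_deriv (C r) x' w'"
          by (rule ddI, unfold arg C_scale, rule DERIV_cong[OF DERIV_cmult[OF D[OF PFC]]])
            (use False in \<open>simp add: power2_eq_square power3_eq_cube\<close>)
        moreover have "dir_deriv (F r) z w' = w' r + dir_deriv (Q r) z w' + dir_deriv (C r) z w'" for z
          unfolding F[OF \<open>r \<in> I\<close>, abs_def] using PFQ PFC \<open>r \<in> I\<close>
          by (simp add: dir_deriv_add[where I = I] polyfn_add)
        ultimately show ?thesis using wX[OF that] by simp
      qed
      then show ?thesis using KellerD[OF K, of "\<lambda>i. t * x' i" w'] that by blast
    qed
    have "dir_deriv (C r) x' w' = 0" for r
      by (subst dir_deriv_linear[OF fin PFC]) (simp add: w'0)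
    then show "\<forall>j\<in>J. w j = 0"
      using wT wY w'0 by (auto simp: J_def w'_def)
  qed
  then have inj: "Inj J G"
    unfolding G_def using finJ H3 by (intro Cubic_injD[OF CI])
  show ?thesis
    unfolding Inj_def
  proof (intro allI impI)
    fix x y assume xy: "\<forall>r\<in>I. F r x = F r y"
    \<comment> \<open>On this section over \<open>t = 1\<close> the \<open>HY\<close> components
      vanish and the \<open>HX\<close> components are \<open>F r x - c r\<close>.\<close>
    define l where "l = (\<lambda>x e. case e of HX i \<Rightarrow> x i | HY i \<Rightarrow> - C i x | HT \<Rightarrow> 1)"
    have "G j (l x) = G j (l y)" if "j \<in> J" for j
      using xy that F by (cases j) (auto simp: G_def H_def l_def J_def)
    then have "l x (HX i) = l y (HX i)" if "i \<in> I" for i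
      using InjD[OF inj, of "l x" "l y"] J(1) that by blast
    then show "\<forall>i\<in>I. x i = y i" by (simp add: l_def)
  qed
qed

lemma poly_deg_3_decomp:
  assumes "finite I" "poly_deg I 3 f"
  shows "\<exists>c b m p. \<forall>x. f x = c + (\<Sum>i\<in>I. b i * x i) + (\<Sum>i\<in>I. \<Sum>k\<in>I. m i k * (x i * x k)) +
    (\<Sum>i\<in>I. \<Sum>k\<in>I. \<Sum>l\<in>I. p i k l * (x i * x k * x l))"
proof -
  obtain c b q where q: "\<And>i k. poly_deg I 1 (q i k)"
    "\<And>x. f x = c + (\<Sum>i\<in>I. b i * x i) + (\<Sum>i\<in>I. \<Sum>k\<in>I. x i * x k * q i k x)"
    using poly_deg_Suc_Suc_decomp[of I 1 f] assms by (auto simp: numeral_3_eq_3)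
  define P where "P i k a g \<longleftrightarrow> (\<forall>l. poly_deg I 0 (g l)) \<and> (\<forall>x. q i k x = a + (\<Sum>l\<in>I. x l * g l x))"
    for i k a g
  have "\<exists>a g. P i k a g" for i k
    unfolding P_def by (rule poly_deg_Suc_decomp[OF assms(1) q(1)]) simp
  then obtain m g where "\<And>i k. P i k (m i k) (g i k)" by metis
  then have g: "poly_deg I 0 (g i k l)" "q i k x = m i k + (\<Sum>l\<in>I. x l * g i k l x)" for i k l x
    unfolding P_def by blast+
  define p where "p i k l = g i k l (\<lambda>_. 0)" for i k l
  have gp: "g i k l x = p i k l" for i k l x
    unfolding p_def by (rule poly_deg_0[OF g(1) refl])
  have "f x = c + (\<Sum>i\<in>I. b i * x i) + (\<Sum>i\<in>I. \<Sum>k\<in>I. m i k * (x i * x k)) +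
      (\<Sum>i\<in>I. \<Sum>k\<in>I. \<Sum>l\<in>I. p i k l * (x i * x k * x l))" for x
    unfolding q(2) g(2) gp by (simp add: distrib_left sum.distrib sum_distrib_left mult_ac)
  then show ?thesis by blast
qed

text \<open>The linear part \<open>b\<close> of \<open>F\<close> is its derivative at the origin,
  hence invertible by the Keller property. Composing with the inverse \<open>M\<close> on the left
  makes the linear part the identity and changes neither the kernels of the derivatives nor the
  collisions.\<close>

lemma Keller_inj_3:
  assumes CI: "Cubic_inj TYPE('i hom)"
  shows "Keller_inj TYPE('i) 3"
  unfolding Keller_inj_def
proof (intro allI impI)
  fix I :: "'i set" and F
  assume fin: "finite I" and F: "\<forall>r\<in>I. poly_deg I 3 (F r)" and K: "Keller I F"
  define P where "P r c b m p \<longleftrightarrow> (\<forall>x. F r x = c + (\<Sum>i\<in>I. b i * x i) +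
    (\<Sum>i\<in>I. \<Sum>k\<in>I. m i k * (x i * x k)) +
    (\<Sum>i\<in>I. \<Sum>k\<in>I. \<Sum>l\<in>I. p i k l * (x i * x k * x l)))" for r c b m p
  have "\<exists>c b m p. P r c b m p" if "r \<in> I" for r
    unfolding P_def using F that by (intro poly_deg_3_decomp[OF fin]) auto
  then obtain c b m p where "\<And>r. r \<in> I \<Longrightarrow> P r (c r) (b r) (m r) (p r)" by metis
  then have F_eq: "F r x = c r + (\<Sum>i\<in>I. b r i * x i) +
    (\<Sum>i\<in>I. \<Sum>k\<in>I. m r i k * (x i * x k)) +
    (\<Sum>i\<in>I. \<Sum>k\<in>I. \<Sum>l\<in>I. p r i k l * (x i * x k * x l))" if "r \<in> I" for r x
    using that unfolding P_def by blast
  have PFF: "polyfn I (F r)" if "r \<in> I" for r using F that polyfn_I by blast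
  have dd0: "dir_deriv (F r) (\<lambda>_. 0) v = (\<Sum>i\<in>I. b r i * v i)" if "r \<in> I" for r v
  proof (rule ddI)
    have *: "F r (\<lambda>i. 0 + s * v i) = c r + s * (\<Sum>i\<in>I. b r i * v i) +
        s^2 * (\<Sum>i\<in>I. \<Sum>k\<in>I. m r i k * (v i * v k)) +
        s^3 * (\<Sum>i\<in>I. \<Sum>k\<in>I. \<Sum>l\<in>I. p r i k l * (v i * v k * v l))" for s
      unfolding F_eq[OF that]
      by (simp add: sum_distrib_left power2_eq_square power3_eq_cube mult_ac)
    show "((\<lambda>s. F r (\<lambda>i. 0 + s * v i)) has_field_derivative (\<Sum>i\<in>I. b r i * v i)) (at 0)"
      unfolding * by (auto intro!: derivative_eq_intros)
  qed
  have b_inj: "\<forall>j\<in>I. v j = 0" if "\<forall>i\<in>I. (\<Sum>j\<in>I. b i j * v j) = 0" for v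
    using KellerD[OF K, of "\<lambda>_. 0" v] dd0 that by auto
  obtain M where M: "\<And>i k. i \<in> I \<Longrightarrow> k \<in> I \<Longrightarrow> (\<Sum>j\<in>I. M i j * b j k) = of_bool (i = k)"
    and M': "\<And>i k. i \<in> I \<Longrightarrow> k \<in> I \<Longrightarrow> (\<Sum>j\<in>I. b i j * M j k) = of_bool (i = k)"
    using lin_inverse[OF fin b_inj] by blast
  have M_inv: "(\<Sum>j\<in>I. b i j * (\<Sum>k\<in>I. M j k * a k)) = a i" if "i \<in> I" for i a
  proof -
    have "(\<Sum>j\<in>I. b i j * (\<Sum>k\<in>I. M j k * a k)) = (\<Sum>k\<in>I. (\<Sum>j\<in>I. b i j * M j k) * a k)"
      unfolding sum_distrib_left sum_distrib_right by (subst sum.swap) (simp add: mult.assoc)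
    also have "\<dots> = a i" using M' that fin by simp
    finally show ?thesis .
  qed
  define G where "G r x = (\<Sum>j\<in>I. M r j * F j x)" for r x
  define m' where "m' r i k = (\<Sum>j\<in>I. M r j * m j i k)" for r i k
  define p' where "p' r i k l = (\<Sum>j\<in>I. M r j * p j i k l)" for r i k l
  have "Inj I G"
  proof (rule cubic_homogenize[OF CI fin])
    fix r x assume r: "r \<in> I"
    have "(\<Sum>j\<in>I. M r j * (\<Sum>i\<in>I. b j i * x i)) = (\<Sum>i\<in>I. (\<Sum>j\<in>I. M r j * b j i) * x i)"
      unfolding sum_distrib_left sum_distrib_right by (subst sum.swap) (simp add: mult.assoc)
    also have "\<dots> = x r" using M r fin by simp
    finally have lin: "(\<Sum>j\<in>I. M r j * (\<Sum>i\<in>I. b j i * x i)) = x r" .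
    have quad: "(\<Sum>j\<in>I. M r j * (\<Sum>i\<in>I. \<Sum>k\<in>I. m j i k * (x i * x k))) =
        (\<Sum>i\<in>I. \<Sum>k\<in>I. m' r i k * (x i * x k))"
    proof -
      have "(\<Sum>j\<in>I. M r j * (\<Sum>i\<in>I. \<Sum>k\<in>I. m j i k * (x i * x k))) =
          (\<Sum>j\<in>I. \<Sum>i\<in>I. \<Sum>k\<in>I. M r j * m j i k * (x i * x k))"
        by (simp add: sum_distrib_left mult.assoc)
      also have "\<dots> = (\<Sum>i\<in>I. \<Sum>k\<in>I. \<Sum>j\<in>I. M r j * m j i k * (x i * x k))"
        by (subst sum.swap, rule sum.cong[OF refl], subst sum.swap, rule refl)
      finally show ?thesis by (simp add: m'_def sum_distrib_right)
    qed
    have cub: "(\<Sum>j\<in>I. M r j * (\<Sum>i\<in>I. \<Sum>k\<in>I. \<Sum>l\<in>I. p j i k l * (x i * x k * x l))) =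
        (\<Sum>i\<in>I. \<Sum>k\<in>I. \<Sum>l\<in>I. p' r i k l * (x i * x k * x l))"
    proof -
      have "(\<Sum>j\<in>I. M r j * (\<Sum>i\<in>I. \<Sum>k\<in>I. \<Sum>l\<in>I. p j i k l * (x i * x k * x l))) =
          (\<Sum>j\<in>I. \<Sum>i\<in>I. \<Sum>k\<in>I. \<Sum>l\<in>I. M r j * p j i k l * (x i * x k * x l))"
        by (simp add: sum_distrib_left mult.assoc)
      also have "\<dots> = (\<Sum>i\<in>I. \<Sum>k\<in>I. \<Sum>l\<in>I. \<Sum>j\<in>I. M r j * p j i k l * (x i * x k * x l))"
        by (subst sum.swap, rule sum.cong[OF refl], subst sum.swap, rule sum.cong[OF refl],
            subst sum.swap, rule refl)
      finally show ?thesis by (simp add: p'_def sum_distrib_right)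
    qed
    have "G r x = (\<Sum>j\<in>I. M r j * c j) + (\<Sum>j\<in>I. M r j * (\<Sum>i\<in>I. b j i * x i)) +
        (\<Sum>j\<in>I. M r j * (\<Sum>i\<in>I. \<Sum>k\<in>I. m j i k * (x i * x k))) +
        (\<Sum>j\<in>I. M r j * (\<Sum>i\<in>I. \<Sum>k\<in>I. \<Sum>l\<in>I. p j i k l * (x i * x k * x l)))"
      unfolding G_def by (simp add: F_eq distrib_left sum.distrib cong: sum.cong)
    then show "G r x = (\<Sum>j\<in>I. M r j * c j) + x r + (\<Sum>i\<in>I. \<Sum>k\<in>I. m' r i k * (x i * x k)) +
        (\<Sum>i\<in>I. \<Sum>k\<in>I. \<Sum>l\<in>I. p' r i k l * (x i * x k * x l))"
      unfolding lin quad cub .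
  next
    show "Keller I G"
      unfolding Keller_def
    proof (intro allI impI)
      fix x v assume *: "\<forall>r\<in>I. dir_deriv (G r) x v = 0"
      have "dir_deriv (G r) x v = (\<Sum>j\<in>I. M r j * dir_deriv (F j) x v)" for r
        unfolding G_def[abs_def] using PFF
        by (simp add: dir_deriv_sum[where I = I] dir_deriv_cmult[where I = I] polyfn_mult)
      then have "dir_deriv (F i) x v = 0" if "i \<in> I" for i
        using M_inv[OF that, of "\<lambda>j. dir_deriv (F j) x v"] * by simp
      then show "\<forall>i\<in>I. v i = 0" using KellerD[OF K, of x v] by blast
    qed
  qed auto
  then show "Inj I F"
    unfolding Inj_def G_def by simp
qed

definition Druz_inj :: "'i itself \<Rightarrow> bool" where
  "Druz_inj _ \<longleftrightarrow> (\<forall>(I :: 'i set) A. finite I \<longrightarrow>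
    Keller I (\<lambda>r x. x r + (\<Sum>i\<in>I. A r i * x i) ^ 3) \<longrightarrow> Inj I (\<lambda>r x. x r + (\<Sum>i\<in>I. A r i * x i) ^ 3))"

lemma polyfn_lin_cube: "polyfn I (\<lambda>x. (\<Sum>i\<in>I. l i * x i) ^ 3)"
  by (intro polyfn_power polyfn_sum polyfn_mult polyfn_const polyfn_var)

lemma dir_deriv_lin_cube:
  "dir_deriv (\<lambda>x. (\<Sum>i\<in>I. l i * x i) ^ 3) x v = 3 * (\<Sum>i\<in>I. l i * x i)^2 * (\<Sum>i\<in>I. l i * v i)"
proof (rule ddI)
  have *: "(\<Sum>i\<in>I. l i * (x i + s * v i)) = (\<Sum>i\<in>I. l i * x i) + s * (\<Sum>i\<in>I. l i * v i)" for s
    by (simp add: distrib_left sum.distrib sum_distrib_left mult_ac)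
  show "((\<lambda>s. (\<Sum>i\<in>I. l i * (x i + s * v i)) ^ 3) has_field_derivative
      3 * (\<Sum>i\<in>I. l i * x i)^2 * (\<Sum>i\<in>I. l i * v i)) (at 0)"
    unfolding * by (auto intro!: derivative_eq_intros)
qed

text \<open>If \<open>F(x) = x + B (L x)\<^sup>3\<close> and \<open>A = L B\<close>, then \<open>B F\<^sub>A(u) = F(B u)\<close>.\<close>
lemma Cubic_inj_if_Druz_inj:
  assumes DI: "Druz_inj TYPE('i \<times> nat)"
  shows "Cubic_inj TYPE('i)"
  unfolding Cubic_inj_def
proof (intro allI impI)
  fix I :: "'i set" and H
  assume fin: "finite I" and H: "\<forall>r\<in>I. cubes I (H r)" and K: "Keller I (\<lambda>r x. x r + H r x)"
  define P where "P r n b L \<longleftrightarrow> b 0 = 1 \<and> L 0 = (\<lambda>_. 0) \<and>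
    (\<forall>x. H r x = (\<Sum>j\<le>(n::nat). b j * (\<Sum>i\<in>I. L j i * x i) ^ 3))" for r n b L
  have "\<exists>n b L. P r n b L" if "r \<in> I" for r
    unfolding P_def using H that by (intro cubes_repr) auto
  then obtain n b L where "\<And>r. r \<in> I \<Longrightarrow> P r (n r) (b r) (L r)" by metis
  then have b0: "b r 0 = 1" and L0: "L r 0 = (\<lambda>_. 0)"
    and H_eq: "H r x = (\<Sum>j\<le>n r. b r j * (\<Sum>i\<in>I. L r j i * x i) ^ 3)" if "r \<in> I" for r x
    using that unfolding P_def by blast+
  define J where "J = Sigma I (\<lambda>r. {..n r})"
  have finJ: "finite J" using fin by (simp add: J_def)
  \<comment> \<open>An index of the larger space is a component \<open>r\<close> with a summand
    \<open>j\<close> of \<open>H r\<close>. The map \<open>B\<close> adds up the summands of one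
    component with their coefficients, and \<open>A\<close> is the product
    \<open>L B\<close>.\<close>
  define A where "A a c = L (fst a) (snd a) (fst c) * b (fst c) (snd c)" for a c :: "'i \<times> nat"
  define B where "B u r = (\<Sum>j\<le>n r. b r j * u (r, j))" for u r
  have AB: "(\<Sum>c\<in>J. A (r, j) c * u c) = (\<Sum>i\<in>I. L r j i * B u i)" for r j u
  proof -
    have "(\<Sum>c\<in>J. A (r, j) c * u c) = (\<Sum>i\<in>I. \<Sum>k\<le>n i. A (r, j) (i, k) * u (i, k))"
      unfolding J_def using fin by (subst sum.Sigma) (auto simp: split_def)
    then show ?thesis by (simp add: A_def B_def sum_distrib_left mult.assoc)
  qed
  define G where "G = (\<lambda>r x. x r + (\<Sum>i\<in>J. A r i * x i) ^ 3)"
  have "Keller J G"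
    unfolding Keller_def
  proof (intro allI impI)
    fix u w assume *: "\<forall>r\<in>J. dir_deriv (G r) u w = 0"
    have eq: "w (r, j) + 3 * (\<Sum>i\<in>I. L r j i * B u i)^2 * (\<Sum>i\<in>I. L r j i * B w i) = 0"
      if "r \<in> I" "j \<le> n r" for r j
    proof -
      have "(r, j) \<in> J" using that by (simp add: J_def)
      then have "dir_deriv (G (r, j)) u w = w (r, j) +
          3 * (\<Sum>i\<in>J. A (r, j) i * u i)^2 * (\<Sum>i\<in>J. A (r, j) i * w i)"
        unfolding G_def by (simp add: dir_deriv_add[where I = J] polyfn_lin_cube dir_deriv_lin_cube)
      then show ?thesis using * \<open>(r, j) \<in> J\<close> by (simp add: AB)
    qed
    \<comment> \<open>Applying \<open>B\<close> to the equations \<open>eq\<close> gives the kernel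
      equation of \<open>x + H x\<close> at the point \<open>B u\<close> in direction
      \<open>B w\<close>.\<close>
    have "dir_deriv (\<lambda>x. x r + H r x) (B u) (B w) = 0" if r: "r \<in> I" for r
    proof -
      have PFc: "polyfn I (\<lambda>x. b r j * (\<Sum>i\<in>I. L r j i * x i) ^ 3)"
        and PFl: "polyfn I (\<lambda>x. (\<Sum>i\<in>I. L r j i * x i) ^ 3)" for j
        by (intro polyfn_power polyfn_sum polyfn_mult polyfn_const polyfn_var; assumption)+
      have "dir_deriv (\<lambda>x. x r + H r x) (B u) (B w) = B w r +
          (\<Sum>j\<le>n r. b r j * (3 * (\<Sum>i\<in>I. L r j i * B u i)^2 * (\<Sum>i\<in>I. L r j i * B w i)))"
        unfolding H_eq[OF r, abs_def]
        by (subst dir_deriv_add[OF polyfn_var[OF r] polyfn_sum[OF PFc]], subst dir_deriv_sum[OF PFc],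
            subst dir_deriv_cmult[OF PFl]) (simp add: dir_deriv_lin_cube)
      also have "\<dots> = (\<Sum>j\<le>n r. b r j * (w (r, j) +
          3 * (\<Sum>i\<in>I. L r j i * B u i)^2 * (\<Sum>i\<in>I. L r j i * B w i)))"
        by (simp add: B_def[of w r] distrib_left sum.distrib)
      also have "\<dots> = 0" using eq[OF r] by simp
      finally show ?thesis .
    qed
    then have "B w i = 0" if "i \<in> I" for i using KellerD[OF K] that by blast
    then have "w (r, j) = 0" if "r \<in> I" "j \<le> n r" for r j
      using eq[OF that] by simp
    then show "\<forall>a\<in>J. w a = 0" by (auto simp: J_def)
  qed
  then have inj: "Inj J G"
    using DI[unfolded Druz_inj_def, rule_format, OF finJ, of A] by (simp add: G_def)
  show "Inj I (\<lambda>r x. x r + H r x)"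
    unfolding Inj_def
  proof (intro allI impI)
    fix x y assume xy: "\<forall>r\<in>I. x r + H r x = y r + H r y"
    \<comment> \<open>Since the summand with index 0 has coefficient 1, putting \<open>y r\<close>
      there gives a preimage of \<open>y\<close> under \<open>B\<close>.\<close>
    define uy where "uy a = (if snd a = 0 then y (fst a) else 0)" for a :: "'i \<times> nat"
    define l where "l z a = (\<Sum>i\<in>I. L (fst a) (snd a) i * z i) ^ 3" for z and a :: "'i \<times> nat"
    \<comment> \<open>\<open>ux\<close> is forced by \<open>G ux = G uy\<close> once
      \<open>B ux = x\<close> and \<open>B uy = y\<close>; that \<open>B ux = x\<close> indeed holds
      is the collision hypothesis \<open>xy\<close>.\<close>
    define ux where "ux a = uy a + l y a - l x a" for a
    have By: "B uy r = y r" if "r \<in> I" for r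
      unfolding B_def uy_def using b0[OF that] by (simp add: if_distrib cong: if_cong)
    have Bx: "B ux r = x r" if "r \<in> I" for r
    proof -
      have "B ux r = B uy r + (H r y - H r x)"
        unfolding B_def ux_def H_eq[OF that] l_def
        by (simp add: distrib_left right_diff_distrib sum.distrib sum_subtractf)
      also have "\<dots> = (x r + H r x) - H r x" using By[OF that] xy that by simp
      finally show ?thesis by simp
    qed
    have "G a ux = G a uy" if "a \<in> J" for a
      using AB[of "fst a" "snd a" ux] AB[of "fst a" "snd a" uy]
      by (simp add: G_def Bx By ux_def l_def cong: sum.cong)
    then have "ux a = uy a" if "a \<in> J" for a using InjD[OF inj, of ux uy] that by blast
    then have "B ux r = B uy r" if "r \<in> I" for r
      using that by (simp add: B_def J_def)
    then show "\<forall>i\<in>I. x i = y i" using Bx By by simp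
  qed
qed

lemma Druz_inj_if_nat:
  assumes DI: "\<And>n (A :: nat \<Rightarrow> nat \<Rightarrow> complex).
    Keller {..<n} (\<lambda>r x. x r + (\<Sum>i<n. A r i * x i) ^ 3) \<Longrightarrow>
    Inj {..<n} (\<lambda>r x. x r + (\<Sum>i<n. A r i * x i) ^ 3)"
  shows "Druz_inj TYPE('i)"
  unfolding Druz_inj_def
proof (intro allI impI)
  fix I :: "'i set" and A
  assume fin: "finite I" and K: "Keller I (\<lambda>r x. x r + (\<Sum>i\<in>I. A r i * x i) ^ 3)"
  define n where "n = card I"
  have "\<exists>e. bij_betw e {0..<n} I"
    unfolding n_def by (rule ex_bij_betw_nat_finite[OF fin])
  then obtain e where e: "bij_betw e {..<n} I" by (auto simp: atLeast0LessThan)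
  define g where "g = the_inv_into {..<n} e"
  have ge: "g (e a) = a" if "a < n" for a
    using e that by (simp add: g_def bij_betw_def the_inv_into_f_f)
  have eI: "e a \<in> I" if "a < n" for a using bij_betwE[OF e] that by auto
  have eg: "e (g i) = i" "g i < n" if "i \<in> I" for i
    using e that by (auto simp: bij_betw_def ge)
  have sumI: "(\<Sum>j\<in>I. h j) = (\<Sum>a<n. h (e a))" for h :: "'i \<Rightarrow> complex"
    using sum.reindex_bij_betw[OF e] by metis
  define A' where "A' a b = A (e a) (e b)" for a b
  define G where "G = (\<lambda>r x. x r + (\<Sum>i<n. A' r i * x i) ^ 3)"
  have G_dd: "dir_deriv (G a) x v = v a + 3 * (\<Sum>i<n. A' a i * x i)^2 * (\<Sum>i<n. A' a i * v i)"
    if "a < n" for a x v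
    unfolding G_def using that
    by (simp add: dir_deriv_add[where I = "{..<n}"] polyfn_lin_cube dir_deriv_lin_cube)
  have F_dd: "dir_deriv (\<lambda>x. x r + (\<Sum>i\<in>I. A r i * x i) ^ 3) x v =
      v r + 3 * (\<Sum>i\<in>I. A r i * x i)^2 * (\<Sum>i\<in>I. A r i * v i)" if "r \<in> I" for r x v
    using that by (simp add: dir_deriv_add[where I = I] polyfn_lin_cube dir_deriv_lin_cube)
  have "Keller {..<n} G"
    unfolding Keller_def
  proof (intro allI impI)
    fix x v assume *: "\<forall>r\<in>{..<n}. dir_deriv (G r) x v = 0"
    have "dir_deriv (\<lambda>x. x r + (\<Sum>i\<in>I. A r i * x i) ^ 3) (\<lambda>i. x (g i)) (\<lambda>i. v (g i)) = 0"
      if "r \<in> I" for r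
    proof -
      have "dir_deriv (G (g r)) x v = 0" using * eg that by simp
      then show ?thesis
        using G_dd[of "g r" x v] eg that by (subst F_dd[OF that]) (simp add: A'_def ge sumI)
    qed
    then have "v (g i) = 0" if "i \<in> I" for i
      using KellerD[OF K, of "\<lambda>i. x (g i)" "\<lambda>i. v (g i)"] that by blast
    then have "v (g (e a)) = 0" if "a < n" for a using eI that by blast
    then show "\<forall>a\<in>{..<n}. v a = 0" by (simp add: ge)
  qed
  then have inj: "Inj {..<n} G"
    unfolding G_def by (rule DI)
  show "Inj I (\<lambda>r x. x r + (\<Sum>i\<in>I. A r i * x i) ^ 3)"
    unfolding Inj_def
  proof (intro allI impI)
    fix x y assume xy: "\<forall>r\<in>I. x r + (\<Sum>i\<in>I. A r i * x i) ^ 3 = y r + (\<Sum>i\<in>I. A r i * y i) ^ 3"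
    have "G a (\<lambda>a. x (e a)) = G a (\<lambda>a. y (e a))" if "a < n" for a
      using xy[rule_format, OF eI[OF that]] by (simp add: G_def A'_def sumI)
    then have "x (e a) = y (e a)" if "a < n" for a
      using InjD[OF inj, of "\<lambda>a. x (e a)" "\<lambda>a. y (e a)"] that by blast
    then have "x (e (g i)) = y (e (g i))" if "i \<in> I" for i using eg that by blast
    then show "\<forall>i\<in>I. x i = y i" by (simp add: eg)
  qed
qed

lemma Keller_inj_if_Druz:
  assumes "\<And>n (A :: nat \<Rightarrow> nat \<Rightarrow> complex).
    Keller {..<n} (\<lambda>r x. x r + (\<Sum>i<n. A r i * x i) ^ 3) \<Longrightarrow>
    Inj {..<n} (\<lambda>r x. x r + (\<Sum>i<n. A r i * x i) ^ 3)"
  shows "Keller_inj TYPE(nat) d"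
proof -
  \<comment> \<open>Homogenising a cubic map over \<open>nat\<close> leads to
    \<open>nat hom\<close>, and writing its components as sums of cubes adds a summand index in
    \<open>nat\<close>.\<close>
  have "Druz_inj TYPE(nat hom \<times> nat)"
    by (rule Druz_inj_if_nat) (rule assms)
  then show ?thesis
    by (rule Keller_inj_all_degrees[OF Keller_inj_3[OF Cubic_inj_if_Druz_inj]])
qed

section \<open>Extension of rational functions\<close>

text \<open>Points are functions on the whole index type, so bounds on \<open>I\<close> alone do not
  give compactness. Tychonoff's theorem does, with singletons in the coordinates outside
  \<open>I\<close>.\<close>

lemma compact_box:
  fixes S :: "'i \<Rightarrow> complex set"
  assumes "\<And>i. compact (S i)"
  shows "compact {x. \<forall>i. x i \<in> S i}"
proof -
  have "compactin (product_topology (\<lambda>i. euclidean) UNIV) (Pi\<^sub>E UNIV S)"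
    using assms by (simp add: compactin_PiE)
  then have "compact (Pi\<^sub>E UNIV S)"
    by (simp add: euclidean_product_topology)
  moreover have "Pi\<^sub>E UNIV S = {x. \<forall>i. x i \<in> S i}" by auto
  ultimately show ?thesis by simp
qed

text \<open>Gaussian elimination: an equation with nonzero coefficient at \<open>b\<close> is solved
  for \<open>c b\<close>, and \<open>M'\<close> holds the other equations after substitution, so one
  unknown and one equation disappear together.\<close>

lemma more_unknowns_than_equations:
  fixes M :: "'a \<Rightarrow> 't \<Rightarrow> complex"
  assumes "finite T" "finite A" "card T < card A"
  shows "\<exists>c. (\<exists>a\<in>A. c a \<noteq> 0) \<and> (\<forall>t\<in>T. (\<Sum>a\<in>A. c a * M a t) = 0)"
  using assms
proof (induction T arbitrary: A M rule: finite_induct)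
  case empty
  then have "A \<noteq> {}" by auto
  then show ?case by (intro exI[of _ "\<lambda>_. 1"]) auto
next
  case (insert t T)
  show ?case
  proof (cases "\<forall>a\<in>A. M a t = 0")
    case True
    have "card T < card A" using insert by simp
    then obtain c where "\<exists>a\<in>A. c a \<noteq> 0" "\<forall>t\<in>T. (\<Sum>a\<in>A. c a * M a t) = 0"
      using insert.IH[of A M] insert.prems by blast
    then show ?thesis using True by (intro exI[of _ c]) auto
  next
    case False
    then obtain b where b: "b \<in> A" "M b t \<noteq> 0" by blast
    define A' where "A' = A - {b}"
    have A': "finite A'" "card T < card A'" "A = insert b A'" "b \<notin> A'"
      using insert.prems insert.hyps b by (auto simp: A'_def)
    define M' where "M' a s = M a s - M a t / M b t * M b s" for a s
    obtain c where c: "\<exists>a\<in>A'. c a \<noteq> 0" "\<forall>s\<in>T. (\<Sum>a\<in>A'. c a * M' a s) = 0"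
      using insert.IH[OF A'(1,2), of M'] by blast
    define c' where "c' = c(b := - (\<Sum>a\<in>A'. c a * M a t) / M b t)"
    have sum: "(\<Sum>a\<in>A. c' a * M a s) = (\<Sum>a\<in>A'. c a * M a s) -
        (\<Sum>a\<in>A'. c a * M a t) / M b t * M b s" for s
    proof -
      have "(\<Sum>a\<in>A'. c' a * M a s) = (\<Sum>a\<in>A'. c a * M a s)"
        using A'(4) by (intro sum.cong) (auto simp: c'_def)
      then show ?thesis
        unfolding A'(3) using A'(1,4) by (simp add: c'_def)
    qed
    have "(\<Sum>a\<in>A. c' a * M a s) = 0" if "s \<in> insert t T" for s
    proof (cases "s = t")
      case True
      then show ?thesis using b by (simp add: sum)
    next
      case False
      then have "(\<Sum>a\<in>A'. c a * M' a s) = 0" using c that by auto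
      then show ?thesis
        by (simp add: sum M'_def right_diff_distrib sum_subtractf sum_divide_distrib sum_distrib_right mult.assoc)
    qed
    moreover have "\<exists>a\<in>A. c' a \<noteq> 0" using c(1) A' by (auto simp: c'_def)
    ultimately show ?thesis by blast
  qed
qed

section \<open>Monomials: spanning and independence\<close>

definition mon :: "'i set \<Rightarrow> ('i \<Rightarrow> nat) \<Rightarrow> ('i \<Rightarrow> complex) \<Rightarrow> complex" where
  "mon I e x = (\<Prod>i\<in>I. x i ^ e i)"

lemma polyfn_mon: "polyfn I (mon I e)"
  unfolding mon_def[abs_def] by (intro polyfn_prod polyfn_power polyfn_var)

text \<open>Exponents are bounded separately and not by total degree: the index set is then a box
  with \<open>(d + 1) ^ card I\<close> elements, which makes the later dimension count
  elementary.\<close>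

lemma poly_deg_monomials:
  fixes I :: "'i set"
  assumes "finite I"
  shows "poly_deg I d f \<Longrightarrow> \<exists>c. \<forall>x. f x = (\<Sum>e\<in>I \<rightarrow>\<^sub>E {..d}. c e * mon I e x)"
proof (induction d arbitrary: f)
  case 0
  have "mon I e x = 1" if "e \<in> I \<rightarrow>\<^sub>E {..0}" for e x
    using that by (auto simp: mon_def PiE_iff intro!: prod.neutral)
  moreover have "I \<rightarrow>\<^sub>E {..0::nat} = {\<lambda>i\<in>I. 0}"
    by (auto simp: PiE_eq_singleton)
  ultimately show ?case
    using poly_deg_0[OF 0 refl, of _ undefined] by (intro exI[of _ "\<lambda>_. f undefined"]) (simp del: restrict_apply)
next
  case (Suc d)
  define R where "R g \<longleftrightarrow> (\<exists>c. \<forall>x. g x = (\<Sum>e\<in>I \<rightarrow>\<^sub>E {..Suc d}. c e * mon I e x))"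
    for g :: "('i \<Rightarrow> complex) \<Rightarrow> complex"
  have fin: "finite (I \<rightarrow>\<^sub>E {..Suc d})" using assms by (simp add: finite_PiE)
  have R_mon: "R (\<lambda>x. c * mon I e x)" if "e \<in> I \<rightarrow>\<^sub>E {..Suc d}" for c e
    unfolding R_def using that fin
    by (intro exI[of _ "\<lambda>e'. if e' = e then c else 0"]) (simp add: if_distrib[of "\<lambda>a. a * _"] cong: if_cong)
  have R_add: "R (\<lambda>x. g x + h x)" if "R g" "R h" for g h
  proof -
    obtain c c' where "\<forall>x. g x = (\<Sum>e\<in>I \<rightarrow>\<^sub>E {..Suc d}. c e * mon I e x)"
      "\<forall>x. h x = (\<Sum>e\<in>I \<rightarrow>\<^sub>E {..Suc d}. c' e * mon I e x)"
      using \<open>R g\<close> \<open>R h\<close> unfolding R_def by blast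
    then show ?thesis
      unfolding R_def by (intro exI[of _ "\<lambda>e. c e + c' e"]) (simp add: distrib_right sum.distrib)
  qed
  have R_0: "R (\<lambda>x. 0)" unfolding R_def by (intro exI[of _ "\<lambda>_. 0"]) simp
  have R_sum: "R (\<lambda>x. \<Sum>a\<in>A. g a x)" if "\<And>a. a \<in> A \<Longrightarrow> R (g a)" for A :: "'b set" and g
    using that by (induction A rule: infinite_finite_induct) (simp_all add: R_0 R_add)
  obtain c q where q: "\<And>i. poly_deg I d (q i)" "\<And>x. f x = c + (\<Sum>i\<in>I. x i * q i x)"
    using poly_deg_Suc_decomp[OF assms Suc.prems refl] by blast
  obtain b where b: "\<And>i x. q i x = (\<Sum>e\<in>I \<rightarrow>\<^sub>E {..d}. b i e * mon I e x)"
    using Suc.IH[OF q(1)] by metis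
  have shift: "x i * mon I e x = mon I (e(i := Suc (e i))) x" if "i \<in> I" for i e x
  proof -
    have "(\<Prod>j\<in>I - {i}. x j ^ (e(i := Suc (e i))) j) = (\<Prod>j\<in>I - {i}. x j ^ e j)"
      by (intro prod.cong) auto
    then show ?thesis
      using that assms by (simp add: mon_def prod.remove[of I i])
  qed
  have f: "f x = c * mon I (\<lambda>i\<in>I. 0) x +
      (\<Sum>i\<in>I. \<Sum>e\<in>I \<rightarrow>\<^sub>E {..d}. b i e * mon I (e(i := Suc (e i))) x)" for x
  proof -
    have "mon I (\<lambda>i\<in>I. 0) x = 1" by (simp add: mon_def)
    moreover have "(\<Sum>i\<in>I. x i * q i x) =
        (\<Sum>i\<in>I. \<Sum>e\<in>I \<rightarrow>\<^sub>E {..d}. b i e * mon I (e(i := Suc (e i))) x)"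
      by (intro sum.cong refl) (simp add: b sum_distrib_left shift[symmetric] mult.left_commute)
    ultimately show ?thesis using q(2) by simp
  qed
  have "R (\<lambda>x. c * mon I (\<lambda>i\<in>I. 0) x +
      (\<Sum>i\<in>I. \<Sum>e\<in>I \<rightarrow>\<^sub>E {..d}. b i e * mon I (e(i := Suc (e i))) x))"
    by (intro R_add R_sum R_mon) (auto simp: PiE_iff extensional_def le_Suc_eq)
  then show ?case unfolding R_def using f by simp
qed

text \<open>With the other variables fixed, the sum is a univariate polynomial in \<open>x i\<close>
  that vanishes everywhere, so its coefficients vanish and the induction hypothesis applies to
  them.\<close>

lemma mon_independent:
  assumes "finite I" "\<And>x. (\<Sum>e\<in>I \<rightarrow>\<^sub>E {..K}. c e * mon I e x) = 0" "e \<in> I \<rightarrow>\<^sub>E {..K}"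
  shows "c e = 0"
  using assms
proof (induction I arbitrary: c e rule: finite_induct)
  case empty
  then show ?case by (simp add: mon_def)
next
  case (insert i I)
  have expand: "(\<Sum>e\<in>insert i I \<rightarrow>\<^sub>E {..K}. c e * mon (insert i I) e x) =
      (\<Sum>k\<le>K. (\<Sum>e\<in>I \<rightarrow>\<^sub>E {..K}. c (e(i := k)) * mon I e x) * x i ^ k)" for x
  proof -
    have m: "mon (insert i I) (e(i := k)) x = x i ^ k * mon I e x" for e k
    proof -
      have "(\<Prod>j\<in>I. x j ^ (e(i := k)) j) = (\<Prod>j\<in>I. x j ^ e j)"
        using insert.hyps by (intro prod.cong) auto
      then show ?thesis using insert.hyps by (simp add: mon_def)
    qed
    have "(\<Sum>e\<in>insert i I \<rightarrow>\<^sub>E {..K}. c e * mon (insert i I) e x) =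
        (\<Sum>(k, e)\<in>{..K} \<times> (I \<rightarrow>\<^sub>E {..K}). c (e(i := k)) * mon (insert i I) (e(i := k)) x)"
      unfolding PiE_insert_eq using insert.hyps inj_combinator[of i I "\<lambda>_. {..K}"]
      by (subst sum.reindex) (auto simp: o_def split_def intro!: sum.cong)
    also have "\<dots> = (\<Sum>k\<le>K. (\<Sum>e\<in>I \<rightarrow>\<^sub>E {..K}. c (e(i := k)) * mon I e x) * x i ^ k)"
      by (simp add: sum.cartesian_product[symmetric] m sum_distrib_right sum_distrib_left mult_ac)
    finally show ?thesis .
  qed
  have "(\<Sum>e\<in>I \<rightarrow>\<^sub>E {..K}. c (e(i := k)) * mon I e x) = 0" if "k \<le> K" for k x
  proof -
    have "mon I e (x(i := t)) = mon I e x" for e t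
      using insert.hyps by (auto simp: mon_def intro!: prod.cong)
    then have "(\<Sum>k\<le>K. (\<Sum>e\<in>I \<rightarrow>\<^sub>E {..K}. c (e(i := k)) * mon I e x) * t ^ k) = 0" for t
      using expand[of "x(i := t)"] insert.prems(1)[of "x(i := t)"] by simp
    then show ?thesis
      using polyfun_eq_0[of "\<lambda>k. (\<Sum>e\<in>I \<rightarrow>\<^sub>E {..K}. c (e(i := k)) * mon I e x)" K] that by blast
  qed
  from this[of "e i"] have *: "(\<Sum>e'\<in>I \<rightarrow>\<^sub>E {..K}. c (e'(i := e i)) * mon I e' x) = 0" for x
    using insert.prems(2) by auto
  have "restrict e I \<in> I \<rightarrow>\<^sub>E {..K}" using insert.prems(2) by auto
  then have "c ((restrict e I)(i := e i)) = 0"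
    using insert.IH[of "\<lambda>e'. c (e'(i := e i))" "restrict e I"] * by blast
  moreover have "(restrict e I)(i := e i) = e"
    using insert.prems(2) by (auto simp: fun_eq_iff PiE_iff extensional_def)
  ultimately show ?case by simp
qed

text \<open>If \<open>cmod z > 1\<close>, all powers on the right are at most
  \<open>cmod z ^ (D - 1)\<close> in modulus; dividing by this leaves the bound.\<close>

lemma root_bound:
  fixes z :: complex
  assumes "D \<ge> 1" "z ^ D = (\<Sum>a<D. b a * z ^ a)"
  shows "cmod z \<le> 1 + (\<Sum>a<D. cmod (b a))"
proof (cases "cmod z \<le> 1")
  case True
  then show ?thesis by (smt (verit) sum_nonneg norm_ge_zero)
next
  case False
  have "cmod z ^ D \<le> (\<Sum>a<D. cmod (b a) * cmod z ^ a)"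
    using assms(2) by (metis (mono_tags, lifting) norm_mult norm_power norm_sum sum.cong)
  also have "\<dots> \<le> (\<Sum>a<D. cmod (b a) * cmod z ^ (D - 1))"
    using False by (intro sum_mono mult_left_mono power_increasing) auto
  finally have "cmod z * cmod z ^ (D - 1) \<le> (\<Sum>a<D. cmod (b a)) * cmod z ^ (D - 1)"
    using assms(1) by (simp add: power_eq_if sum_distrib_right split: if_splits)
  moreover have "cmod z ^ (D - 1) > 0" using False by (intro zero_less_power) linarith
  ultimately show ?thesis by simp
qed

text \<open>The bound makes each point of \<open>Z\<close> a removable singularity, and the entire
  extension has polynomial growth, so the extended Liouville theorem applies. The degree is bounded
  by the exponent \<open>m\<close> alone, whatever \<open>B\<close> is.\<close>

lemma poly_on_line:
  fixes g :: "complex \<Rightarrow> complex"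
  assumes Z: "finite Z" and hol: "g holomorphic_on - Z"
    and bdd: "\<And>s. s \<notin> Z \<Longrightarrow> cmod (g s) \<le> B * (1 + cmod s) ^ m" and "B \<ge> 0"
  shows "\<exists>P. degree P \<le> m \<and> (\<forall>s. s \<notin> Z \<longrightarrow> g s = poly P s)"
proof -
  have "\<exists>h. h holomorphic_on UNIV \<and> (\<forall>z\<in>UNIV - Z. h z = g z)"
  proof (rule removable_singularities[of Z UNIV g])
    fix z assume "z \<in> Z"
    have "eventually (\<lambda>s. s \<in> ball z 1 - (Z - {z})) (nhds z)"
      using Z by (intro eventually_nhds_in_open open_Diff finite_imp_closed) auto
    then have "eventually (\<lambda>s. cmod (g s) \<le> B * (2 + cmod z) ^ m * norm (1::real)) (at z)"
      unfolding eventually_at_filter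
    proof eventually_elim
      case (elim s)
      show ?case
      proof (intro impI)
        assume "s \<noteq> z"
        then have "cmod (g s) \<le> B * (1 + cmod s) ^ m" using elim by (intro bdd) auto
        moreover have "cmod s \<le> 1 + cmod z"
          using elim norm_triangle_ineq2[of s z] by (simp add: dist_norm norm_minus_commute)
        then have "B * (1 + cmod s) ^ m \<le> B * (2 + cmod z) ^ m"
          using \<open>B \<ge> 0\<close> by (intro mult_left_mono power_mono) auto
        ultimately show "cmod (g s) \<le> B * (2 + cmod z) ^ m * norm (1::real)" by simp
      qed
    qed
    then show "g \<in> O[at z](\<lambda>_. 1)"
      by (intro bigoI[where c = "B * (2 + cmod z) ^ m"]) simp
  qed (use Z hol in \<open>auto simp: Compl_eq_Diff_UNIV\<close>)
  then obtain h where h: "h holomorphic_on UNIV" "\<And>z. z \<notin> Z \<Longrightarrow> h z = g z" by auto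
  \<comment> \<open>From this radius on there are no exceptional points, and
    \<open>1 + cmod s \<le> 2 * cmod s\<close>.\<close>
  define A where "A = 1 + (\<Sum>z\<in>Z. cmod z)"
  have "cmod (h s) \<le> (B * 2 ^ m) * cmod s ^ m" if "A \<le> cmod s" for s
  proof -
    have "s \<notin> Z"
      using member_le_sum[of s Z cmod] Z that by (auto simp: A_def)
    have "1 \<le> cmod s" using that sum_nonneg[of Z cmod] by (simp add: A_def)
    have "cmod (h s) \<le> B * (1 + cmod s) ^ m" using bdd h \<open>s \<notin> Z\<close> by simp
    also have "\<dots> \<le> B * (2 * cmod s) ^ m"
      using \<open>1 \<le> cmod s\<close> \<open>B \<ge> 0\<close> by (intro mult_left_mono power_mono) auto
    finally show ?thesis by (simp add: power_mult_distrib)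
  qed
  from Liouville_polynomial[OF h(1) this]
  have *: "h s = (\<Sum>k\<le>m. (deriv ^^ k) h 0 / fact k * s ^ k)" for s by blast
  define P where "P = (\<Sum>k\<le>m. monom ((deriv ^^ k) h 0 / fact k) k)"
  have "degree P \<le> m"
    unfolding P_def by (intro degree_sum_le) (auto intro: order_trans[OF degree_monom_le])
  moreover have "poly P s = h s" for s
    unfolding *[of s] P_def by (simp add: poly_sum poly_monom)
  ultimately show ?thesis using h(2) by metis
qed

text \<open>One basis \<open>L\<close> serves all polynomials of degree at most \<open>m\<close>, so
  a polynomial in one variable that depends on parameters is recovered from its values at fixed
  nodes.\<close>

lemma lagrange_basis:
  fixes a :: "nat \<Rightarrow> complex"
  assumes "inj a"
  shows "\<exists>L. \<forall>P. degree P \<le> m \<longrightarrow> P = (\<Sum>l\<le>m. Polynomial.smult (poly P (a l)) (L l))"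
proof -
  define N where "N l = (\<Prod>k\<in>{..m} - {l}. [:- a k, 1:])" for l
  define L where "L l = Polynomial.smult (1 / poly (N l) (a l)) (N l)" for l
  have N0: "poly (N l) (a l) \<noteq> 0" for l
    using assms by (auto simp: N_def poly_prod inj_eq)
  have N1: "poly (N l) (a j) = 0" if "j \<le> m" "j \<noteq> l" for l j
    using that by (auto simp: N_def poly_prod)
  have degN: "degree (N l) \<le> m" if "l \<le> m" for l
  proof -
    have "degree (N l) \<le> sum (degree \<circ> (\<lambda>k. [:- a k, 1:])) ({..m} - {l})"
      unfolding N_def by (rule degree_prod_sum_le) simp
    also have "\<dots> = m" using that by simp
    finally show ?thesis .
  qed
  have "P = (\<Sum>l\<le>m. Polynomial.smult (poly P (a l)) (L l))" if "degree P \<le> m" for P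
  proof -
    define R where "R = P - (\<Sum>l\<le>m. Polynomial.smult (poly P (a l)) (L l))"
    have "degree R \<le> m"
      unfolding R_def using that degN
      by (intro degree_diff_le degree_sum_le) (auto simp: L_def)
    have "poly R (a j) = 0" if "j \<le> m" for j
    proof -
      have "poly (\<Sum>l\<le>m. Polynomial.smult (poly P (a l)) (L l)) (a j) =
          (\<Sum>l\<le>m. if l = j then poly P (a j) else 0)"
        unfolding poly_sum using N0 N1[OF that] by (intro sum.cong) (auto simp: L_def)
      then show ?thesis using that by (simp add: R_def)
    qed
    then have "a ` {..m} \<subseteq> {x. poly R x = 0}" by auto
    moreover have "card (a ` {..m}) = Suc m" using assms by (simp add: card_image inj_on_subset)
    ultimately have "R = 0"
      using poly_roots_finite[of R] card_poly_roots_bound[of R] \<open>degree R \<le> m\<close>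
        card_mono[of "{x. poly R x = 0}" "a ` {..m}"] by linarith
    then show ?thesis by (simp add: R_def)
  qed
  then show ?thesis by blast
qed

text \<open>Interpolation in the variable \<open>i\<close> expresses \<open>f\<close> by its values
  at fixed nodes, which by induction are polynomial in the remaining variables. This rests on a
  degree bound \<open>m\<close> uniform in \<open>y\<close>; variables outside \<open>J\<close> stay
  frozen at \<open>y0\<close>.\<close>

lemma separately_polynomial:
  fixes f :: "('i \<Rightarrow> complex) \<Rightarrow> complex"
  assumes "finite J" "\<And>i. infinite (S i)"
    and "\<And>i y. i \<in> J \<Longrightarrow> (\<And>k. y k \<in> S k) \<Longrightarrow>
      \<exists>P. degree P \<le> m \<and> (\<forall>t\<in>S i. f (y(i := t)) = poly P t)"
    and "\<And>k. y0 k \<in> S k"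
  shows "\<exists>p. polyfn J p \<and> (\<forall>y. (\<forall>k. y k \<in> S k) \<longrightarrow> (\<forall>k. k \<notin> J \<longrightarrow> y k = y0 k) \<longrightarrow> f y = p y)"
  using assms(1,3,4)
proof (induction J arbitrary: y0 rule: finite_induct)
  case empty
  have "y = y0" if "\<forall>k. k \<notin> {} \<longrightarrow> y k = y0 k" for y using that by auto
  then show ?case by (intro exI[of _ "\<lambda>_. f y0"]) auto
next
  case (insert i J)
  obtain a :: "nat \<Rightarrow> complex" where a: "inj a" "range a \<subseteq> S i"
    using infinite_countable_subset[OF assms(2)[of i]] by blast
  obtain L where L: "\<And>P. degree P \<le> m \<Longrightarrow> P = (\<Sum>l\<le>m. Polynomial.smult (poly P (a l)) (L l))"
    using lagrange_basis[OF a(1), of m] by blast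
  define Q where "Q l p \<longleftrightarrow> polyfn J p \<and> (\<forall>y. (\<forall>k. y k \<in> S k) \<longrightarrow>
    (\<forall>k. k \<notin> J \<longrightarrow> y k = (y0(i := a l)) k) \<longrightarrow> f y = p y)" for l p
  have "\<exists>p. Q l p" for l
    unfolding Q_def using insert.prems a(2) by (intro insert.IH) auto
  then obtain p where "\<And>l. Q l (p l)" by metis
  then have p: "polyfn J (p l)"
    "\<And>y. (\<forall>k. y k \<in> S k) \<Longrightarrow> (\<forall>k. k \<notin> J \<longrightarrow> y k = (y0(i := a l)) k) \<Longrightarrow> f y = p l y" for l
    unfolding Q_def by blast+
  have p_ins: "polyfn (insert i J) (p l)" for l
    using polyfn_subst[OF p(1)[of l], of "insert i J" "\<lambda>k y. y k"] by simp
  have L_PF: "polyfn (insert i J) (\<lambda>y. poly (L l) (y i))" for l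
    unfolding poly_altdef by (intro polyfn_sum polyfn_mult polyfn_const polyfn_power polyfn_var) simp
  show ?case
  proof (intro exI[of _ "\<lambda>y. \<Sum>l\<le>m. p l y * poly (L l) (y i)"] conjI allI impI)
    show "polyfn (insert i J) (\<lambda>y. \<Sum>l\<le>m. p l y * poly (L l) (y i))"
      by (intro polyfn_sum polyfn_mult p_ins L_PF)
    fix y assume y: "\<forall>k. y k \<in> S k" "\<forall>k. k \<notin> insert i J \<longrightarrow> y k = y0 k"
    obtain P where P: "degree P \<le> m" "\<forall>t\<in>S i. f (y(i := t)) = poly P t"
      using insert.prems(1)[of i y] y(1) by blast
    have "poly P (a l) = p l y" for l
    proof -
      have "a l \<in> S i" using a(2) by auto
      then have "poly P (a l) = f (y(i := a l))" using P(2) by simp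
      also have "\<dots> = p l (y(i := a l))" using y a(2) by (intro p(2)) auto
      also have "\<dots> = p l y" using insert.hyps by (intro polyfn_cong[OF p(1)]) auto
      finally show ?thesis .
    qed
    moreover have "f y = poly P (y i)" using P(2)[rule_format, of "y i"] y by simp
    moreover have "poly P (y i) = (\<Sum>l\<le>m. poly P (a l) * poly (L l) (y i))"
      by (subst L[OF P(1)]) (simp add: poly_sum)
    ultimately show "f y = (\<Sum>l\<le>m. p l y * poly (L l) (y i))" by simp
  qed
qed

lemma polyfn_box:
  fixes I :: "'i set" and V :: "complex set"
  assumes fin: "finite I" and f: "polyfn I f" and V: "open V" "f y0 \<in> V"
  shows "\<exists>\<epsilon>>0. \<forall>y. (\<forall>i\<in>I. cmod (y i - y0 i) < \<epsilon>) \<longrightarrow> f y \<in> V"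
proof -
  have "open (f -` V)"
    using polyfn_continuous_on[OF f] V(1) by (simp add: continuous_on_open_vimage)
  then obtain X where X: "y0 \<in> Pi\<^sub>E UNIV X" "\<And>i. open (X i)" "Pi\<^sub>E UNIV X \<subseteq> f -` V"
    using V(2) product_topology_open_contains_basis[of "\<lambda>i. euclidean" UNIV "f -` V" y0]
    by (auto simp: euclidean_product_topology open_openin[symmetric])
  have "\<exists>e>0. ball (y0 i) e \<subseteq> X i" for i
    using X(1,2) by (meson PiE_mem UNIV_I open_contains_ball)
  then obtain e where e: "\<And>i. e i > 0" "\<And>i. ball (y0 i) (e i) \<subseteq> X i" by metis
  show ?thesis
  proof (intro exI[of _ "Min (insert 1 (e ` I))"] conjI allI impI)
    show "0 < Min (insert 1 (e ` I))" using fin e(1) by auto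
    fix y assume y: "\<forall>i\<in>I. cmod (y i - y0 i) < Min (insert 1 (e ` I))"
    define y' where "y' i = (if i \<in> I then y i else y0 i)" for i
    have "y' i \<in> X i" for i
      using y fin e X(1) by (auto simp: y'_def dist_norm norm_minus_commute intro!: subsetD[OF e(2)])
    then have "f y' \<in> V" using X(3) by auto
    moreover have "f y' = f y" by (rule polyfn_cong[OF f]) (simp add: y'_def)
    ultimately show "f y \<in> V" by simp
  qed
qed

text \<open>Along every line that starts where \<open>q \<noteq> 0\<close>, holomorphy and growth
  make \<open>f\<close> a polynomial of degree at most \<open>m\<close>. In a box around
  \<open>y0\<close> that avoids the zeros of \<open>q\<close>, being polynomial in each variable
  gives a polynomial \<open>p\<close>, and equality with \<open>p\<close> spreads along
  lines.\<close>

lemma poly_extension: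
  fixes f :: "('i \<Rightarrow> complex) \<Rightarrow> complex"
  assumes fin: "finite I" and q: "polyfn I q" "q y0 \<noteq> 0"
    and cong: "\<And>x y. (\<And>i. i \<in> I \<Longrightarrow> x i = y i) \<Longrightarrow> f x = f y"
    and hol: "\<And>y v. (\<lambda>s. f (\<lambda>i. y i + s * v i)) holomorphic_on {s. q (\<lambda>i. y i + s * v i) \<noteq> 0}"
    and bdd: "poly_bdd I (\<lambda>y. q y \<noteq> 0) (\<lambda>y. cmod (f y))"
  shows "\<exists>p. polyfn I p \<and> (\<forall>y. q y \<noteq> 0 \<longrightarrow> f y = p y)"
proof -
  obtain m :: nat where m: "\<And>y. q y \<noteq> 0 \<Longrightarrow> cmod (f y) \<le> m * (1 + pnorm I y) ^ m"
    using bdd unfolding poly_bdd_def by blast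
  have line: "\<exists>P. degree P \<le> m \<and> (\<forall>s. q (\<lambda>i. y i + s * v i) \<noteq> 0 \<longrightarrow> f (\<lambda>i. y i + s * v i) = poly P s)"
    if "q y \<noteq> 0" for y v
  proof -
    define l where "l s = (\<lambda>i. y i + s * v i)" for s
    obtain p where p: "\<And>s. q (l s) = poly p s" unfolding l_def using polyfn_line[OF q(1)] by metis
    define Z where "Z = {s. poly p s = 0}"
    have "p \<noteq> 0" using p[of 0] that by (auto simp: l_def)
    then have "finite Z" unfolding Z_def by (rule poly_roots_finite)
    have Z: "s \<notin> Z \<longleftrightarrow> q (l s) \<noteq> 0" for s by (simp add: Z_def p)
    have "{s. q (\<lambda>i. y i + s * v i) \<noteq> 0} = - Z" using Z by (auto simp: l_def)
    then have "(\<lambda>s. f (l s)) holomorphic_on - Z" using hol[of y v] by (simp add: l_def)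
    \<comment> \<open>Only the constant depends on the line; the exponent \<open>m\<close>, hence
      the degree bound, does not.\<close>
    moreover have "cmod (f (l s)) \<le> (m * (1 + pnorm I y + pnorm I v) ^ m) * (1 + cmod s) ^ m"
      if "s \<notin> Z" for s
    proof -
      have "pnorm I (l s) \<le> pnorm I y + cmod s * pnorm I v"
        unfolding pnorm_def l_def sum_distrib_left sum.distrib[symmetric]
        by (intro sum_mono) (metis norm_mult norm_triangle_ineq)
      then have "1 + pnorm I (l s) \<le> 1 + pnorm I y + cmod s * pnorm I v" by simp
      also have "\<dots> \<le> (1 + pnorm I y + pnorm I v) * (1 + cmod s)"
        by (simp add: algebra_simps)
      finally have "(1 + pnorm I (l s)) ^ m \<le> ((1 + pnorm I y + pnorm I v) * (1 + cmod s)) ^ m"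
        by (intro power_mono) auto
      then have "m * (1 + pnorm I (l s)) ^ m \<le> m * ((1 + pnorm I y + pnorm I v) * (1 + cmod s)) ^ m"
        by (intro mult_left_mono) auto
      then show ?thesis using m[of "l s"] that Z by (simp add: power_mult_distrib mult.assoc)
    qed
    ultimately have "\<exists>P. degree P \<le> m \<and> (\<forall>s. s \<notin> Z \<longrightarrow> f (l s) = poly P s)"
      using \<open>finite Z\<close> by (intro poly_on_line) auto
    then show ?thesis using Z by (simp add: l_def)
  qed
  obtain \<epsilon> where \<epsilon>: "\<epsilon> > 0" "\<And>y. (\<And>i. i \<in> I \<Longrightarrow> cmod (y i - y0 i) < \<epsilon>) \<Longrightarrow> q y \<noteq> 0"
    using polyfn_box[where I = I and f = q and V = "- {0}" and ?y0.0 = y0, OF fin q(1)] q(2)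
    by (auto simp: open_Compl)
  define S where "S i = ball (y0 i) \<epsilon>" for i
  have q_S: "q y \<noteq> 0" if "\<And>k. y k \<in> S k" for y
    using \<epsilon>(2)[of y] that by (simp add: S_def dist_norm norm_minus_commute)
  have "\<exists>p. polyfn I p \<and> (\<forall>y. (\<forall>k. y k \<in> S k) \<longrightarrow> (\<forall>k. k \<notin> I \<longrightarrow> y k = y0 k) \<longrightarrow> f y = p y)"
  proof (rule separately_polynomial[OF fin])
    show "infinite (S i)" for i
      unfolding S_def using \<epsilon>(1) by (intro uncountable_infinite uncountable_ball)
    show "y0 k \<in> S k" for k using \<epsilon>(1) by (simp add: S_def)
    fix i y assume y: "\<And>k. y k \<in> S k"
    define v :: "'i \<Rightarrow> complex" where "v = (\<lambda>j. if j = i then (1::complex) else 0)"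
    obtain P where P: "degree P \<le> m"
      "\<And>s. q (\<lambda>j. y j + s * v j) \<noteq> 0 \<Longrightarrow> f (\<lambda>j. y j + s * v j) = poly P s"
      using line[OF q_S[OF y], of v] by blast
    have upd: "(\<lambda>j. y j + s * v j) = y(i := y i + s)" for s by (auto simp: v_def)
    have "f (y(i := t)) = poly (P \<circ>\<^sub>p [:- y i, 1:]) t" if "t \<in> S i" for t
    proof -
      have "q (y(i := t)) \<noteq> 0" using y that by (intro q_S) auto
      then show ?thesis using P(2)[of "t - y i"] by (simp add: upd poly_pcompose)
    qed
    moreover have "degree (P \<circ>\<^sub>p [:- y i, 1:]) \<le> m"
      using P(1) degree_pcompose_le[of P "[:- y i, 1:]"] by simp
    ultimately show "\<exists>P. degree P \<le> m \<and> (\<forall>t\<in>S i. f (y(i := t)) = poly P t)" by blast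
  qed
  then obtain p where p: "polyfn I p"
    "\<And>y. (\<forall>k. y k \<in> S k) \<Longrightarrow> (\<forall>k. k \<notin> I \<longrightarrow> y k = y0 k) \<Longrightarrow> f y = p y" by blast
  have p': "f y = p y" if "\<And>i. i \<in> I \<Longrightarrow> cmod (y i - y0 i) < \<epsilon>" for y
  proof -
    define y' where "y' i = (if i \<in> I then y i else y0 i)" for i
    have "f y = f y'" by (rule cong) (simp add: y'_def)
    also have "\<dots> = p y'"
      using that \<epsilon>(1) by (intro p(2)) (auto simp: y'_def S_def dist_norm norm_minus_commute)
    also have "\<dots> = p y" by (rule polyfn_cong[OF p(1)]) (simp add: y'_def)
    finally show ?thesis .
  qed
  \<comment> \<open>On the line from \<open>y0\<close> to \<open>y\<close> both \<open>f\<close> and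
    \<open>p\<close> are given by polynomials in the parameter, and these agree near 0.\<close>
  have "f y = p y" if qy: "q y \<noteq> 0" for y
  proof -
    define v where "v = (\<lambda>i. y i - y0 i)"
    obtain P where P: "\<And>s. q (\<lambda>j. y0 j + s * v j) \<noteq> 0 \<Longrightarrow> f (\<lambda>j. y0 j + s * v j) = poly P s"
      using line[OF q(2), of v] by blast
    obtain P' where P': "\<And>s. p (\<lambda>j. y0 j + s * v j) = poly P' s" using polyfn_line[OF p(1)] by metis
    define \<delta> where "\<delta> = \<epsilon> / (1 + pnorm I v)"
    have pos: "1 + pnorm I v > 0" by (simp add: add_pos_nonneg)
    have "poly P s = poly P' s" if "s \<in> ball 0 \<delta>" for s
    proof -
      have small: "cmod ((y0 i + s * v i) - y0 i) < \<epsilon>" if "i \<in> I" for i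
      proof -
        have "cmod (s * v i) \<le> cmod s * (1 + pnorm I v)"
          unfolding norm_mult using pnorm_ge[OF fin that, of v] by (intro mult_left_mono) auto
        also have "\<dots> < \<epsilon>" using \<open>s \<in> _\<close> pos by (simp add: \<delta>_def field_simps)
        finally show ?thesis by simp
      qed
      have "q (\<lambda>j. y0 j + s * v j) \<noteq> 0" by (rule \<epsilon>(2)) (rule small)
      moreover have "f (\<lambda>j. y0 j + s * v j) = p (\<lambda>j. y0 j + s * v j)" by (rule p') (rule small)
      ultimately show ?thesis using P P' by metis
    qed
    moreover have "infinite (ball (0::complex) \<delta>)"
      using pos \<epsilon>(1) by (intro uncountable_infinite uncountable_ball) (simp add: \<delta>_def)
    ultimately have "P = P'" using poly_eq_infinite[of "ball 0 \<delta>" P P'] by blast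
    then show ?thesis using P[of 1] P'[of 1] qy by (simp add: v_def)
  qed
  then show ?thesis using p(1) by blast
qed

section \<open>Univariate polynomials with polynomial coefficients\<close>

lemma monic_poly_induct [consumes 1, case_names one root]:
  fixes p :: "complex poly"
  assumes "lead_coeff p = 1" "P 1"
    and "\<And>a r. lead_coeff r = 1 \<Longrightarrow> P r \<Longrightarrow> P ([:- a, 1:] * r)"
  shows "P p"
  using assms(1)
proof (induction "degree p" arbitrary: p)
  case 0
  then have "p = 1" by (metis degree_eq_zeroE lead_coeff_pCons(2) one_pCons pCons_0_0)
  then show ?case using assms(2) by simp
next
  case (Suc n)
  then obtain a where "poly p a = 0" using alg_closed_imp_poly_has_root[of p] by auto
  then obtain r where r: "p = [:- a, 1:] * r" using poly_eq_0_iff_dvd by (metis dvdE)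
  have "lead_coeff p = lead_coeff [:- a, 1:] * lead_coeff r" unfolding r by (rule lead_coeff_mult)
  then have lr: "lead_coeff r = 1" using Suc.prems by simp
  then have "r \<noteq> 0" by auto
  then have "degree p = Suc (degree r)" unfolding r by (subst degree_mult_eq) auto
  then show ?case using Suc lr r assms(3) by simp
qed

text \<open>\<open>cmod (poly p t0)\<close> is the product of the distances from \<open>t0\<close>
  to the roots, so it is at least \<open>\<delta> ^ degree p\<close> if no root is nearer than
  \<open>\<delta>\<close>. This supplies the continuity of roots.\<close>

lemma monic_root_near:
  fixes p :: "complex poly"
  assumes "lead_coeff p = 1" "\<delta> > 0" "cmod (poly p t0) < \<delta> ^ degree p"
  shows "\<exists>t. cmod (t - t0) < \<delta> \<and> poly p t = 0"
proof (rule ccontr)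
  assume "\<nexists>t. cmod (t - t0) < \<delta> \<and> poly p t = 0"
  then have far: "\<forall>t. poly p t = 0 \<longrightarrow> \<delta> \<le> cmod (t - t0)" by force
  have "\<delta> ^ degree p \<le> cmod (poly p t0)"
    using assms(1) far
  proof (induction rule: monic_poly_induct)
    case (root a r)
    then have "r \<noteq> 0" by auto
    have "\<delta> \<le> cmod (t0 - a)" using root.prems by (simp add: norm_minus_commute)
    moreover have "\<delta> ^ degree r \<le> cmod (poly r t0)" using root by simp
    ultimately have "\<delta> * \<delta> ^ degree r \<le> cmod (t0 - a) * cmod (poly r t0)"
      using assms(2) by (intro mult_mono) auto
    moreover have "degree ([:- a, 1:] * r) = Suc (degree r)"
      using \<open>r \<noteq> 0\<close> by (subst degree_mult_eq) auto
    moreover have "poly ([:- a, 1:] * r) t0 = (t0 - a) * poly r t0" by (simp add: algebra_simps)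
    ultimately show ?case by (simp only: norm_mult power_Suc)
  qed simp
  then show False using assms(3) by simp
qed

text \<open>Each linear factor \<open>t - a\<close> multiplies a bound for the coefficients by at
  most \<open>1 + R\<close>.\<close>

lemma monic_coeff_bound:
  fixes p :: "complex poly"
  assumes "lead_coeff p = 1" "\<forall>t. poly p t = 0 \<longrightarrow> cmod t \<le> R" "R \<ge> 0"
  shows "cmod (coeff p j) \<le> (1 + R) ^ degree p"
  using assms(1,2)
proof (induction arbitrary: j rule: monic_poly_induct)
  case one
  show ?case by (simp add: coeff_1 split: nat.split)
next
  case (root a r)
  have "r \<noteq> 0" using root by auto
  have a: "cmod a \<le> R" using root.prems by simp
  have IH: "cmod (coeff r j) \<le> (1 + R) ^ degree r" for j using root by simp
  have "coeff ([:- a, 1:] * r) j = (if j = 0 then 0 else coeff r (j - 1)) - a * coeff r j"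
    by (simp add: coeff_pCons split: nat.split)
  also have "cmod \<dots> \<le> cmod (if j = 0 then 0 else coeff r (j - 1)) + cmod (a * coeff r j)"
    by (rule norm_triangle_ineq4)
  also have "\<dots> \<le> (1 + R) ^ degree r + R * (1 + R) ^ degree r"
  proof (rule add_mono)
    show "cmod (if j = 0 then 0 else coeff r (j - 1)) \<le> (1 + R) ^ degree r"
      using IH assms(3) by simp
    show "cmod (a * coeff r j) \<le> R * (1 + R) ^ degree r"
      unfolding norm_mult using IH assms(3) a by (intro mult_mono) auto
  qed
  also have "\<dots> = (1 + R) ^ Suc (degree r)" by (simp add: algebra_simps)
  also have "Suc (degree r) = degree ([:- a, 1:] * r)"
    using \<open>r \<noteq> 0\<close> by (subst degree_mult_eq) auto
  finally show ?case .
qed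

text \<open>An element of \<open>C[y][t]\<close>. The bound \<open>a\<close> is strict:
  \<open>polyfam I 0\<close> means zero, and \<open>polyfam I (Suc d)\<close> means degree at most
  \<open>d\<close> in \<open>t\<close>, where the top coefficient may vanish for some or all
  \<open>y\<close>.\<close>

definition polyfam :: "'i set \<Rightarrow> nat \<Rightarrow> (('i \<Rightarrow> complex) \<Rightarrow> complex poly) \<Rightarrow> bool" where
  "polyfam I a \<Phi> \<longleftrightarrow> (\<forall>y. \<forall>j\<ge>a. coeff (\<Phi> y) j = 0) \<and> (\<forall>k. polyfn I (\<lambda>y. coeff (\<Phi> y) k))"

lemma polyfam_coeff: "polyfam I a \<Phi> \<Longrightarrow> polyfn I (\<lambda>y. coeff (\<Phi> y) k)"
  by (simp add: polyfam_def)

lemma polyfam_coeff_0: "polyfam I a \<Phi> \<Longrightarrow> a \<le> j \<Longrightarrow> coeff (\<Phi> y) j = 0"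
  by (simp add: polyfam_def)

lemma polyfam_mono: "polyfam I a \<Phi> \<Longrightarrow> a \<le> b \<Longrightarrow> polyfam I b \<Phi>"
  by (simp add: polyfam_def)

lemma polyfam_add: "polyfam I a \<Phi> \<Longrightarrow> polyfam I b \<Psi> \<Longrightarrow> polyfam I (max a b) (\<lambda>y. \<Phi> y + \<Psi> y)"
  by (simp add: polyfam_def polyfn_add)

lemma polyfam_diff: "polyfam I a \<Phi> \<Longrightarrow> polyfam I b \<Psi> \<Longrightarrow> polyfam I (max a b) (\<lambda>y. \<Phi> y - \<Psi> y)"
  by (simp add: polyfam_def polyfn_diff)

lemma polyfam_smult: "polyfam I a \<Phi> \<Longrightarrow> polyfn I f \<Longrightarrow> polyfam I a (\<lambda>y. Polynomial.smult (f y) (\<Phi> y))"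
  by (simp add: polyfam_def polyfn_mult)

lemma polyfam_monom: "polyfn I f \<Longrightarrow> polyfam I (Suc k) (\<lambda>y. Polynomial.monom (f y) k)"
proof -
  assume f: "polyfn I f"
  have "polyfn I (\<lambda>y. coeff (Polynomial.monom (f y) k) j)" for j
    using f by (cases "k = j") simp_all
  then show ?thesis by (simp add: polyfam_def)
qed

lemma polyfam_const: "polyfam I 1 (\<lambda>y. [:c:])"
  using polyfam_monom[of I "\<lambda>_. c" 0] by (simp add: monom_0)

lemma polyfam_mult:
  assumes "polyfam I a \<Phi>" "polyfam I b \<Psi>"
  shows "polyfam I (a + b) (\<lambda>y. \<Phi> y * \<Psi> y)"
  unfolding polyfam_def
proof (intro conjI allI impI)
  fix y j assume "a + b \<le> j"
  show "coeff (\<Phi> y * \<Psi> y) j = 0"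
    unfolding coeff_mult
  proof (rule sum.neutral, rule ballI)
    fix i assume "i \<in> {..j}"
    have "a \<le> i \<or> b \<le> j - i" using \<open>a + b \<le> j\<close> by linarith
    then show "coeff (\<Phi> y) i * coeff (\<Psi> y) (j - i) = 0"
      using polyfam_coeff_0[OF assms(1)] polyfam_coeff_0[OF assms(2)] by fastforce
  qed
next
  show "polyfn I (\<lambda>y. coeff (\<Phi> y * \<Psi> y) k)" for k
    unfolding coeff_mult by (intro polyfn_sum polyfn_mult polyfam_coeff[OF assms(1)] polyfam_coeff[OF assms(2)])
qed

lemma polyfam_cong: "polyfam I a \<Phi> \<Longrightarrow> (\<And>i. i \<in> I \<Longrightarrow> x i = y i) \<Longrightarrow> \<Phi> x = \<Phi> y"
  by (rule poly_eqI) (rule polyfn_cong[OF polyfam_coeff])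

lemma polyfam_poly: "polyfam I a \<Phi> \<Longrightarrow> poly (\<Phi> y) t = (\<Sum>j<a. coeff (\<Phi> y) j * t ^ j)"
proof -
  assume *: "polyfam I a \<Phi>"
  show ?thesis
  proof (cases a)
    case 0
    then have "\<Phi> y = 0" using polyfam_coeff_0[OF *] by (intro poly_eqI) simp
    then show ?thesis using 0 by simp
  next
    case (Suc b)
    then have "degree (\<Phi> y) \<le> b" using polyfam_coeff_0[OF *] by (intro degree_le) auto
    then have "poly (\<Phi> y) t = (\<Sum>j\<le>b. coeff (\<Phi> y) j * t ^ j)"
      unfolding poly_altdef by (intro sum.mono_neutral_left) (auto simp: coeff_eq_0)
    then show ?thesis unfolding Suc lessThan_Suc_atMost .
  qed
qed

text \<open>Lowering the bound until the top coefficient is not identically zero gives the generic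
  degree \<open>b\<close>; at single points \<open>y\<close> the degree may still be
  smaller.\<close>

lemma polyfam_top:
  assumes "polyfam I a \<Phi>" "\<Phi> y \<noteq> 0"
  shows "\<exists>b<a. polyfam I (Suc b) \<Phi> \<and> (\<exists>y. coeff (\<Phi> y) b \<noteq> 0)"
  using assms
proof (induction a)
  case 0
  then have "\<Phi> y = 0" using polyfam_coeff_0[OF 0(1)] by (intro poly_eqI) simp
  then show ?case using 0 by simp
next
  case (Suc a)
  show ?case
  proof (cases "\<exists>y. coeff (\<Phi> y) a \<noteq> 0")
    case False
    have "coeff (\<Phi> y) j = 0" if "a \<le> j" for y j
      using False polyfam_coeff_0[OF Suc.prems(1), of j y] that by (cases "j = a") auto
    then have "polyfam I a \<Phi>" using polyfam_coeff[OF Suc.prems(1)] by (simp add: polyfam_def)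
    then show ?thesis using Suc by (meson less_SucI)
  qed (use Suc in blast)
qed

text \<open>Multiplying by the top coefficient of \<open>B\<close> in each step avoids dividing by a
  function of \<open>y\<close>: the top term of \<open>A\<close> cancels against that of
  \<open>M * B\<close>, and the bound drops by one.\<close>

lemma pseudo_division:
  assumes "polyfam I a A" "polyfam I (Suc e) B"
  shows "\<exists>k b S T. polyfam I b S \<and> polyfam I e T \<and>
    (\<forall>y. Polynomial.smult (coeff (B y) e ^ k) (A y) = B y * S y + T y)"
  using assms(1)
proof (induction a arbitrary: A)
  case 0
  then have "polyfam I e A" by (rule polyfam_mono) simp
  then show ?case
    using polyfam_const[of I 0]
    by (intro exI[of _ 0] exI[of _ 1] exI[of _ "\<lambda>_. 0"] exI[of _ A]) simp
next
  case (Suc a)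
  show ?case
  proof (cases "Suc a \<le> e")
    case True
    then have "polyfam I e A" using Suc.prems by (elim polyfam_mono)
    then show ?thesis
      using polyfam_const[of I 0]
      by (intro exI[of _ 0] exI[of _ 1] exI[of _ "\<lambda>_. 0"] exI[of _ A]) simp
  next
    case False
    define M where "M y = Polynomial.monom (coeff (A y) a) (a - e)" for y
    define A' where "A' y = Polynomial.smult (coeff (B y) e) (A y) - M y * B y" for y
    have M: "polyfam I (Suc (a - e)) M"
      unfolding M_def[abs_def] by (rule polyfam_monom) (rule polyfam_coeff[OF Suc.prems])
    have "polyfam I (max (Suc a) (Suc (a - e) + Suc e)) A'"
      unfolding A'_def[abs_def]
      by (intro polyfam_diff polyfam_smult polyfam_mult M Suc.prems assms(2) polyfam_coeff[OF assms(2)])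
    then have PFA': "polyfn I (\<lambda>y. coeff (A' y) k)" for k by (rule polyfam_coeff)
    have "coeff (A' y) j = 0" if "a \<le> j" for y j
    proof -
      have MB: "coeff (M y * B y) j = coeff (A y) a * coeff (B y) (j - (a - e))"
        using that unfolding M_def by (simp add: coeff_monom_mult)
      show ?thesis
      proof (cases "j = a")
        case True
        then have "j - (a - e) = e" using False by simp
        then have "coeff (M y * B y) j = coeff (A y) j * coeff (B y) e"
          unfolding MB by (simp only: True)
        then show ?thesis by (simp add: A'_def)
      next
        case False
        then have "coeff (A y) j = 0" "coeff (B y) (j - (a - e)) = 0"
          using that \<open>\<not> Suc a \<le> e\<close>
          by (auto intro: polyfam_coeff_0[OF Suc.prems] polyfam_coeff_0[OF assms(2)])
        then show ?thesis by (simp add: A'_def MB)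
      qed
    qed
    then have "polyfam I a A'" using PFA' by (simp add: polyfam_def)
    then obtain k b S T where ST: "polyfam I b S" "polyfam I e T"
      "\<And>y. Polynomial.smult (coeff (B y) e ^ k) (A' y) = B y * S y + T y"
      using Suc.IH by blast
    define S' where "S' y = S y + Polynomial.smult (coeff (B y) e ^ k) (M y)" for y
    have "polyfam I (max b (Suc (a - e))) S'"
      unfolding S'_def[abs_def] by (intro polyfam_add ST polyfam_smult M polyfn_power polyfam_coeff[OF assms(2)])
    moreover have "Polynomial.smult (coeff (B y) e ^ Suc k) (A y) = B y * S' y + T y" for y
    proof -
      have "Polynomial.smult (coeff (B y) e ^ Suc k) (A y) =
          Polynomial.smult (coeff (B y) e ^ k) (A' y) + Polynomial.smult (coeff (B y) e ^ k) (M y * B y)"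
        unfolding A'_def by (simp add: smult_diff_right mult.commute)
      then show ?thesis unfolding ST(3) S'_def by (simp add: algebra_simps)
    qed
    ultimately show ?thesis using ST(2) by blast
  qed
qed

lemma coeff_mult_top:
  assumes "\<And>j. j > a \<Longrightarrow> coeff p j = 0" "\<And>j. j > b \<Longrightarrow> coeff q j = 0"
  shows "coeff (p * q) (a + b) = coeff p a * coeff q (b :: nat)"
proof -
  have "coeff (p * q) (a + b) = (\<Sum>i\<le>a + b. if i = a then coeff p a * coeff q b else 0)"
    unfolding coeff_mult
  proof (intro sum.cong refl)
    fix i assume "i \<in> {..a + b}"
    consider "i < a" | "i = a" | "a < i" by linarith
    then show "coeff p i * coeff q (a + b - i) = (if i = a then coeff p a * coeff q b else 0)"
      by cases (auto simp: assms)
  qed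
  then show ?thesis by simp
qed

text \<open>The coefficient of \<open>t ^ d\<close> is the degree \<open>d\<close> part of
  \<open>f\<close> evaluated at \<open>v\<close>. It cannot contain \<open>y\<close>, since each
  factor \<open>y i\<close> takes the place of a factor \<open>t\<close>.\<close>

lemma poly_deg_direction:
  "poly_deg I d f \<Longrightarrow> \<exists>\<Phi> \<tau>. polyfam I (Suc d) \<Phi> \<and> (\<forall>y t. poly (\<Phi> y) t = f (\<lambda>i. y i + t * v i)) \<and>
    (\<forall>y. coeff (\<Phi> y) d = \<tau>)"
proof (induction rule: poly_deg.induct)
  case (poly_deg_const d c)
  have "polyfam I (Suc d) (\<lambda>_. [:c:])" using polyfam_const[of I c] by (rule polyfam_mono) simp
  then show ?case
    by (intro exI[of _ "\<lambda>_. [:c:]"] exI[of _ "coeff [:c:] d"]) simp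
next
  case (poly_deg_var i d)
  have "polyfn I (\<lambda>y. coeff [:y i, v i:] k)" for k
  proof -
    have "(\<lambda>y. coeff [:y i, v i:] k) =
        (if k = 0 then (\<lambda>y. y i) else (\<lambda>_. if k = 1 then v i else 0))"
      by (rule ext) (simp add: coeff_pCons split: nat.split)
    then show ?thesis using poly_deg_var(1) by simp
  qed
  moreover have "coeff [:y i, v i:] j = 0" if "Suc d \<le> j" for y j
    using that poly_deg_var(2) by (auto simp: coeff_pCons split: nat.split)
  ultimately have "polyfam I (Suc d) (\<lambda>y. [:y i, v i:])" by (simp add: polyfam_def)
  moreover have "coeff [:y i, v i:] d = coeff [:0, v i:] d" for y
    using poly_deg_var(2) by (auto simp: coeff_pCons split: nat.split)
  ultimately show ?case
    by (intro exI[of _ "\<lambda>y. [:y i, v i:]"] exI[of _ "coeff [:0, v i:] d"]) (simp add: mult.commute)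
next
  case (poly_deg_add d f g)
  obtain \<Phi> \<tau> where f: "polyfam I (Suc d) \<Phi>" "\<And>y t. poly (\<Phi> y) t = f (\<lambda>i. y i + t * v i)"
    "\<And>y. coeff (\<Phi> y) d = \<tau>" using poly_deg_add.IH(1) by blast
  obtain \<Psi> \<sigma> where g: "polyfam I (Suc d) \<Psi>" "\<And>y t. poly (\<Psi> y) t = g (\<lambda>i. y i + t * v i)"
    "\<And>y. coeff (\<Psi> y) d = \<sigma>" using poly_deg_add.IH(2) by blast
  show ?case
    using polyfam_add[OF f(1) g(1)]
    by (intro exI[of _ "\<lambda>y. \<Phi> y + \<Psi> y"] exI[of _ "\<tau> + \<sigma>"]) (simp add: f g)
next
  case (poly_deg_mult a f b g)
  obtain \<Phi> \<tau> where f: "polyfam I (Suc a) \<Phi>" "\<And>y t. poly (\<Phi> y) t = f (\<lambda>i. y i + t * v i)"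
    "\<And>y. coeff (\<Phi> y) a = \<tau>" using poly_deg_mult.IH(1) by blast
  obtain \<Psi> \<sigma> where g: "polyfam I (Suc b) \<Psi>" "\<And>y t. poly (\<Psi> y) t = g (\<lambda>i. y i + t * v i)"
    "\<And>y. coeff (\<Psi> y) b = \<sigma>" using poly_deg_mult.IH(2) by blast
  have top: "coeff (\<Phi> y * \<Psi> y) (a + b) = \<tau> * \<sigma>" for y
    using coeff_mult_top[of a "\<Phi> y" b "\<Psi> y"] polyfam_coeff_0[OF f(1)] polyfam_coeff_0[OF g(1)] f(3) g(3)
    by simp
  have CL2: "polyfam I (Suc a + Suc b) (\<lambda>y. \<Phi> y * \<Psi> y)" by (rule polyfam_mult[OF f(1) g(1)])
  have "polyfam I (Suc (a + b)) (\<lambda>y. \<Phi> y * \<Psi> y)"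
    unfolding polyfam_def
  proof (intro conjI allI impI)
    fix y j assume "Suc (a + b) \<le> j"
    have "degree (\<Phi> y * \<Psi> y) \<le> a + b"
      by (intro order_trans[OF degree_mult_le] add_mono degree_le)
        (auto intro: polyfam_coeff_0[OF f(1)] polyfam_coeff_0[OF g(1)])
    then show "coeff (\<Phi> y * \<Psi> y) j = 0" using \<open>Suc (a + b) \<le> j\<close> by (intro coeff_eq_0) simp
  qed (rule polyfam_coeff[OF CL2])
  then show ?case
    using top by (intro exI[of _ "\<lambda>y. \<Phi> y * \<Psi> y"] exI[of _ "\<tau> * \<sigma>"]) (simp add: f(2) g(2))
qed

text \<open>The linear change of variables of Noether normalisation.\<close>
lemma monic_direction:
  fixes I :: "'i set"
  assumes fin: "finite I" and f: "polyfn I f" "f y0 \<noteq> 0"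
  shows "\<exists>v d \<tau> \<Phi>. \<tau> \<noteq> 0 \<and> polyfam I (Suc d) \<Phi> \<and> (\<forall>y t. poly (\<Phi> y) t = f (\<lambda>i. y i + t * v i)) \<and>
    (\<forall>y. coeff (\<Phi> y) d = \<tau>)"
proof -
  obtain D where "poly_deg I D f" using f(1) by (auto simp: polyfn_def)
  define T where "T = I \<rightarrow>\<^sub>E {..D}"
  have finT: "finite T" using fin by (simp add: T_def finite_PiE)
  obtain c where c: "\<And>x. f x = (\<Sum>e\<in>T. c e * mon I e x)"
    using poly_deg_monomials[OF fin \<open>poly_deg I D f\<close>] unfolding T_def by blast
  define S where "S = {e \<in> T. c e \<noteq> 0}"
  define deg where "deg e = (\<Sum>i\<in>I. e i)" for e :: "'i \<Rightarrow> nat"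
  have finS: "finite S" using finT by (simp add: S_def)
  have f_S: "f x = (\<Sum>e\<in>S. c e * mon I e x)" for x
    unfolding c S_def using finT by (intro sum.mono_neutral_right) auto
  have "S \<noteq> {}" using f(2) f_S[of y0] by auto
  define d where "d = Max (deg ` S)"
  have d: "\<And>e. e \<in> S \<Longrightarrow> deg e \<le> d" "d \<in> deg ` S"
    unfolding d_def using finS \<open>S \<noteq> {}\<close> by auto
  have mon_PD: "poly_deg I (deg e) (mon I e)" for e
    unfolding mon_def[abs_def] deg_def
    using poly_deg_prod[of I I e "\<lambda>i x. x i ^ e i"] poly_deg_power[OF poly_deg_var, of _ I 1] by simp
  have PDf: "poly_deg I d f"
    unfolding f_S[abs_def] using d(1) by (intro poly_deg_sum poly_deg_cmult) (auto intro: poly_deg_mono[OF mon_PD])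
  \<comment> \<open>The part of highest total degree; by independence of monomials it is nonzero in
    some direction \<open>v\<close>.\<close>
  define top where "top x = (\<Sum>e\<in>{e \<in> S. deg e = d}. c e * mon I e x)" for x
  have "\<exists>v. top v \<noteq> 0"
  proof (rule ccontr)
    assume "\<not> ?thesis"
    then have top0: "top x = 0" for x by blast
    obtain e where e: "e \<in> S" "deg e = d" using d(2) by auto
    define c' where "c' e = (if e \<in> S \<and> deg e = d then c e else 0)" for e
    have "(\<Sum>e\<in>T. c' e * mon I e x) = top x" for x
      unfolding top_def using finT by (intro sum.mono_neutral_cong_right) (auto simp: c'_def S_def)
    then have "c' e = 0"
      using e top0 unfolding T_def by (intro mon_independent[OF fin, where c = c' and K = D]) (auto simp: S_def T_def)
    then show False using e by (simp add: c'_def S_def)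
  qed
  then obtain v where v: "top v \<noteq> 0" by blast
  obtain \<Phi> \<tau> where \<Phi>: "polyfam I (Suc d) \<Phi>" "\<And>y t. poly (\<Phi> y) t = f (\<lambda>i. y i + t * v i)"
    "\<And>y. coeff (\<Phi> y) d = \<tau>" using poly_deg_direction[OF PDf] by blast
  \<comment> \<open>The top coefficient \<open>\<tau>\<close> is the same for all \<open>y\<close>,
    so it can be read off at \<open>y = 0\<close>, where the polynomial in \<open>t\<close> is
    explicit.\<close>
  have "\<Phi> (\<lambda>_. 0) = (\<Sum>e\<in>S. Polynomial.monom (c e * mon I e v) (deg e))"
  proof (rule poly_eq_infinite[of UNIV])
    fix t :: complex
    have "mon I e (\<lambda>i. t * v i) = t ^ deg e * mon I e v" for e
      by (simp add: mon_def deg_def power_mult_distrib prod.distrib power_sum)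
    then show "poly (\<Phi> (\<lambda>_. 0)) t = poly (\<Sum>e\<in>S. Polynomial.monom (c e * mon I e v) (deg e)) t"
      by (simp add: \<Phi>(2) f_S poly_sum poly_monom mult_ac)
  qed (simp add: infinite_UNIV_char_0)
  then have "\<tau> = (\<Sum>e\<in>S. if deg e = d then c e * mon I e v else 0)"
    using \<Phi>(3)[of "\<lambda>_. 0"] by (simp add: coeff_sum coeff_monom)
  also have "\<dots> = top v"
    unfolding top_def using finS by (simp add: sum.inter_filter)
  finally show ?thesis using v \<Phi> by metis
qed

lemma polyfn_direction: "polyfn I f \<Longrightarrow> \<exists>a \<Phi>. polyfam I a \<Phi> \<and> (\<forall>y t. poly (\<Phi> y) t = f (\<lambda>i. y i + t * v i))"
  unfolding polyfn_def using poly_deg_direction by blast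

section \<open>The image of an injective Keller map\<close>

lemma bounded_subsequence:
  fixes X :: "nat \<Rightarrow> nat \<Rightarrow> complex"
  assumes "\<And>k i. i \<in> I \<Longrightarrow> cmod (X k i) \<le> R"
  shows "\<exists>x r. strict_mono r \<and> (\<forall>i\<in>I. (\<lambda>k. X (r k) i) \<longlonglongrightarrow> x i)"
proof -
  define X' where "X' k i = (if i \<in> I then X k i else 0)" for k i
  define S :: "nat \<Rightarrow> complex set" where "S i = (if i \<in> I then cball 0 R else {0})" for i
  have "compact {x. \<forall>i. x i \<in> S i}" by (rule compact_box) (simp add: S_def)
  then have "seq_compact {x. \<forall>i. x i \<in> S i}" by (rule compact_imp_seq_compact)
  moreover have "X' k \<in> {x. \<forall>i. x i \<in> S i}" for k
    using assms by (auto simp: X'_def S_def)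
  ultimately obtain x r where r: "strict_mono r" "(X' \<circ> r) \<longlonglongrightarrow> x"
    using seq_compactE[of "{x. \<forall>i. x i \<in> S i}" X'] by blast
  have "(\<lambda>k. X (r k) i) \<longlonglongrightarrow> x i" if "i \<in> I" for i
  proof -
    have "isCont (\<lambda>x :: nat \<Rightarrow> complex. x i) x"
    proof -
      have "continuous_on UNIV (\<lambda>x :: nat \<Rightarrow> complex. x i)" by simp
      then show ?thesis using continuous_on_eq_continuous_at[OF open_UNIV] by blast
    qed
    from isCont_tendsto_compose[OF this r(2)] show ?thesis
      using that by (simp add: X'_def o_def)
  qed
  then show ?thesis using r(1) by blast
qed

locale injective_Keller =
  fixes I :: "nat set" and F :: "nat \<Rightarrow> (nat \<Rightarrow> complex) \<Rightarrow> complex"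
  assumes fin: "finite I"
    and PFF: "i \<in> I \<Longrightarrow> polyfn I (F i)"
    and K: "Keller I F"
    and inj: "Inj I F"
begin

definition Fv :: "(nat \<Rightarrow> complex) \<Rightarrow> nat \<Rightarrow> complex" where
  "Fv x j = F j x"

definition img :: "(nat \<Rightarrow> complex) \<Rightarrow> bool" where
  "img y \<longleftrightarrow> (\<exists>x. \<forall>i\<in>I. F i x = y i)"

lemma imgI: "(\<And>i. i \<in> I \<Longrightarrow> F i x = y i) \<Longrightarrow> img y"
  unfolding img_def by blast

lemma polyfn_comp_Fv: "polyfn I f \<Longrightarrow> polyfn I (\<lambda>x. f (Fv x))"
  unfolding Fv_def by (rule polyfn_subst[where g = F and I = I]) (simp_all add: PFF)

text \<open>For \<open>y = F(x) - t v\<close> the point \<open>y + t v\<close> of the line is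
  \<open>F(x)\<close>; composites of this form turn statements about pairs \<open>(y, t)\<close>
  into statements about \<open>x\<close>.\<close>

lemma polyfn_comp_Fv_shift: "polyfn I f \<Longrightarrow> polyfn I (\<lambda>x. f (\<lambda>i. Fv x i - t * v i))"
  unfolding Fv_def
  by (rule polyfn_subst[where g = "\<lambda>i x. F i x - t * v i" and I = I]) (simp_all add: polyfn_diff PFF)

lemma dir_deriv_inverse:
  "\<exists>M. (\<forall>i\<in>I. \<forall>k\<in>I. (\<Sum>j\<in>I. M i j * dir_deriv (F j) x (\<lambda>l. if l = k then 1 else 0)) = of_bool (i = k)) \<and>
    (\<forall>i\<in>I. \<forall>k\<in>I. (\<Sum>j\<in>I. dir_deriv (F i) x (\<lambda>l. if l = j then 1 else 0) * M j k) = of_bool (i = k))"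
proof (rule lin_inverse[OF fin])
  fix v assume *: "\<forall>i\<in>I. (\<Sum>j\<in>I. dir_deriv (F i) x (\<lambda>l. if l = j then 1 else 0) * v j) = 0"
  have "dir_deriv (F i) x v = 0" if "i \<in> I" for i
    using * that by (subst dir_deriv_linear[OF fin PFF[OF that]]) (simp add: mult.commute)
  then show "\<forall>j\<in>I. v j = 0" using KellerD[OF K, of x v] by blast
qed

lemma dir_deriv_surj: "\<exists>w. (\<forall>i\<in>I. dir_deriv (F i) x w = a i) \<and> (\<forall>i. i \<notin> I \<longrightarrow> w i = 0)"
proof -
  obtain M where M: "\<And>i k. i \<in> I \<Longrightarrow> k \<in> I \<Longrightarrow>
      (\<Sum>j\<in>I. dir_deriv (F i) x (\<lambda>l. if l = j then 1 else 0) * M j k) = of_bool (i = k)"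
    using dir_deriv_inverse[of x] by blast
  define w where "w j = (if j \<in> I then \<Sum>k\<in>I. M j k * a k else 0)" for j
  have "dir_deriv (F i) x w = a i" if "i \<in> I" for i
  proof -
    have "dir_deriv (F i) x w = (\<Sum>j\<in>I. (\<Sum>k\<in>I. M j k * a k) * dir_deriv (F i) x (\<lambda>l. if l = j then 1 else 0))"
      by (subst dir_deriv_linear[OF fin PFF[OF that]]) (simp add: w_def)
    also have "\<dots> = (\<Sum>k\<in>I. (\<Sum>j\<in>I. dir_deriv (F i) x (\<lambda>l. if l = j then 1 else 0) * M j k) * a k)"
      unfolding sum_distrib_right by (subst sum.swap) (simp add: mult_ac)
    also have "\<dots> = a i" using M that fin by simp
    finally show ?thesis .
  qed
  then show ?thesis by (intro exI[of _ w]) (simp add: w_def)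
qed

text \<open>A minimum of \<open>|F - y|\<^sup>2\<close> on a box around \<open>x\<^sub>0\<close> is attained in the interior if \<open>y\<close> is close to
  \<open>F(x\<^sub>0)\<close>, and there the surjectivity of the derivative forces \<open>F = y\<close>.\<close>
lemma img_open:
  "\<exists>\<epsilon>>0. \<forall>y. (\<forall>i\<in>I. cmod (y i - F i x0) < \<epsilon>) \<longrightarrow> img y"
proof -
  define S where "S i = (if i \<in> I then cball (x0 i) 1 else {x0 i})" for i
  define B where "B = {x. \<forall>i. x i \<in> S i}"
  define E where "E = B \<inter> (\<Union>i\<in>I. {x. cmod (x i - x0 i) = 1})"
  define N where "N y x = (\<Sum>i\<in>I. (cmod (F i x - y i))^2)" for y x
  have B: "compact B" unfolding B_def by (rule compact_box) (simp add: S_def)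
  have "closed (\<Union>i\<in>I. {x :: nat \<Rightarrow> complex. cmod (x i - x0 i) = 1})"
    using fin by (intro closed_UN closed_Collect_eq continuous_intros ballI) auto
  then have E: "compact E" unfolding E_def by (intro compact_Int_closed B)
  have N_cont: "continuous_on A (N y)" for y A
    unfolding N_def
    by (intro continuous_intros) (auto intro: continuous_on_subset[OF polyfn_continuous_on[OF PFF]])
  have N_nonneg: "N y x \<ge> 0" for y x by (auto simp: N_def intro: sum_nonneg)
  \<comment> \<open>By injectivity \<open>F\<close> differs from its value at \<open>x0\<close> on
    the boundary \<open>E\<close> of the box, so the squared distance has a positive lower bound
    there.\<close>
  obtain m where m: "m > 0" "\<And>x. x \<in> E \<Longrightarrow> m \<le> N (Fv x0) x"
  proof (cases "E = {}")
    case False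
    obtain x where x: "x \<in> E" "\<And>x'. x' \<in> E \<Longrightarrow> N (Fv x0) x \<le> N (Fv x0) x'"
      using continuous_attains_inf[OF E False N_cont] by blast
    have "N (Fv x0) x \<noteq> 0"
    proof
      assume "N (Fv x0) x = 0"
      then have "F i x = F i x0" if "i \<in> I" for i
        using fin that by (simp add: N_def Fv_def sum_nonneg_eq_0_iff)
      then have "x i = x0 i" if "i \<in> I" for i using InjD[OF inj, of x x0] that by blast
      then show False using x(1) by (auto simp: E_def)
    qed
    then show ?thesis using that[of "N (Fv x0) x"] x(2) N_nonneg[of "Fv x0" x] by auto
  qed (use that[of 1] in auto)
  \<comment> \<open>This radius gives \<open>N y x0 < m / 4\<close>. A minimum point
    \<open>x\<close> on \<open>E\<close> would satisfy
    \<open>m \<le> 2 N y x + 2 N y x0 \<le> 4 N y x0 < m\<close>. The added 1 keeps the denominator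
    positive for empty \<open>I\<close>.\<close>
  define \<epsilon> where "\<epsilon> = sqrt (m / (4 * (real (card I) + 1)))"
  show ?thesis
  proof (intro exI[of _ \<epsilon>] conjI allI impI)
    show "\<epsilon> > 0" using m(1) by (simp add: \<epsilon>_def)
    fix y assume y: "\<forall>i\<in>I. cmod (y i - F i x0) < \<epsilon>"
    have y0: "N y x0 < m / 4"
    proof -
      have "N y x0 \<le> (\<Sum>i\<in>I. \<epsilon>^2)"
        unfolding N_def using y by (intro sum_mono power_mono) (auto simp: norm_minus_commute less_imp_le)
      also have "\<dots> = real (card I) * (m / (4 * (real (card I) + 1)))"
        using m(1) by (simp add: \<epsilon>_def)
      also have "\<dots> < m / 4" using m(1) by (simp add: field_simps)
      finally show ?thesis .
    qed
    have "x0 \<in> B" by (simp add: B_def S_def)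
    then obtain x where x: "x \<in> B" "\<And>x'. x' \<in> B \<Longrightarrow> N y x \<le> N y x'"
      using continuous_attains_inf[OF B _ N_cont] by blast
    have "x \<notin> E"
    proof
      assume "x \<in> E"
      have "(cmod (a - b))^2 \<le> 2 * (cmod (a - c))^2 + 2 * (cmod (b - c))^2" for a b c
      proof -
        have "(cmod (a - b))^2 \<le> (cmod (a - c) + cmod (b - c))^2"
          using norm_triangle_ineq4[of "a - c" "b - c"] by (intro power_mono) auto
        also have "\<dots> \<le> 2 * (cmod (a - c))^2 + 2 * (cmod (b - c))^2"
          using sum_squares_bound[of "cmod (a - c)" "cmod (b - c)"]
          by (simp add: power2_sum)
        finally show ?thesis .
      qed
      then have "N (Fv x0) x \<le> 2 * N y x + 2 * N y x0"
        unfolding N_def sum_distrib_left sum.distrib[symmetric] Fv_def by (intro sum_mono)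
      moreover have "N y x \<le> N y x0" using x(2) \<open>x0 \<in> B\<close> by blast
      ultimately show False using m(2)[OF \<open>x \<in> E\<close>] y0 by linarith
    qed
    then have interior: "cmod (x i - x0 i) < 1" if "i \<in> I" for i
    proof -
      have "x i \<in> S i" using x(1) by (simp add: B_def)
      then have "cmod (x i - x0 i) \<le> 1"
        using that by (simp add: S_def dist_norm norm_minus_commute)
      moreover have "cmod (x i - x0 i) \<noteq> 1" using x(1) \<open>x \<notin> E\<close> that by (auto simp: E_def)
      ultimately show ?thesis by simp
    qed
    \<comment> \<open>Newton's direction: to first order it multiplies \<open>F - y\<close> by
      \<open>1 - t\<close>, so the squared distance has derivative \<open>- 2 * N y x\<close>, which
      must be zero at an interior minimum.\<close>
    obtain w where w: "\<And>i. i \<in> I \<Longrightarrow> dir_deriv (F i) x w = y i - F i x" "\<And>i. i \<notin> I \<Longrightarrow> w i = 0"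
      using dir_deriv_surj[of x "\<lambda>i. y i - F i x"] by blast
    define g where "g t = N y (\<lambda>i. x i + of_real t * w i)" for t :: real
    have deriv: "(g has_real_derivative - 2 * N y x) (at 0)"
    proof -
      have "((\<lambda>t. (cmod (F i (\<lambda>j. x j + of_real t * w j) - y i))^2)
          has_real_derivative - 2 * (cmod (F i x - y i))^2) (at 0)" if "i \<in> I" for i
      proof -
        define h where "h t = F i (\<lambda>j. x j + of_real t * w j) - y i" for t :: real
        have "((\<lambda>s. F i (\<lambda>j. x j + s * w j) - y i) has_field_derivative (y i - F i x)) (at 0)"
          using polyfn_has_dd[OF PFF[OF that], of x w] w(1)[OF that]
          by (auto intro!: derivative_eq_intros)
        then have h: "(h has_vector_derivative (y i - F i x)) (at 0)"
          unfolding h_def using has_vector_derivative_real_field[of _ _ 0 UNIV] by simp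
        have "((\<lambda>t. h t \<bullet> h t) has_vector_derivative (h 0 \<bullet> (y i - F i x) + (y i - F i x) \<bullet> h 0)) (at 0)"
          by (rule bounded_bilinear.has_vector_derivative[OF bounded_bilinear_inner h h])
        moreover have "h 0 \<bullet> (y i - F i x) + (y i - F i x) \<bullet> h 0 = - 2 * (cmod (F i x - y i))^2"
          unfolding h_def by (simp add: power2_norm_eq_inner inner_diff_left inner_diff_right inner_commute)
        ultimately show ?thesis
          unfolding has_real_derivative_iff_has_vector_derivative power2_norm_eq_inner h_def by simp
      qed
      then have "(g has_real_derivative (\<Sum>i\<in>I. - 2 * (cmod (F i x - y i))^2)) (at 0)"
        unfolding g_def N_def by (intro DERIV_sum)
      then show ?thesis by (simp add: N_def sum_distrib_left)
    qed
    have "eventually (\<lambda>t::real. \<forall>i\<in>I. cmod (x i + of_real t * w i - x0 i) < 1) (nhds 0)"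
    proof (rule eventually_ball_finite[OF fin], rule ballI)
      fix i assume "i \<in> I"
      have "((\<lambda>t::real. cmod (x i + of_real t * w i - x0 i)) \<longlongrightarrow> cmod (x i + of_real 0 * w i - x0 i)) (nhds 0)"
        by (intro tendsto_intros filterlim_ident)
      then show "eventually (\<lambda>t::real. cmod (x i + of_real t * w i - x0 i) < 1) (nhds 0)"
        using interior[OF \<open>i \<in> I\<close>] by (intro order_tendstoD(2)) auto
    qed
    then obtain d where d: "d > 0" "\<And>t::real. \<bar>t\<bar> < d \<Longrightarrow> \<forall>i\<in>I. cmod (x i + of_real t * w i - x0 i) < 1"
      unfolding eventually_nhds_metric by (auto simp: dist_norm)
    have "g 0 \<le> g t" if "\<bar>0 - t\<bar> < d" for t
    proof -
      have "(\<lambda>i. x i + of_real t * w i) \<in> B"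
        using d(2)[of t] that w(2) x(1)
        by (auto simp: B_def S_def dist_norm norm_minus_commute less_imp_le split: if_splits)
      then show ?thesis using x(2) by (simp add: g_def)
    qed
    then have "- 2 * N y x = 0" using DERIV_local_min[OF deriv d(1)] by blast
    then have "F i x = y i" if "i \<in> I" for i
      using fin that by (simp add: N_def sum_nonneg_eq_0_iff)
    then show "img y" by (rule imgI)
  qed
qed

text \<open>The image contains a box, so the identity theorem applies. This takes the place of
  density of the image and makes composition with \<open>F\<close> injective on polynomials.\<close>

lemma zero_if_zero_on_img:
  assumes "polyfn I f" "\<And>x. f (Fv x) = 0"
  shows "f y = 0"
proof -
  obtain \<epsilon> where \<epsilon>: "\<epsilon> > 0" "\<And>y. (\<forall>i\<in>I. cmod (y i - F i undefined) < \<epsilon>) \<Longrightarrow> img y"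
    using img_open by blast
  show ?thesis
  proof (rule polyfn_zero_on_box[OF fin assms(1) \<epsilon>(1)])
    fix y assume "\<And>i. i \<in> I \<Longrightarrow> cmod (y i - F i undefined) < \<epsilon>"
    then obtain x where "\<forall>i\<in>I. F i x = y i" using \<epsilon>(2)[of y] unfolding img_def by blast
    then have "f y = f (Fv x)" by (intro polyfn_cong[OF assms(1)]) (simp add: Fv_def)
    then show "f y = 0" using assms(2) by simp
  qed
qed

text \<open>For large \<open>k\<close> there are more products of powers \<open>x\<^sub>i\<^sup>a F\<^sup>b\<close> with exponents at most \<open>k\<close> than
  monomials of their degree.\<close>
lemma algebraic_relation:
  assumes i: "i \<in> I"
  shows "\<exists>D p. D \<ge> 1 \<and> (\<forall>a. polyfn I (p a)) \<and> (\<exists>y. p D y \<noteq> 0) \<and>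
    (\<forall>x. (\<Sum>a\<le>D. p a (Fv x) * x i ^ a) = 0)"
proof -
  obtain d where d: "\<And>j. j \<in> I \<Longrightarrow> poly_deg I d (F j)"
    using polyfn_PD_common[OF fin, of I F] PFF by blast
  define n where "n = card I"
  \<comment> \<open>\<open>D\<close> bounds the degree \<open>k + k n d\<close> of the products.
    With this \<open>k\<close> the monomials number
    \<open>(D + 1)^n \<le> ((k + 1) (1 + n d))^n = (k + 1)^n k\<close>, fewer than the
    \<open>(k + 1)^(n + 1)\<close> products.\<close>
  define k where "k = (1 + n * d) ^ n"
  define D where "D = k * (1 + n * d)"
  define A where "A = {..k} \<times> (I \<rightarrow>\<^sub>E {..k})"
  define g where "g ab x = x i ^ fst ab * mon I (snd ab) (Fv x)" for ab x
  have PDg: "poly_deg I D (g ab)" if "ab \<in> A" for ab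
  proof -
    have e: "fst ab \<le> k" "\<And>j. j \<in> I \<Longrightarrow> snd ab j \<le> k" using that by (auto simp: A_def)
    have "poly_deg I (\<Sum>j\<in>I. snd ab j * d) (\<lambda>x. \<Prod>j\<in>I. F j x ^ snd ab j)"
      by (intro poly_deg_prod poly_deg_power d)
    moreover have "(\<Sum>j\<in>I. snd ab j * d) \<le> (\<Sum>j\<in>I. k * d)"
      using e(2) by (intro sum_mono mult_right_mono) auto
    ultimately have "poly_deg I (k * (n * d)) (\<lambda>x. \<Prod>j\<in>I. F j x ^ snd ab j)"
      by (elim poly_deg_mono) (simp add: n_def mult_ac)
    moreover have "poly_deg I k (\<lambda>x. x i ^ fst ab)"
      using poly_deg_power[OF poly_deg_var[OF i, of 1], of "fst ab"] e(1) by (auto elim: poly_deg_mono)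
    ultimately have "poly_deg I (k + k * (n * d)) (\<lambda>x. x i ^ fst ab * (\<Prod>j\<in>I. F j x ^ snd ab j))"
      by (intro poly_deg_mult)
    then show ?thesis
      unfolding g_def[abs_def] mon_def Fv_def D_def by (simp add: add_mult_distrib2)
  qed
  define T where "T = I \<rightarrow>\<^sub>E {..D}"
  have "\<exists>M. \<forall>x. g ab x = (\<Sum>e\<in>T. M e * mon I e x)" if "ab \<in> A" for ab
    unfolding T_def by (rule poly_deg_monomials[OF fin PDg[OF that]])
  then obtain M where M: "\<And>ab x. ab \<in> A \<Longrightarrow> g ab x = (\<Sum>e\<in>T. M ab e * mon I e x)" by metis
  have fin_TA: "finite T" "finite A" using fin by (auto simp: T_def A_def finite_PiE)
  have "card T < card A"
  proof -
    have "card T = (D + 1) ^ n" unfolding T_def using fin by (simp add: card_PiE n_def)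
    also have "\<dots> \<le> ((k + 1) * (1 + n * d)) ^ n"
      by (intro power_mono) (auto simp: D_def)
    also have "\<dots> = (k + 1) ^ n * k" unfolding power_mult_distrib by (simp only: k_def)
    also have "\<dots> < (k + 1) ^ n * (k + 1)" by simp
    also have "\<dots> = card A" unfolding A_def using fin by (simp add: card_PiE n_def card_cartesian_product)
    finally show ?thesis .
  qed
  then obtain c where c: "\<exists>ab\<in>A. c ab \<noteq> 0" "\<And>e. e \<in> T \<Longrightarrow> (\<Sum>ab\<in>A. c ab * M ab e) = 0"
    using more_unknowns_than_equations[OF fin_TA, of M] by blast
  define p where "p a y = (\<Sum>b\<in>I \<rightarrow>\<^sub>E {..k}. c (a, b) * mon I b y)" for a y
  have PFp: "polyfn I (p a)" for a
    unfolding p_def[abs_def] by (intro polyfn_sum polyfn_mult polyfn_const polyfn_mon)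
  have rel: "(\<Sum>a\<le>k. p a (Fv x) * x i ^ a) = 0" for x
  proof -
    have "(\<Sum>a\<le>k. p a (Fv x) * x i ^ a) = (\<Sum>ab\<in>A. c ab * g ab x)"
      unfolding A_def p_def g_def
      by (simp add: sum.cartesian_product[symmetric] sum_distrib_right sum_distrib_left mult_ac split_def)
        (simp add: sum.cartesian_product split_def mult_ac)
    also have "\<dots> = (\<Sum>e\<in>T. (\<Sum>ab\<in>A. c ab * M ab e) * mon I e x)"
      unfolding sum_distrib_right by (subst sum.swap) (simp add: M sum_distrib_left mult.assoc)
    also have "\<dots> = 0" using c(2) by simp
    finally show ?thesis .
  qed
  \<comment> \<open>Independence of monomials makes some coefficient \<open>p a\<close> nonzero;
    cutting the relation off at the largest such index makes its leading coefficient
    nonzero.\<close>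
  define Z where "Z = {a. a \<le> k \<and> (\<exists>y. p a y \<noteq> 0)}"
  obtain a b where ab: "a \<le> k" "b \<in> I \<rightarrow>\<^sub>E {..k}" "c (a, b) \<noteq> 0" using c(1) by (auto simp: A_def)
  have "\<exists>y. p a y \<noteq> 0"
  proof (rule ccontr)
    assume "\<not> ?thesis"
    then have "c (a, b) = 0"
      by (intro mon_independent[OF fin _ ab(2), where c = "\<lambda>b. c (a, b)"]) (simp add: p_def)
    then show False using ab(3) by simp
  qed
  then have "a \<in> Z" using ab(1) by (simp add: Z_def)
  have finZ: "finite Z" by (simp add: Z_def)
  define m where "m = Max Z"
  have m: "m \<in> Z" "\<And>a. a \<in> Z \<Longrightarrow> a \<le> m"
    unfolding m_def using finZ \<open>a \<in> Z\<close> by (auto intro: Max_in)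
  have rel': "(\<Sum>a\<le>m. p a (Fv x) * x i ^ a) = 0" for x
  proof -
    have "(\<Sum>a\<le>m. p a (Fv x) * x i ^ a) = (\<Sum>a\<le>k. p a (Fv x) * x i ^ a)"
    proof (rule sum.mono_neutral_left)
      show "{..m} \<subseteq> {..k}" using m(1) by (auto simp: Z_def)
      show "\<forall>a\<in>{..k} - {..m}. p a (Fv x) * x i ^ a = 0"
        using m(2) by (force simp: Z_def)
    qed simp
    then show ?thesis using rel by simp
  qed
  \<comment> \<open>Without a positive power of \<open>x i\<close> the relation would be a nonzero
    polynomial vanishing on the image.\<close>
  have "m \<noteq> 0"
  proof
    assume "m = 0"
    then have "p 0 (Fv x) = 0" for x using rel'[of x] by simp
    then have "p 0 y = 0" for y by (rule zero_if_zero_on_img[OF PFp])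
    then show False using m(1) \<open>m = 0\<close> by (simp add: Z_def)
  qed
  then show ?thesis
    using PFp m(1) rel' by (intro exI[of _ m] exI[of _ p]) (simp add: Z_def)
qed

text \<open>A quantitative form of properness: \<open>x i\<close> stays bounded as long as
  \<open>F x\<close> is bounded and \<open>q (F x)\<close> stays away from zero.\<close>

definition growth :: "((nat \<Rightarrow> complex) \<Rightarrow> complex) \<Rightarrow> nat \<Rightarrow> bool" where
  "growth q i \<longleftrightarrow> (\<exists>B. poly_bdd I (\<lambda>_. True) B \<and> (\<forall>y. 0 \<le> B y) \<and> (\<forall>x. cmod (q (Fv x) * x i) \<le> B (Fv x)))"

text \<open>Multiplying the relation by \<open>p_D ^ (D - 1)\<close> makes it monic in
  \<open>p_D x_i\<close>, with coefficients \<open>b a\<close> polynomial in \<open>F x\<close>; the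
  root bound is then of polynomial growth in \<open>F x\<close>.\<close>

lemma growth_coordinate:
  assumes "i \<in> I"
  shows "\<exists>q. polyfn I q \<and> (\<exists>y. q y \<noteq> 0) \<and> growth q i"
proof -
  obtain D p where D: "D \<ge> 1" and p: "\<And>a. polyfn I (p a)" "\<exists>y. p D y \<noteq> 0"
    and rel: "\<And>x. (\<Sum>a\<le>D. p a (Fv x) * x i ^ a) = 0"
    using algebraic_relation[OF assms] by blast
  define b where "b a y = - p a y * p D y ^ (D - 1 - a)" for a y
  define B where "B y = 1 + (\<Sum>a<D. cmod (b a y))" for y
  have "polyfn I (b a)" for a
    unfolding b_def[abs_def] by (intro polyfn_mult polyfn_uminus polyfn_power p)
  then have "poly_bdd I (\<lambda>_. True) B"
    unfolding B_def[abs_def] by (intro poly_bdd_add poly_bdd_const poly_bdd_sum polyfn_poly_bdd fin)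
  moreover have "0 \<le> B y" for y unfolding B_def by (simp add: add_nonneg_nonneg sum_nonneg)
  moreover have "cmod (p D (Fv x) * x i) \<le> B (Fv x)" for x
    unfolding B_def
  proof (rule root_bound[OF D])
    define y where "y = Fv x"
    have "(p D y * x i) ^ D + (\<Sum>a<D. - b a y * (p D y * x i) ^ a) =
        p D y ^ (D - 1) * (\<Sum>a\<le>D. p a y * x i ^ a)"
    proof -
      have "(\<Sum>a<D. - b a y * (p D y * x i) ^ a) = (\<Sum>a<D. p D y ^ (D - 1) * (p a y * x i ^ a))"
      proof (rule sum.cong[OF refl])
        fix a assume "a \<in> {..<D}"
        then have "p D y ^ (D - 1) = p D y ^ (D - 1 - a) * p D y ^ a"
          by (simp add: power_add[symmetric])
        then show "- b a y * (p D y * x i) ^ a = p D y ^ (D - 1) * (p a y * x i ^ a)"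
          by (simp add: b_def power_mult_distrib mult_ac)
      qed
      moreover have "(p D y * x i) ^ D = p D y ^ (D - 1) * (p D y * x i ^ D)"
        using D by (cases D) (simp_all add: power_mult_distrib mult_ac)
      moreover have "{..D} = insert D {..<D}" by auto
      ultimately show ?thesis by (simp add: sum_distrib_left distrib_left)
    qed
    then show "(p D (Fv x) * x i) ^ D = (\<Sum>a<D. b a (Fv x) * (p D (Fv x) * x i) ^ a)"
      using rel[of x] by (simp add: y_def sum_negf)
  qed
  ultimately have "growth (p D) i" unfolding growth_def by blast
  then show ?thesis using p by blast
qed

lemma growth_mult: "growth q i \<Longrightarrow> polyfn I r \<Longrightarrow> growth (\<lambda>y. r y * q y) i"
proof -
  assume "growth q i" and r: "polyfn I r"
  then obtain B where B: "poly_bdd I (\<lambda>_. True) B" "\<And>y. 0 \<le> B y"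
    "\<And>x. cmod (q (Fv x) * x i) \<le> B (Fv x)" unfolding growth_def by blast
  have "poly_bdd I (\<lambda>_. True) (\<lambda>y. cmod (r y) * B y)"
    using B by (intro poly_bdd_mult polyfn_poly_bdd fin r) auto
  moreover have "cmod (r (Fv x) * q (Fv x) * x i) \<le> cmod (r (Fv x)) * B (Fv x)" for x
    using B(3)[of x] by (simp add: norm_mult mult.assoc mult_left_mono)
  ultimately show ?thesis
    unfolding growth_def using B(2) by (intro exI[of _ "\<lambda>y. cmod (r y) * B y"]) auto
qed

text \<open>A growth bound survives multiplication of \<open>q\<close> by a polynomial, so the
  product of the denominators serves all coordinates.\<close>

lemma growth_all: "\<exists>q. polyfn I q \<and> (\<exists>y. q y \<noteq> 0) \<and> (\<forall>i\<in>I. growth q i)"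
proof -
  have "\<exists>q. polyfn I q \<and> (\<exists>y. q y \<noteq> 0) \<and> (\<forall>i\<in>J. growth q i)" if "finite J" "J \<subseteq> I" for J
    using that
  proof (induction J rule: finite_induct)
    case empty
    show ?case by (intro exI[of _ "\<lambda>_. 1"]) auto
  next
    case (insert i J)
    obtain q where q: "polyfn I q" "\<exists>y. q y \<noteq> 0" "\<forall>i\<in>J. growth q i" using insert by auto
    obtain r where r: "polyfn I r" "\<exists>y. r y \<noteq> 0" "growth r i"
      using growth_coordinate[of i] insert.prems by auto
    obtain y where "q y * r y \<noteq> 0"
      using polyfn_common_nonzero[OF q(1) _ r(1)] q(2) r(2) by auto
    moreover have "growth (\<lambda>y. q y * r y) i" by (rule growth_mult[OF r(3) q(1)])
    moreover have "growth (\<lambda>y. q y * r y) j" if "j \<in> J" for j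
      using growth_mult[OF q(3)[rule_format, OF that] r(1)] by (simp add: mult.commute)
    ultimately show ?case
      using q(1) r(1) by (intro exI[of _ "\<lambda>y. q y * r y"]) auto
  qed
  then show ?thesis using fin by blast
qed

end

section \<open>Rationality of the inverse\<close>

locale injective_Keller_growth = injective_Keller +
  fixes q :: "(nat \<Rightarrow> complex) \<Rightarrow> complex"
  assumes PFq: "polyfn I q" and q_nonzero: "\<exists>y. q y \<noteq> 0" and q_growth: "i \<in> I \<Longrightarrow> growth q i"
begin

text \<open>Properness over \<open>q \<noteq> 0\<close>: along the sequence \<open>q\<close> stays
  away from zero, the growth bounds keep the preimages bounded, and by continuity a limit of a
  subsequence is a preimage of \<open>y\<close>.\<close>

lemma subseq_preimage:
  fixes X :: "nat \<Rightarrow> nat \<Rightarrow> complex"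
  assumes y: "q y \<noteq> 0" and X: "\<And>i. i \<in> I \<Longrightarrow> (\<lambda>k. F i (X k)) \<longlonglongrightarrow> y i"
  shows "\<exists>x r. strict_mono r \<and> (\<forall>i\<in>I. (\<lambda>k. X (r k) i) \<longlonglongrightarrow> x i) \<and> (\<forall>i\<in>I. F i x = y i)"
proof -
  have qX: "(\<lambda>k. q (Fv (X k))) \<longlonglongrightarrow> q y"
    unfolding Fv_def using X by (intro polyfn_tendsto[OF PFq])
  have "Bseq (\<lambda>k. X k i)" if i: "i \<in> I" for i
  proof -
    obtain B where B: "poly_bdd I (\<lambda>_. True) B" "\<And>x. cmod (q (Fv x) * x i) \<le> B (Fv x)"
      using q_growth[OF i] unfolding growth_def by blast
    obtain m :: nat where m: "\<And>y. B y \<le> m * (1 + pnorm I y) ^ m"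
      using B(1) unfolding poly_bdd_def by blast
    define b where "b k = m * (1 + pnorm I (Fv (X k))) ^ m / cmod (q (Fv (X k)))" for k
    have "b \<longlonglongrightarrow> m * (1 + pnorm I y) ^ m / cmod (q y)"
      unfolding b_def pnorm_def using y
      by (intro tendsto_intros qX) (auto simp: Fv_def intro: X)
    then have "Bseq b" by (rule convergent_imp_Bseq[OF convergentI])
    moreover have "eventually (\<lambda>k. q (Fv (X k)) \<noteq> 0) sequentially"
      using tendsto_imp_eventually_ne[OF qX y] .
    then have "eventually (\<lambda>k. norm (X k i) \<le> norm (b k)) sequentially"
    proof eventually_elim
      case (elim k)
      have "cmod (q (Fv (X k))) * cmod (X k i) \<le> m * (1 + pnorm I (Fv (X k))) ^ m"
        using B(2)[of "X k"] m[of "Fv (X k)"] by (simp add: norm_mult)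
      then have "cmod (X k i) \<le> b k"
        using elim by (simp add: b_def pos_le_divide_eq mult.commute)
      then show ?case by simp
    qed
    ultimately show ?thesis by (rule Bseq_eventually_mono[rotated])
  qed
  then have "\<exists>R. \<forall>k. cmod (X k i) \<le> R" if "i \<in> I" for i
    using that unfolding Bseq_def by blast
  then obtain R where R: "\<And>i k. i \<in> I \<Longrightarrow> cmod (X k i) \<le> R i" by metis
  have "cmod (X k i) \<le> (\<Sum>i\<in>I. \<bar>R i\<bar>)" if "i \<in> I" for i k
    using R[OF that, of k] member_le_sum[of i I "\<lambda>i. \<bar>R i\<bar>"] fin that by fastforce
  then obtain x r where xr: "strict_mono r" "\<And>i. i \<in> I \<Longrightarrow> (\<lambda>k. X (r k) i) \<longlonglongrightarrow> x i"
    using bounded_subsequence[of I X] by blast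
  have "F i x = y i" if "i \<in> I" for i
  proof (rule LIMSEQ_unique)
    show "(\<lambda>k. F i (X (r k))) \<longlonglongrightarrow> F i x"
      by (rule polyfn_tendsto[OF PFF[OF that]]) (rule xr(2))
    show "(\<lambda>k. F i (X (r k))) \<longlonglongrightarrow> y i"
      using LIMSEQ_subseq_LIMSEQ[OF X[OF that] xr(1)] by (simp add: o_def)
  qed
  then show ?thesis using xr by blast
qed

text \<open>On a complex line minus the finitely many zeros of \<open>q\<close>, which is connected, the image of
  \<open>F\<close> is open and closed.\<close>
lemma img_if_nonzero:
  assumes "q y \<noteq> 0"
  shows "img y"
proof -
  obtain y1 where y1: "q y1 \<noteq> 0" "img y1"
  proof -
    obtain x where "q (Fv x) \<noteq> 0" using zero_if_zero_on_img[OF PFq] q_nonzero by blast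
    then show ?thesis using that[of "Fv x"] imgI[of x "Fv x"] by (simp add: Fv_def)
  qed
  define l where "l s = (\<lambda>i. y1 i + s * (y i - y1 i))" for s
  obtain p where p: "\<And>s. q (l s) = poly p s" unfolding l_def using polyfn_line[OF PFq] by metis
  define Z where "Z = {s. poly p s = 0}"
  have l01: "l 0 = y1" "l 1 = y" by (auto simp: l_def)
  have "p \<noteq> 0" using p[of 0] y1(1) by (auto simp: l01)
  then have finZ: "finite Z" unfolding Z_def by (rule poly_roots_finite)
  define S where "S = - Z"
  have S: "s \<in> S \<longleftrightarrow> q (l s) \<noteq> 0" for s by (simp add: S_def Z_def p)
  have "connected S"
    unfolding S_def Compl_eq_Diff_UNIV by (rule connected_open_delete_finite[OF _ _ _ finZ]) auto
  have "open S" unfolding S_def using finZ by (simp add: finite_imp_closed open_Compl)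
  define A where "A = {s \<in> S. img (l s)}"
  have "open A"
  proof (subst open_subopen, rule ballI)
    fix s assume "s \<in> A"
    then have "s \<in> S" "img (l s)" by (auto simp: A_def)
    then obtain x where x: "\<And>i. i \<in> I \<Longrightarrow> F i x = l s i" by (auto simp: img_def)
    obtain \<epsilon> where \<epsilon>: "\<epsilon> > 0" "\<And>y. (\<forall>i\<in>I. cmod (y i - F i x) < \<epsilon>) \<Longrightarrow> img y"
      using img_open[of x] by blast
    define V where "V = S \<inter> (\<Inter>i\<in>I. {t. cmod (l t i - l s i) < \<epsilon>})"
    have "open V"
      unfolding V_def l_def using fin
      by (intro open_Int \<open>open S\<close> open_INT open_Collect_less continuous_intros ballI) auto
    moreover have "s \<in> V" using \<open>s \<in> S\<close> \<epsilon>(1) by (simp add: V_def)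
    moreover have "V \<subseteq> A"
    proof
      fix t assume "t \<in> V"
      then have "\<forall>i\<in>I. cmod (l t i - F i x) < \<epsilon>" by (simp add: V_def x)
      then show "t \<in> A" using \<epsilon>(2) \<open>t \<in> V\<close> by (simp add: A_def V_def)
    qed
    ultimately show "\<exists>T. open T \<and> s \<in> T \<and> T \<subseteq> A" by blast
  qed
  then have "openin (top_of_set S) A" by (intro open_subset) (auto simp: A_def)
  moreover have "closedin (top_of_set S) A"
    unfolding closedin_limpt
  proof (intro conjI allI impI)
    show "A \<subseteq> S" by (auto simp: A_def)
    fix s assume s: "s islimpt A \<and> s \<in> S"
    then obtain t where t: "\<And>k. t k \<in> A - {s}" "t \<longlonglongrightarrow> s"
      using islimpt_sequential by blast
    have "\<exists>x. \<forall>i\<in>I. F i x = l (t k) i" for k using t(1)[of k] by (auto simp: A_def img_def)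
    then obtain X where X: "\<And>k i. i \<in> I \<Longrightarrow> F i (X k) = l (t k) i" by metis
    have lim: "(\<lambda>k. F i (X k)) \<longlonglongrightarrow> l s i" if "i \<in> I" for i
      using t(2) that by (simp add: X l_def) (intro tendsto_intros)
    have "q (l s) \<noteq> 0" using s S by blast
    from subseq_preimage[OF this, of X] lim obtain x where "\<forall>i\<in>I. F i x = l s i" by blast
    then show "s \<in> A" using s by (auto simp: A_def img_def)
  qed
  ultimately have "A = {} \<or> A = S" using \<open>connected S\<close> unfolding connected_clopen by blast
  moreover have "0 \<in> A" using y1 S by (simp add: A_def l01)
  moreover have "1 \<in> S" using assms S by (simp add: l01)
  ultimately have "1 \<in> A" by blast
  then show ?thesis by (simp add: A_def l01)
qed

text \<open>Where \<open>q \<noteq> 0\<close> a preimage exists and is unique on \<open>I\<close>;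
  elsewhere the value is arbitrary. The condition sees only the coordinates of \<open>y\<close> in
  \<open>I\<close>, so points agreeing there have the same chosen preimage.\<close>

definition G :: "(nat \<Rightarrow> complex) \<Rightarrow> nat \<Rightarrow> complex" where
  "G y = (SOME x. \<forall>i\<in>I. F i x = y i)"

lemma F_G: "q y \<noteq> 0 \<Longrightarrow> i \<in> I \<Longrightarrow> F i (G y) = y i"
proof -
  assume "q y \<noteq> 0" "i \<in> I"
  then have "\<exists>x. \<forall>i\<in>I. F i x = y i" using img_if_nonzero by (simp add: img_def)
  then have "\<forall>i\<in>I. F i (G y) = y i" unfolding G_def by (rule someI_ex)
  then show "F i (G y) = y i" using \<open>i \<in> I\<close> by blast
qed

lemma G_eq: "q y \<noteq> 0 \<Longrightarrow> (\<And>j. j \<in> I \<Longrightarrow> F j x = y j) \<Longrightarrow> i \<in> I \<Longrightarrow> G y i = x i"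
  by (rule InjD[OF inj]) (auto simp: F_G)

text \<open>Otherwise some sequence of preimages keeps distance \<open>\<epsilon>\<close> from
  \<open>G y\<close>; by properness a subsequence converges to a preimage of \<open>y\<close>, which
  by injectivity is \<open>G y\<close> on \<open>I\<close>.\<close>

lemma G_tendsto:
  fixes l :: "complex \<Rightarrow> nat \<Rightarrow> complex"
  assumes l: "\<And>i. i \<in> I \<Longrightarrow> ((\<lambda>s. l s i) \<longlongrightarrow> y i) (at s0)" and y: "q y \<noteq> 0" and i: "i \<in> I"
  shows "((\<lambda>s. G (l s) i) \<longlongrightarrow> G y i) (at s0)"
proof (rule ccontr)
  assume "\<not> ?thesis"
  then obtain \<epsilon> where \<epsilon>: "\<epsilon> > 0" "\<not> eventually (\<lambda>s. dist (G (l s) i) (G y i) < \<epsilon>) (at s0)"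
    unfolding tendsto_iff by blast
  have "((\<lambda>s. q (l s)) \<longlongrightarrow> q y) (at s0)" using l by (intro polyfn_tendsto[OF PFq])
  then have "eventually (\<lambda>s. q (l s) \<noteq> 0) (at s0)" using y by (rule tendsto_imp_eventually_ne)
  then have fr: "frequently (\<lambda>s. q (l s) \<noteq> 0 \<and> \<epsilon> \<le> dist (G (l s) i) (G y i)) (at s0)"
  proof -
    have f1: "frequently (\<lambda>s. \<epsilon> \<le> dist (G (l s) i) (G y i)) (at s0)"
      using \<epsilon>(2) by (simp add: frequently_def not_le)
    then show ?thesis
      using frequently_eventually_frequently[OF f1 \<open>eventually (\<lambda>s. q (l s) \<noteq> 0) (at s0)\<close>]
      by (simp add: conj_commute)
  qed
  have "\<exists>s. s \<noteq> s0 \<and> dist s s0 < 1 / Suc k \<and> q (l s) \<noteq> 0 \<and> \<epsilon> \<le> dist (G (l s) i) (G y i)" for k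
  proof -
    have "eventually (\<lambda>s. s \<noteq> s0 \<and> dist s s0 < 1 / Suc k) (at s0)"
      unfolding eventually_at by (intro exI[of _ "1 / Suc k"]) auto
    from frequently_ex[OF frequently_eventually_frequently[OF fr this]] show ?thesis by blast
  qed
  then obtain s where s: "\<And>k. s k \<noteq> s0" "\<And>k. dist (s k) s0 < 1 / Suc k"
    "\<And>k. q (l (s k)) \<noteq> 0" "\<And>k. \<epsilon> \<le> dist (G (l (s k)) i) (G y i)" by metis
  have "s \<longlonglongrightarrow> s0"
  proof (rule metric_LIMSEQ_I)
    fix r :: real assume "r > 0"
    then obtain N where "1 / Suc N < r" using nat_approx_posE by blast
    moreover have "dist (s k) s0 < 1 / Suc N" if "k \<ge> N" for k
      using s(2)[of k] that frac_le[of 1 1 "Suc N" "Suc k"] by simp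
    ultimately show "\<exists>N. \<forall>k\<ge>N. dist (s k) s0 < r" by (meson less_trans)
  qed
  then have s_at: "filterlim s (at s0) sequentially"
    using s(1) by (simp add: filterlim_at)
  have "(\<lambda>k. F j (G (l (s k)))) \<longlonglongrightarrow> y j" if "j \<in> I" for j
    using filterlim_compose[OF l[OF that] s_at] by (simp add: F_G[OF s(3) that])
  then obtain x r where xr: "strict_mono r" "\<forall>j\<in>I. (\<lambda>k. G (l (s (r k))) j) \<longlonglongrightarrow> x j"
    "\<forall>j\<in>I. F j x = y j"
    using subseq_preimage[OF y, of "\<lambda>k. G (l (s k))"] by blast
  have "G y i = x i" using G_eq[OF y _ i] xr(3) by blast
  then have "(\<lambda>k. dist (G (l (s (r k))) i) (G y i)) \<longlonglongrightarrow> 0"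
    using xr(2) i by (simp add: tendsto_dist_iff[symmetric])
  then have "\<epsilon> \<le> 0" using s(4) by (intro tendsto_lowerbound) auto
  then show False using \<epsilon>(1) by simp
qed

text \<open>Hadamard's expansion of \<open>F\<close> at \<open>x0 = G (l s0)\<close> gives the
  linear system \<open>sum_j \<xi>_j D_rj = v_r\<close> for the difference quotients
  \<open>\<xi>\<close>. Its matrix tends to the invertible derivative at \<open>x0\<close> by
  continuity of \<open>G\<close>, so \<open>\<xi>\<close> tends to \<open>w = M v\<close>.\<close>

lemma G_deriv:
  assumes s0: "q (\<lambda>i. y i + s0 * v i) \<noteq> 0" and i: "i \<in> I"
  shows "(\<lambda>s. G (\<lambda>i. y i + s * v i) i) field_differentiable (at s0)"
proof -
  define l where "l s = (\<lambda>i. y i + s * v i)" for s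
  define x0 where "x0 = G (l s0)"
  have "\<exists>D. (\<forall>j. polyfn I (D j)) \<and> (\<forall>x. F r x - F r x0 = (\<Sum>j\<in>I. (x j - x0 j) * D j x))"
    if "r \<in> I" for r
    using polyfn_hadamard[OF fin PFF[OF that]] .
  then obtain D where "\<And>r. r \<in> I \<Longrightarrow> (\<forall>j. polyfn I (D r j)) \<and>
      (\<forall>x. F r x - F r x0 = (\<Sum>j\<in>I. (x j - x0 j) * D r j x))"
    by metis
  then have PFD: "polyfn I (D r j)" and D: "F r x - F r x0 = (\<Sum>j\<in>I. (x j - x0 j) * D r j x)"
    if "r \<in> I" for r j x using that by blast+
  have ddD: "dir_deriv (F r) x0 (\<lambda>l. if l = k then 1 else 0) = D r k x0" if "r \<in> I" "k \<in> I" for r k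
    using dir_deriv_hadamard[OF fin PFD[OF that(1)] D[OF that(1)]] fin that
    by (simp add: if_distrib[of "\<lambda>a. a * _"] cong: if_cong)
  obtain M where M: "\<And>i k. i \<in> I \<Longrightarrow> k \<in> I \<Longrightarrow> (\<Sum>r\<in>I. M i r * D r k x0) = of_bool (i = k)"
    using dir_deriv_inverse[of x0] by (auto simp: ddD cong: sum.cong)
  define \<xi> where "\<xi> s j = (G (l s) j - x0 j) / (s - s0)" for s j
  define E where "E s r j = D r j (G (l s)) - D r j x0" for s r j
  have l_lim: "((\<lambda>s. l s j) \<longlongrightarrow> l s0 j) (at s0)" for j
    unfolding l_def by (intro tendsto_intros)
  have q0: "q (l s0) \<noteq> 0" using s0 by (simp add: l_def)
  have G_lim: "((\<lambda>s. G (l s) j) \<longlongrightarrow> x0 j) (at s0)" if "j \<in> I" for j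
    unfolding x0_def using q0 that by (intro G_tendsto l_lim)
  have E_lim: "((\<lambda>s. E s r j) \<longlongrightarrow> 0) (at s0)" if "r \<in> I" for r j
  proof -
    have "((\<lambda>s. D r j (G (l s))) \<longlongrightarrow> D r j x0) (at s0)"
      by (rule polyfn_tendsto[OF PFD[OF that]]) (rule G_lim)
    then show ?thesis unfolding E_def by (rule LIM_zero)
  qed
  have "((\<lambda>s. q (l s)) \<longlongrightarrow> q (l s0)) (at s0)" by (intro polyfn_tendsto[OF PFq] l_lim)
  then have ev_q: "eventually (\<lambda>s. q (l s) \<noteq> 0) (at s0)"
    using q0 by (rule tendsto_imp_eventually_ne)
  have \<xi>: "\<xi> s k = (\<Sum>r\<in>I. M k r * v r) - (\<Sum>r\<in>I. \<Sum>j\<in>I. M k r * (\<xi> s j * E s r j))"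
    if "q (l s) \<noteq> 0" "s \<noteq> s0" "k \<in> I" for s k
  proof -
    have eq: "(\<Sum>j\<in>I. \<xi> s j * D r j (G (l s))) = v r" if "r \<in> I" for r
    proof -
      have "(s - s0) * v r = F r (G (l s)) - F r x0"
        unfolding x0_def using F_G[OF \<open>q (l s) \<noteq> 0\<close> that] F_G[OF q0 that]
        by (simp add: l_def algebra_simps)
      also have "\<dots> = (\<Sum>j\<in>I. (s - s0) * (\<xi> s j * D r j (G (l s))))"
        unfolding D[OF that] using \<open>s \<noteq> s0\<close> by (intro sum.cong refl) (simp add: \<xi>_def)
      finally show ?thesis using \<open>s \<noteq> s0\<close> by (simp add: sum_distrib_left[symmetric])
    qed
    have "\<xi> s k = (\<Sum>j\<in>I. (\<Sum>r\<in>I. M k r * D r j x0) * \<xi> s j)"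
      using M that(3) fin by simp
    also have "\<dots> = (\<Sum>r\<in>I. M k r * (\<Sum>j\<in>I. \<xi> s j * D r j x0))"
      unfolding sum_distrib_left sum_distrib_right by (subst sum.swap) (simp add: mult_ac)
    also have "\<dots> = (\<Sum>r\<in>I. M k r * (v r - (\<Sum>j\<in>I. \<xi> s j * E s r j)))"
    proof (intro sum.cong refl)
      fix r assume "r \<in> I"
      have "(\<Sum>j\<in>I. \<xi> s j * D r j x0) = (\<Sum>j\<in>I. \<xi> s j * D r j (G (l s))) - (\<Sum>j\<in>I. \<xi> s j * E s r j)"
        unfolding E_def by (simp add: right_diff_distrib sum_subtractf)
      then show "M k r * (\<Sum>j\<in>I. \<xi> s j * D r j x0) = M k r * (v r - (\<Sum>j\<in>I. \<xi> s j * E s r j))"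
        using eq[OF \<open>r \<in> I\<close>] by simp
    qed
    finally show ?thesis by (simp add: right_diff_distrib sum_subtractf sum_distrib_left)
  qed
  define N where "N s = (\<Sum>k\<in>I. cmod (\<xi> s k))" for s
  define \<eta> where "\<eta> s = (\<Sum>k\<in>I. \<Sum>r\<in>I. \<Sum>j\<in>I. cmod (M k r) * cmod (E s r j))" for s
  define w where "w k = (\<Sum>r\<in>I. M k r * v r)" for k
  define C where "C = (\<Sum>k\<in>I. cmod (w k))"
  have \<eta>_lim: "(\<eta> \<longlongrightarrow> 0) (at s0)"
  proof -
    have "(\<eta> \<longlongrightarrow> (\<Sum>k\<in>I. \<Sum>r\<in>I. \<Sum>j\<in>I. cmod (M k r) * cmod 0)) (at s0)"
      unfolding \<eta>_def by (intro tendsto_intros E_lim)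
    then show ?thesis by simp
  qed
  have \<xi>_w: "(\<Sum>k\<in>I. cmod (\<xi> s k - w k)) \<le> N s * \<eta> s" if "q (l s) \<noteq> 0" "s \<noteq> s0" for s
  proof -
    have "cmod (\<xi> s k - w k) \<le> (\<Sum>r\<in>I. \<Sum>j\<in>I. N s * (cmod (M k r) * cmod (E s r j)))"
      if "k \<in> I" for k
    proof -
      have "cmod (\<xi> s k - w k) = cmod (\<Sum>r\<in>I. \<Sum>j\<in>I. M k r * (\<xi> s j * E s r j))"
        using \<xi>[OF \<open>q (l s) \<noteq> 0\<close> \<open>s \<noteq> s0\<close> that] by (simp add: w_def norm_minus_commute)
      also have "\<dots> \<le> (\<Sum>r\<in>I. \<Sum>j\<in>I. cmod (M k r * (\<xi> s j * E s r j)))"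
        by (intro order_trans[OF norm_sum] sum_mono norm_sum)
      also have "\<dots> \<le> (\<Sum>r\<in>I. \<Sum>j\<in>I. N s * (cmod (M k r) * cmod (E s r j)))"
      proof (intro sum_mono)
        fix r j assume "j \<in> I"
        then have "cmod (\<xi> s j) \<le> N s" unfolding N_def using fin by (intro member_le_sum) auto
        then have "cmod (\<xi> s j) * (cmod (M k r) * cmod (E s r j)) \<le> N s * (cmod (M k r) * cmod (E s r j))"
          by (intro mult_right_mono) auto
        then show "cmod (M k r * (\<xi> s j * E s r j)) \<le> N s * (cmod (M k r) * cmod (E s r j))"
          by (simp add: norm_mult mult_ac)
      qed
      finally show ?thesis .
    qed
    then show ?thesis unfolding \<eta>_def sum_distrib_left by (intro sum_mono)
  qed
  \<comment> \<open>With \<open>\<eta> s < 1 / 2\<close>, the estimate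
    \<open>N \<le> N \<eta> + C\<close> bounds the quotients by \<open>2 * C\<close>; their distance
    to \<open>w\<close> is then at most \<open>2 * C * \<eta> s\<close>.\<close>
  have ev: "eventually (\<lambda>s. q (l s) \<noteq> 0 \<and> s \<noteq> s0 \<and> \<eta> s < 1 / 2) (at s0)"
    using ev_q order_tendstoD(2)[OF \<eta>_lim, of "1 / 2"] eventually_neq_at_within[of s0 s0 UNIV]
    by (intro eventually_conj) auto
  have "((\<lambda>s. \<xi> s i - w i) \<longlongrightarrow> 0) (at s0)"
  proof (rule Lim_null_comparison)
    show "((\<lambda>s. 2 * C * \<eta> s) \<longlongrightarrow> 0) (at s0)"
      using tendsto_mult_left[OF \<eta>_lim, of "2 * C"] by simp
    show "eventually (\<lambda>s. norm (\<xi> s i - w i) \<le> 2 * C * \<eta> s) (at s0)"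
      using ev
    proof eventually_elim
      case (elim s)
      have \<eta>0: "\<eta> s \<ge> 0" and N0: "N s \<ge> 0" unfolding \<eta>_def N_def by (intro sum_nonneg; simp)+
      have "N s \<le> (\<Sum>k\<in>I. cmod (\<xi> s k - w k) + cmod (w k))"
        unfolding N_def by (intro sum_mono) (metis diff_add_cancel norm_triangle_ineq)
      also have "\<dots> \<le> N s * \<eta> s + C" using \<xi>_w[of s] elim by (simp add: sum.distrib C_def)
      also have "N s * \<eta> s \<le> N s * (1 / 2)" using elim N0 by (intro mult_left_mono) auto
      finally have "N s \<le> 2 * C" by simp
      have "norm (\<xi> s i - w i) \<le> (\<Sum>k\<in>I. cmod (\<xi> s k - w k))"
        using i fin by (intro member_le_sum) auto
      also have "\<dots> \<le> N s * \<eta> s" using \<xi>_w[of s] elim by simp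
      also have "\<dots> \<le> 2 * C * \<eta> s" using \<open>N s \<le> 2 * C\<close> \<eta>0 by (intro mult_right_mono)
      finally show ?case .
    qed
  qed
  then have "((\<lambda>s. \<xi> s i) \<longlongrightarrow> w i) (at s0)" by (simp add: LIM_zero_iff)
  then have "((\<lambda>s. G (l s) i) has_field_derivative w i) (at s0)"
    unfolding has_field_derivative_iff \<xi>_def x0_def .
  then show ?thesis unfolding field_differentiable_def l_def by blast
qed

text \<open>\<open>q G_i\<close> is holomorphic along lines and of polynomial growth where
  \<open>q \<noteq> 0\<close>, so \<open>poly_extension\<close> makes it a polynomial
  \<open>h\<close>.\<close>

lemma rational_inverse:
  assumes i: "i \<in> I"
  shows "\<exists>h. polyfn I h \<and> (\<forall>x. q (Fv x) * x i = h (Fv x))"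
proof -
  obtain y0 where y0: "q y0 \<noteq> 0" using q_nonzero by blast
  obtain B where B: "poly_bdd I (\<lambda>_. True) B" "\<And>x. cmod (q (Fv x) * x i) \<le> B (Fv x)"
    using q_growth[OF i] unfolding growth_def by blast
  obtain m :: nat where m: "\<And>y. B y \<le> m * (1 + pnorm I y) ^ m"
    using B(1) unfolding poly_bdd_def by blast
  define f where "f y = q y * G y i" for y
  have "\<exists>h. polyfn I h \<and> (\<forall>y. q y \<noteq> 0 \<longrightarrow> f y = h y)"
  proof (rule poly_extension[where I = I and q = q and ?y0.0 = y0 and f = f, OF fin PFq y0])
    fix x y :: "nat \<Rightarrow> complex" assume xy: "\<And>i. i \<in> I \<Longrightarrow> x i = y i"
    have "G x = G y" unfolding G_def using xy by simp
    moreover have "q x = q y" by (rule polyfn_cong[OF PFq]) (rule xy)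
    ultimately show "f x = f y" by (simp add: f_def)
  next
    fix y v
    have qd: "(\<lambda>s. q (\<lambda>i. y i + s * v i)) field_differentiable (at s)" for s
    proof -
      obtain p where p: "\<And>s. q (\<lambda>i. y i + s * v i) = poly p s"
        using polyfn_line[OF PFq, of y v] by blast
      show ?thesis unfolding p field_differentiable_def by (rule exI) (rule poly_DERIV)
    qed
    show "(\<lambda>s. f (\<lambda>i. y i + s * v i)) holomorphic_on {s. q (\<lambda>i. y i + s * v i) \<noteq> 0}"
      unfolding holomorphic_on_def
    proof
      fix s assume "s \<in> {s. q (\<lambda>i. y i + s * v i) \<noteq> 0}"
      then have "q (\<lambda>i. y i + s * v i) \<noteq> 0" by simp
      from field_differentiable_mult[OF qd G_deriv[OF this i]]
      show "(\<lambda>s. f (\<lambda>i. y i + s * v i)) field_differentiable (at s within {s. q (\<lambda>i. y i + s * v i) \<noteq> 0})"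
        unfolding f_def by (rule field_differentiable_at_within)
    qed
  next
    show "poly_bdd I (\<lambda>y. q y \<noteq> 0) (\<lambda>y. cmod (f y))"
    proof (rule poly_bddI)
      fix y assume y: "q y \<noteq> 0"
      have "cmod (q (Fv (G y)) * G y i) \<le> m * (1 + pnorm I (Fv (G y))) ^ m"
        using B(2)[of "G y"] m[of "Fv (G y)"] by simp
      moreover have "q (Fv (G y)) = q y"
        by (rule polyfn_cong[OF PFq]) (simp add: Fv_def F_G[OF y])
      moreover have "pnorm I (Fv (G y)) = pnorm I y"
        unfolding pnorm_def Fv_def by (simp add: F_G[OF y])
      ultimately show "cmod (f y) \<le> m * (1 + pnorm I y) ^ m" by (simp add: f_def)
    qed
  qed
  then obtain h where h: "polyfn I h" "\<And>y. q y \<noteq> 0 \<Longrightarrow> f y = h y" by blast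
  have PFx: "polyfn I (\<lambda>x. q (Fv x) * x i - h (Fv x))"
    by (intro polyfn_diff polyfn_mult polyfn_comp_Fv PFq h(1) polyfn_var i)
  \<comment> \<open>The extra factor \<open>q (Fv x)\<close> makes the identity valid at its zeros
    too; as a polynomial in \<open>x\<close> that is not identically zero, it can be
    cancelled.\<close>
  have "q (Fv x) * (q (Fv x) * x i - h (Fv x)) = 0" for x
  proof (cases "q (Fv x) = 0")
    case False
    have "G (Fv x) i = x i" by (rule G_eq[OF False _ i]) (simp add: Fv_def)
    then show ?thesis using h(2)[OF False] by (simp add: f_def)
  qed simp
  moreover obtain x1 where "q (Fv x1) \<noteq> 0" using zero_if_zero_on_img[OF PFq] q_nonzero by blast
  ultimately have "q (Fv x) * x i - h (Fv x) = 0" for x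
    using polyfn_zero_prod[where I = I and f = "\<lambda>x. q (Fv x)" and
        g = "\<lambda>x. q (Fv x) * x i - h (Fv x)" and y = x1, OF polyfn_comp_Fv[OF PFq] PFx] by blast
  then show ?thesis using h(1) by auto
qed

end

section \<open>Polynomiality of the inverse\<close>

context injective_Keller
begin

text \<open>Think of \<open>\<Phi>\<close> as a denominator of the rational function \<open>x\<^sub>i(y + t v) = H y / Q y\<close> of minimal
  degree in \<open>t\<close>. Its roots are among those of the monic polynomial \<open>Q y\<close>, so its normalised
  coefficients are polynomially bounded rational functions, hence polynomials.\<close>
lemma minimal_denominator_monic:
  assumes Q: "polyfam I (Suc d) Q" "\<And>y. coeff (Q y) d = 1"
    and \<Phi>: "polyfam I (Suc e) \<Phi>" "\<exists>y. coeff (\<Phi> y) e \<noteq> 0"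
    and dvd: "\<And>y. Polynomial.smult (coeff (\<Phi> y) e ^ k) (Q y) = \<Phi> y * S y"
  shows "\<exists>\<Phi>'. polyfam I (Suc e) \<Phi>' \<and> (\<forall>y. coeff (\<Phi>' y) e = 1) \<and>
    (\<forall>y. \<Phi> y = Polynomial.smult (coeff (\<Phi> y) e) (\<Phi>' y))"
proof -
  define \<alpha> where "\<alpha> y = coeff (\<Phi> y) e" for y
  have polyfn\<alpha>: "polyfn I \<alpha>" unfolding \<alpha>_def[abs_def] by (rule polyfam_coeff[OF \<Phi>(1)])
  obtain y0 where y0: "\<alpha> y0 \<noteq> 0" using \<Phi>(2) by (auto simp: \<alpha>_def)
  \<comment> \<open>The roots of the monic \<open>Q y\<close> lie in the disc of radius
    \<open>R y\<close>; by \<open>dvd\<close> so do those of \<open>\<Phi> y\<close> wherever its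
    top coefficient \<open>\<alpha> y\<close> is nonzero.\<close>
  define R where "R y = 1 + (\<Sum>l<d. cmod (coeff (Q y) l))" for y
  have R1: "R y \<ge> 1" for y by (simp add: R_def sum_nonneg)
  have root_R: "cmod t \<le> R y" if "\<alpha> y \<noteq> 0" "poly (\<Phi> y) t = 0" for y t
  proof -
    have "\<alpha> y ^ k * poly (Q y) t = 0"
      using arg_cong[OF dvd[of y], of "\<lambda>p. poly p t"] that(2) by (simp add: \<alpha>_def)
    then have Q0: "poly (Q y) t = 0" using that(1) by simp
    have eq: "poly (Q y) t = (\<Sum>l<d. coeff (Q y) l * t ^ l) + t ^ d"
      using polyfam_poly[OF Q(1), of y t] by (simp add: Q(2))
    have "d \<ge> 1"
    proof (rule ccontr)
      assume "\<not> d \<ge> 1"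
      then have "d = 0" by simp
      then show False using Q0 eq by simp
    qed
    moreover have "t ^ d = (\<Sum>l<d. - coeff (Q y) l * t ^ l)"
      using Q0 eq by (simp add: sum_negf eq_neg_iff_add_eq_0 add.commute)
    ultimately have "cmod t \<le> 1 + (\<Sum>l<d. cmod (- coeff (Q y) l))" by (rule root_bound)
    then show ?thesis by (simp add: R_def)
  qed
  have bound: "cmod (coeff (\<Phi> y) j / \<alpha> y) \<le> (1 + R y) ^ e" if "\<alpha> y \<noteq> 0" for y j
  proof -
    define p where "p = Polynomial.smult (1 / \<alpha> y) (\<Phi> y)"
    have "degree p \<le> e"
      unfolding p_def using polyfam_coeff_0[OF \<Phi>(1)] by (intro degree_le) auto
    moreover have ce: "coeff p e = 1" using that by (simp add: p_def \<alpha>_def)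
    ultimately have deg: "degree p = e" by (metis le_antisym le_degree zero_neq_one)
    have "cmod (coeff p j) \<le> (1 + R y) ^ degree p"
    proof (rule monic_coeff_bound)
      show "lead_coeff p = 1" using ce deg by simp
      show "\<forall>t. poly p t = 0 \<longrightarrow> cmod t \<le> R y"
        using root_R[OF that] that by (simp add: p_def)
      show "R y \<ge> 0" using R1[of y] by simp
    qed
    then show ?thesis unfolding deg by (simp add: p_def)
  qed
  have "poly_bdd I (\<lambda>y. \<alpha> y \<noteq> 0) (\<lambda>y. (1 + R y) ^ e)"
  proof (rule poly_bdd_power)
    show "poly_bdd I (\<lambda>y. \<alpha> y \<noteq> 0) (\<lambda>y. 1 + R y)"
      unfolding R_def
      by (intro poly_bdd_add poly_bdd_const poly_bdd_sum polyfn_poly_bdd fin polyfam_coeff[OF Q(1)])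
    show "0 \<le> 1 + R y" for y using R1[of y] by simp
  qed
  then have bdd: "poly_bdd I (\<lambda>y. \<alpha> y \<noteq> 0) (\<lambda>y. cmod (coeff (\<Phi> y) j / \<alpha> y))" for j
    by (rule poly_bdd_mono) (rule bound)
  have "\<exists>p. polyfn I p \<and> (\<forall>y. \<alpha> y \<noteq> 0 \<longrightarrow> coeff (\<Phi> y) j / \<alpha> y = p y)" for j
  proof (rule poly_extension[where I = I and q = \<alpha> and ?y0.0 = y0 and
        f = "\<lambda>y. coeff (\<Phi> y) j / \<alpha> y", OF fin polyfn\<alpha> y0])
    fix x y :: "nat \<Rightarrow> complex" assume xy: "\<And>i. i \<in> I \<Longrightarrow> x i = y i"
    show "coeff (\<Phi> x) j / \<alpha> x = coeff (\<Phi> y) j / \<alpha> y"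
      using polyfam_cong[OF \<Phi>(1) xy] by (simp add: \<alpha>_def)
  next
    fix y v
    obtain p r where p: "\<And>s. coeff (\<Phi> (\<lambda>i. y i + s * v i)) j = poly p s"
      and r: "\<And>s. \<alpha> (\<lambda>i. y i + s * v i) = poly r s"
      using polyfn_line[OF polyfam_coeff[OF \<Phi>(1), of j], of y v] polyfn_line[OF polyfn\<alpha>, of y v] by blast
    show "(\<lambda>s. coeff (\<Phi> (\<lambda>i. y i + s * v i)) j / \<alpha> (\<lambda>i. y i + s * v i)) holomorphic_on
        {s. \<alpha> (\<lambda>i. y i + s * v i) \<noteq> 0}"
      unfolding p r by (intro holomorphic_intros) auto
  qed (rule bdd)
  then obtain c where c: "\<And>j. polyfn I (c j)" "\<And>j y. \<alpha> y \<noteq> 0 \<Longrightarrow> coeff (\<Phi> y) j / \<alpha> y = c j y" by metis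
  have coeff_\<Phi>: "coeff (\<Phi> y) j = \<alpha> y * c j y" for y j
  proof -
    have "\<alpha> y * (coeff (\<Phi> y) j - \<alpha> y * c j y) = 0" for y
      using c(2)[of y j] by (cases "\<alpha> y = 0") (auto simp: field_simps)
    moreover have "polyfn I (\<lambda>y. coeff (\<Phi> y) j - \<alpha> y * c j y)"
      by (intro polyfn_diff polyfn_mult polyfn\<alpha> c(1) polyfam_coeff[OF \<Phi>(1)])
    ultimately have "coeff (\<Phi> y) j - \<alpha> y * c j y = 0"
      using polyfn_zero_prod[where I = I and f = \<alpha> and y = y0 and
          g = "\<lambda>y. coeff (\<Phi> y) j - \<alpha> y * c j y"] polyfn\<alpha> y0 by blast
    then show ?thesis by simp
  qed
  define \<Phi>' where "\<Phi>' y = (\<Sum>j\<le>e. Polynomial.monom (if j = e then 1 else c j y) j)" for y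
  have coeff_\<Phi>': "coeff (\<Phi>' y) j = (if j = e then 1 else if j < e then c j y else 0)" for y j
    by (simp add: \<Phi>'_def coeff_sum coeff_monom)
  have "polyfn I (\<lambda>y. coeff (\<Phi>' y) k)" for k
  proof -
    consider "k = e" | "k < e" | "k > e" by linarith
    then show ?thesis by cases (simp_all add: coeff_\<Phi>' c(1))
  qed
  then have "polyfam I (Suc e) \<Phi>'" by (simp add: polyfam_def coeff_\<Phi>')
  moreover have "\<Phi> y = Polynomial.smult (coeff (\<Phi> y) e) (\<Phi>' y)" for y
  proof (rule poly_eqI)
    fix j
    show "coeff (\<Phi> y) j = coeff (Polynomial.smult (coeff (\<Phi> y) e) (\<Phi>' y)) j"
      using polyfam_coeff_0[OF \<Phi>(1), of j y] coeff_\<Phi>[of y j] by (auto simp: coeff_\<Phi>' \<alpha>_def)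
  qed
  moreover have "coeff (\<Phi>' y) e = 1" for y by (simp add: coeff_\<Phi>')
  ultimately show ?thesis by blast
qed

lemma polyfam_eq_0:
  assumes "polyfam I a \<Phi>" "polyfn I f" "f y0 \<noteq> 0" "\<And>y. f y \<noteq> 0 \<Longrightarrow> \<Phi> y = 0"
  shows "\<Phi> y = 0"
proof (rule poly_eqI)
  fix j
  have "f y * coeff (\<Phi> y) j = 0" for y using assms(4)[of y] by (cases "f y = 0") auto
  then have "coeff (\<Phi> y) j = 0"
    using polyfn_zero_prod[where I = I and f = f and g = "\<lambda>y. coeff (\<Phi> y) j" and y = y0]
      assms(2,3) polyfam_coeff[OF assms(1)] by blast
  then show "coeff (\<Phi> y) j = coeff 0 j" by simp
qed

text \<open>\<open>C[y][t]\<close> has no zero divisors: where the chosen coefficient of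
  \<open>\<Gamma>\<close> is nonzero one cancels in \<open>C[t]\<close>, and vanishing extends to
  the other \<open>y\<close>.\<close>

lemma polyfam_cancel:
  assumes \<Gamma>: "polyfam I a \<Gamma>" "coeff (\<Gamma> y0) k \<noteq> 0" and \<Phi>: "polyfam I b \<Phi>" "\<And>y. \<Gamma> y * \<Phi> y = 0"
  shows "\<Phi> y = 0"
proof (rule polyfam_eq_0[where f = "\<lambda>y. coeff (\<Gamma> y) k" and ?y0.0 = y0, OF \<Phi>(1) polyfam_coeff[OF \<Gamma>(1)] \<Gamma>(2)])
  fix y assume "coeff (\<Gamma> y) k \<noteq> 0"
  then have "\<Gamma> y \<noteq> 0" by auto
  then show "\<Phi> y = 0" using \<Phi>(2)[of y] by simp
qed

text \<open>The monic denominator has no zero \<open>(y, t)\<close> with \<open>y + t v\<close> in the image of \<open>F\<close>: the numerator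
  would vanish there too, for all neighbouring \<open>y\<close>, contradicting the Bezout identity. But then
  it does not depend on \<open>y\<close>, so it has degree \<open>0\<close>.\<close>
lemma denominator_degree_0:
  assumes \<Phi>: "polyfam I (Suc e) \<Phi>'" "\<And>y. coeff (\<Phi>' y) e = 1"
    and \<Psi>: "\<And>x t. poly (\<Phi>' (\<lambda>i. Fv x i - t * v i)) t = 0 \<Longrightarrow> poly (\<Psi> (\<lambda>i. Fv x i - t * v i)) t = 0"
      "polyfam I a \<Psi>"
    and bezout: "\<And>y t. poly (A y) t * poly (\<Phi>' y) t + poly (B y) t * poly (\<Psi> y) t = \<gamma> y"
    and \<gamma>: "polyfn I \<gamma>" "\<gamma> y1 \<noteq> 0"
  shows "e = 0"
proof (rule ccontr)
  assume "e \<noteq> 0"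
  have deg: "degree (\<Phi>' y) = e" "lead_coeff (\<Phi>' y) = 1" for y
  proof -
    have "degree (\<Phi>' y) \<le> e" using polyfam_coeff_0[OF \<Phi>(1)] by (intro degree_le) auto
    then show "degree (\<Phi>' y) = e" by (metis \<Phi>(2) le_antisym le_degree zero_neq_one)
    then show "lead_coeff (\<Phi>' y) = 1" using \<Phi>(2) by simp
  qed
  have PFp: "polyfn I (\<lambda>y. poly (\<Phi>' y) t)" for t
    unfolding polyfam_poly[OF \<Phi>(1)] by (intro polyfn_sum polyfn_mult polyfn_const polyfam_coeff[OF \<Phi>(1)])
  \<comment> \<open>Otherwise, for fixed \<open>t\<close>, the value at \<open>F x - t v\<close> is
    a nonvanishing polynomial in \<open>x\<close>, hence constant, so
    \<open>poly (\<Phi>' y) t\<close> is the same nonzero number for all \<open>y\<close>. But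
    \<open>\<Phi>' y1\<close> has positive degree and thus a root.\<close>
  have "\<exists>x t. poly (\<Phi>' (\<lambda>i. Fv x i - t * v i)) t = 0"
  proof (rule ccontr)
    assume nz: "\<not> ?thesis"
    define \<kappa> where "\<kappa> t = poly (\<Phi>' (\<lambda>i. Fv (\<lambda>_. 0) i - t * v i)) t" for t
    have const: "poly (\<Phi>' (\<lambda>i. Fv x i - t * v i)) t = \<kappa> t" for x t
      unfolding \<kappa>_def
      by (rule polyfn_nonvanishing_const[where I = I and f = "\<lambda>x. poly (\<Phi>' (\<lambda>i. Fv x i - t * v i)) t"],
          rule polyfn_comp_Fv_shift[where f = "\<lambda>y. poly (\<Phi>' y) t"], rule PFp) (use nz in blast)
    have "poly (\<Phi>' y) t = \<kappa> t" for y t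
    proof -
      have "polyfn I (\<lambda>y. poly (\<Phi>' (\<lambda>i. y i - t * v i)) t - \<kappa> t)"
        using polyfn_subst[OF PFp[of t], of I "\<lambda>i y. y i - t * v i"]
        by (simp add: polyfn_diff)
      then have "poly (\<Phi>' (\<lambda>i. (y i + t * v i) - t * v i)) t - \<kappa> t = 0"
        by (rule zero_if_zero_on_img[where f = "\<lambda>y. poly (\<Phi>' (\<lambda>i. y i - t * v i)) t - \<kappa> t"
              and y = "\<lambda>i. y i + t * v i"]) (simp add: const)
      then show ?thesis by simp
    qed
    moreover have "\<kappa> t \<noteq> 0" for t using nz by (auto simp: \<kappa>_def)
    moreover obtain t where "poly (\<Phi>' y1) t = 0"
      using alg_closed_imp_poly_has_root[of "\<Phi>' y1"] deg(1) \<open>e \<noteq> 0\<close> by auto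
    ultimately show False by metis
  qed
  then obtain x0 t0 where root: "poly (\<Phi>' (\<lambda>i. Fv x0 i - t0 * v i)) t0 = 0" by blast
  define y0 where "y0 = (\<lambda>i. Fv x0 i - t0 * v i)"
  obtain \<epsilon> where \<epsilon>: "\<epsilon> > 0" "\<And>y. (\<forall>i\<in>I. cmod (y i - F i x0) < \<epsilon>) \<Longrightarrow> img y"
    using img_open[of x0] by blast
  \<comment> \<open>The distance \<open>\<epsilon>\<close> is split: one half for
    \<open>y - y0\<close>, the other for the displacement \<open>(t - t0) v\<close> caused by the
    moving root.\<close>
  define \<delta> where "\<delta> = \<epsilon> / 2 / (1 + pnorm I v)"
  have pos: "1 + pnorm I v > 0" by (simp add: add_pos_nonneg)
  have \<delta>: "\<delta> > 0" using \<epsilon>(1) pos by (simp add: \<delta>_def)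
  obtain \<epsilon>' where \<epsilon>': "\<epsilon>' > 0"
    "\<And>y. (\<forall>i\<in>I. cmod (y i - y0 i) < \<epsilon>') \<Longrightarrow> poly (\<Phi>' y) t0 \<in> ball 0 (\<delta> ^ e)"
    using polyfn_box[where I = I and f = "\<lambda>y. poly (\<Phi>' y) t0" and ?y0.0 = y0 and V = "ball 0 (\<delta> ^ e)",
        OF fin PFp open_ball] root \<delta> by (auto simp: y0_def)
  have "\<gamma> y1 = 0"
  proof (rule polyfn_zero_on_box[where I = I and f = \<gamma> and ?y0.0 = y0, OF fin \<gamma>(1)])
    show "min \<epsilon>' (\<epsilon> / 2) > 0" using \<epsilon> \<epsilon>' by simp
    fix y assume y: "\<And>i. i \<in> I \<Longrightarrow> cmod (y i - y0 i) < min \<epsilon>' (\<epsilon> / 2)"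
    have "cmod (poly (\<Phi>' y) t0) < \<delta> ^ degree (\<Phi>' y)"
      using \<epsilon>'(2)[of y] y by (simp add: deg(1))
    then obtain t where t: "cmod (t - t0) < \<delta>" "poly (\<Phi>' y) t = 0"
      using monic_root_near[OF deg(2) \<delta>] by blast
    have "cmod (y i + t * v i - F i x0) < \<epsilon>" if "i \<in> I" for i
    proof -
      have le: "cmod (t - t0) * cmod (v i) \<le> \<delta> * (1 + pnorm I v)"
        using t(1) pnorm_ge[OF fin that, of v] \<delta> by (intro mult_mono) auto
      have "\<epsilon> / 2 / r * r = \<epsilon> / 2" if "r > 0" for r :: real using that by simp
      from this[OF pos] have \<delta>_eq: "\<delta> * (1 + pnorm I v) = \<epsilon> / 2" by (simp only: \<delta>_def)
      with le have "cmod ((t - t0) * v i) \<le> \<epsilon> / 2" by (simp add: norm_mult \<delta>_eq)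
      have eq: "y i + t * v i - F i x0 = (y i - y0 i) + (t - t0) * v i"
        by (simp add: y0_def Fv_def algebra_simps)
      have "cmod (y i - y0 i) < \<epsilon> / 2" using y[OF that] by simp
      then show ?thesis
        unfolding eq using norm_triangle_ineq[of "y i - y0 i" "(t - t0) * v i"] \<open>_ \<le> \<epsilon> / 2\<close>
        by linarith
    qed
    then obtain x where x: "\<And>i. i \<in> I \<Longrightarrow> F i x = y i + t * v i"
      using \<epsilon>(2)[of "\<lambda>i. y i + t * v i"] unfolding img_def by blast
    have agree: "(\<lambda>i. Fv x i - t * v i) i = y i" if "i \<in> I" for i
      using x[OF that] by (simp add: Fv_def)
    have "\<Phi>' (\<lambda>i. Fv x i - t * v i) = \<Phi>' y" "\<Psi> (\<lambda>i. Fv x i - t * v i) = \<Psi> y"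
      by (rule polyfam_cong[OF \<Phi>(1) agree] polyfam_cong[OF \<Psi>(2) agree], assumption)+
    then have "poly (\<Psi> y) t = 0" using \<Psi>(1)[of x t] t(2) by simp
    then show "\<gamma> y = 0" using bezout[of y t] t(2) by simp
  qed
  then show False using \<gamma>(2) by simp
qed

text \<open>Along the lines \<open>y + t v\<close> the functions \<open>q\<close> and
  \<open>h\<close> become \<open>Q\<close> and \<open>H\<close> in \<open>C[y][t]\<close>, with
  \<open>Q\<close> monic. A denominator of \<open>H / Q\<close> of least degree in \<open>t\<close>
  replaces the reduced one; once that degree is 0, \<open>Q\<close> divides \<open>H\<close>, and
  the quotient yields the polynomial.\<close>

lemma polynomial_inverse_coordinate:
  assumes q: "polyfn I q" "q y0 \<noteq> 0" and h: "polyfn I h" and i: "i \<in> I"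
    and rel: "\<And>x. q (Fv x) * x i = h (Fv x)"
  shows "\<exists>p. polyfn I p \<and> (\<forall>x. p (Fv x) = x i)"
proof -
  obtain v d \<tau> Q0 where Q0: "\<tau> \<noteq> 0" "polyfam I (Suc d) Q0"
    "\<And>y t. poly (Q0 y) t = q (\<lambda>i. y i + t * v i)" "\<And>y. coeff (Q0 y) d = \<tau>"
    using monic_direction[where I = I and f = q and ?y0.0 = y0, OF fin q] by blast
  obtain a H0 where H0: "polyfam I a H0" "\<And>y t. poly (H0 y) t = h (\<lambda>i. y i + t * v i)"
    using polyfn_direction[OF h, of v] by blast
  define Q where "Q y = Polynomial.smult (1 / \<tau>) (Q0 y)" for y
  define H where "H y = Polynomial.smult (1 / \<tau>) (H0 y)" for y
  have Q: "polyfam I (Suc d) Q" "\<And>y. coeff (Q y) d = 1"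
    unfolding Q_def[abs_def] using Q0 by (auto intro: polyfam_smult)
  have H: "polyfam I a H" unfolding H_def[abs_def] using H0 by (auto intro: polyfam_smult)
  have QF: "poly (Q (\<lambda>i. Fv x i - t * v i)) t = q (Fv x) / \<tau>" for x t
    by (simp add: Q_def Q0(3))
  have HF: "poly (H (\<lambda>i. Fv x i - t * v i)) t = q (Fv x) / \<tau> * x i" for x t
    by (simp add: H_def H0(2) rel[symmetric])
  obtain x1 where x1: "q (Fv x1) \<noteq> 0" using zero_if_zero_on_img[where f = q and y = y0, OF q(1)] q(2) by blast
  define P where "P e \<longleftrightarrow> (\<exists>\<Phi> \<Psi> b. polyfam I (Suc e) \<Phi> \<and> polyfam I b \<Psi> \<and> (\<forall>y. \<Phi> y * H y = \<Psi> y * Q y) \<and>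
    (\<exists>y. coeff (\<Phi> y) e \<noteq> 0))" for e
  have "P d"
    unfolding P_def using Q H by (intro exI[of _ Q] exI[of _ H] exI[of _ a]) (auto simp: mult.commute)
  define e where "e = (LEAST e. P e)"
  have "P e" unfolding e_def using \<open>P d\<close> by (rule LeastI)
  then obtain \<Phi> \<Psi> b where \<Phi>: "polyfam I (Suc e) \<Phi>" and \<Psi>: "polyfam I b \<Psi>"
    and HQ: "\<And>y. \<Phi> y * H y = \<Psi> y * Q y" and \<Phi>_top: "\<exists>y. coeff (\<Phi> y) e \<noteq> 0"
    unfolding P_def by blast
  obtain z0 where z0: "coeff (\<Phi> z0) e \<noteq> 0" using \<Phi>_top by blast
  have minimal: "\<Phi>1 y = 0"
    if CL1: "polyfam I e \<Phi>1" and CL2: "polyfam I c \<Psi>1" and HQ1: "\<And>y. \<Phi>1 y * H y = \<Psi>1 y * Q y"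
    for \<Phi>1 \<Psi>1 c y
  proof (rule ccontr)
    assume "\<Phi>1 y \<noteq> 0"
    then obtain e' where "e' < e" "polyfam I (Suc e') \<Phi>1" "\<exists>y. coeff (\<Phi>1 y) e' \<noteq> 0"
      using polyfam_top[OF CL1] by blast
    then have "P e'" unfolding P_def using CL2 HQ1 by blast
    then have "e \<le> e'" unfolding e_def by (rule Least_le)
    then show False using \<open>e' < e\<close> by simp
  qed

  obtain k c S T where S: "polyfam I c S" and T: "polyfam I e T"
    and ST: "\<And>y. Polynomial.smult (coeff (\<Phi> y) e ^ k) (Q y) = \<Phi> y * S y + T y"
    using pseudo_division[OF Q(1) \<Phi>] by blast
  \<comment> \<open>The remainder is again a denominator, with numerator \<open>\<Psi>1\<close>, but
    of smaller degree, so minimality makes it zero: \<open>\<Phi>\<close> divides \<open>Q\<close>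
    up to a power of its top coefficient.\<close>
  have "T y = 0" for y
  proof (rule minimal[OF T])
    define \<Psi>1 where "\<Psi>1 y = Polynomial.smult (coeff (\<Phi> y) e ^ k) (H y) - S y * \<Psi> y" for y
    show "polyfam I (max a (c + b)) \<Psi>1"
      unfolding \<Psi>1_def[abs_def] by (intro polyfam_diff polyfam_smult polyfam_mult H S \<Psi> polyfn_power polyfam_coeff[OF \<Phi>])
    fix y
    have "T y * H y = Polynomial.smult (coeff (\<Phi> y) e ^ k) (Q y) * H y - S y * (\<Phi> y * H y)"
      unfolding ST by (simp add: algebra_simps)
    also have "\<dots> = \<Psi>1 y * Q y"
      unfolding HQ \<Psi>1_def by (simp add: algebra_simps)
    finally show "T y * H y = \<Psi>1 y * Q y" .
  qed
  then have dvd: "Polynomial.smult (coeff (\<Phi> y) e ^ k) (Q y) = \<Phi> y * S y" for y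
    using ST by simp
  obtain \<Phi>' where \<Phi>': "polyfam I (Suc e) \<Phi>'" "\<And>y. coeff (\<Phi>' y) e = 1"
    "\<And>y. \<Phi> y = Polynomial.smult (coeff (\<Phi> y) e) (\<Phi>' y)"
    using minimal_denominator_monic[OF Q \<Phi> \<Phi>_top dvd] by metis

  \<comment> \<open>A combination of \<open>\<Phi>\<close> and \<open>\<Psi>\<close> of least degree
    \<open>g\<close> acts as their greatest common divisor: their remainders modulo it are
    combinations of smaller degree, hence zero.\<close>
  define P2 where "P2 g \<longleftrightarrow> (\<exists>A B c1 c2. polyfam I c1 A \<and> polyfam I c2 B \<and>
    polyfam I (Suc g) (\<lambda>y. A y * \<Phi> y + B y * \<Psi> y) \<and> (\<exists>y. coeff (A y * \<Phi> y + B y * \<Psi> y) g \<noteq> 0))" for g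
  have "P2 e"
    unfolding P2_def using \<Phi> \<Phi>_top polyfam_const[of I 1] polyfam_const[of I 0]
    by (intro exI[of _ "\<lambda>_. [:1:]"] exI[of _ "\<lambda>_. [:0:]"] exI[of _ 1]) simp
  define g where "g = (LEAST g. P2 g)"
  have "P2 g" unfolding g_def using \<open>P2 e\<close> by (rule LeastI)
  then obtain A B c1 c2 where A: "polyfam I c1 A" and B: "polyfam I c2 B"
    and \<Gamma>': "polyfam I (Suc g) (\<lambda>y. A y * \<Phi> y + B y * \<Psi> y)"
      "\<exists>y. coeff (A y * \<Phi> y + B y * \<Psi> y) g \<noteq> 0"
    unfolding P2_def by blast
  define \<Gamma> where "\<Gamma> y = A y * \<Phi> y + B y * \<Psi> y" for y
  define \<gamma> where "\<gamma> y = coeff (\<Gamma> y) g" for y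
  have \<Gamma>: "polyfam I (Suc g) \<Gamma>" unfolding \<Gamma>_def[abs_def] by (rule \<Gamma>'(1))
  obtain z1 where z1: "\<gamma> z1 \<noteq> 0" using \<Gamma>'(2) unfolding \<gamma>_def \<Gamma>_def by blast
  have polyfn\<gamma>: "polyfn I \<gamma>" unfolding \<gamma>_def[abs_def] by (rule polyfam_coeff[OF \<Gamma>])
  have minimal2: "T1 y = 0"
    if CL1: "polyfam I g T1" and CL2: "polyfam I n1 A1" "polyfam I n2 B1" and T1: "\<And>y. T1 y = A1 y * \<Phi> y + B1 y * \<Psi> y"
    for T1 A1 B1 n1 n2 y
  proof (rule ccontr)
    assume "T1 y \<noteq> 0"
    then obtain g' where g': "g' < g" "polyfam I (Suc g') T1" "\<exists>y. coeff (T1 y) g' \<noteq> 0"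
      using polyfam_top[OF CL1] by blast
    have "T1 = (\<lambda>y. A1 y * \<Phi> y + B1 y * \<Psi> y)" by (rule ext) (rule T1)
    then have "polyfam I (Suc g') (\<lambda>y. A1 y * \<Phi> y + B1 y * \<Psi> y)"
      "\<exists>y. coeff (A1 y * \<Phi> y + B1 y * \<Psi> y) g' \<noteq> 0" using g'(2,3) by simp_all
    then have "P2 g'" unfolding P2_def using CL2 by blast
    then have "g \<le> g'" unfolding g_def by (rule Least_le)
    then show False using \<open>g' < g\<close> by simp
  qed
  obtain k1 n1 S1 T1 where S1: "polyfam I n1 S1" and T1: "polyfam I g T1"
    and ST1: "\<And>y. Polynomial.smult (\<gamma> y ^ k1) (\<Phi> y) = \<Gamma> y * S1 y + T1 y"
    using pseudo_division[OF \<Phi> \<Gamma>] unfolding \<gamma>_def by blast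
  have "T1 y = 0" for y
  proof (rule minimal2[OF T1])
    show "polyfam I (max 1 (c1 + n1)) (\<lambda>y. Polynomial.smult (\<gamma> y ^ k1) [:1:] - A y * S1 y)"
      by (intro polyfam_diff polyfam_smult polyfam_mult polyfam_const A S1 polyfn_power polyfn\<gamma>)
    show "polyfam I (max 1 (c2 + n1)) (\<lambda>y. [:0:] - B y * S1 y)"
      by (intro polyfam_diff polyfam_mult polyfam_const B S1)
    fix y
    have "T1 y = Polynomial.smult (\<gamma> y ^ k1) (\<Phi> y) - \<Gamma> y * S1 y" by (simp add: ST1)
    then show "T1 y = (Polynomial.smult (\<gamma> y ^ k1) [:1:] - A y * S1 y) * \<Phi> y + ([:0:] - B y * S1 y) * \<Psi> y"
      by (simp add: \<Gamma>_def algebra_simps)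
  qed
  then have ST1: "Polynomial.smult (\<gamma> y ^ k1) (\<Phi> y) = \<Gamma> y * S1 y" for y using ST1 by simp
  obtain k2 n2 S2 T2 where S2: "polyfam I n2 S2" and T2: "polyfam I g T2"
    and ST2: "\<And>y. Polynomial.smult (\<gamma> y ^ k2) (\<Psi> y) = \<Gamma> y * S2 y + T2 y"
    using pseudo_division[OF \<Psi> \<Gamma>] unfolding \<gamma>_def by blast
  have "T2 y = 0" for y
  proof (rule minimal2[OF T2])
    show "polyfam I (max 1 (c1 + n2)) (\<lambda>y. [:0:] - A y * S2 y)"
      by (intro polyfam_diff polyfam_mult polyfam_const A S2)
    show "polyfam I (max 1 (c2 + n2)) (\<lambda>y. Polynomial.smult (\<gamma> y ^ k2) [:1:] - B y * S2 y)"
      by (intro polyfam_diff polyfam_smult polyfam_mult polyfam_const B S2 polyfn_power polyfn\<gamma>)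
    fix y
    have "T2 y = Polynomial.smult (\<gamma> y ^ k2) (\<Psi> y) - \<Gamma> y * S2 y" by (simp add: ST2)
    then show "T2 y = ([:0:] - A y * S2 y) * \<Phi> y + (Polynomial.smult (\<gamma> y ^ k2) [:1:] - B y * S2 y) * \<Psi> y"
      by (simp add: \<Gamma>_def algebra_simps)
  qed
  then have ST2: "Polynomial.smult (\<gamma> y ^ k2) (\<Psi> y) = \<Gamma> y * S2 y" for y using ST2 by simp
  define \<Phi>1 where "\<Phi>1 y = Polynomial.smult (\<gamma> y ^ k2) (S1 y)" for y
  define \<Psi>1 where "\<Psi>1 y = Polynomial.smult (\<gamma> y ^ k1) (S2 y)" for y
  have \<Phi>1: "polyfam I n1 \<Phi>1" unfolding \<Phi>1_def[abs_def] by (intro polyfam_smult S1 polyfn_power polyfn\<gamma>)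
  have \<Psi>1: "polyfam I n2 \<Psi>1" unfolding \<Psi>1_def[abs_def] by (intro polyfam_smult S2 polyfn_power polyfn\<gamma>)
  have \<Gamma>\<Phi>1: "\<Gamma> y * \<Phi>1 y = Polynomial.smult (\<gamma> y ^ k1 * \<gamma> y ^ k2) (\<Phi> y)" for y
    unfolding \<Phi>1_def by (simp add: ST1[symmetric] mult.commute[of "\<gamma> y ^ k2"])
  have \<Gamma>\<Psi>1: "\<Gamma> y * \<Psi>1 y = Polynomial.smult (\<gamma> y ^ k1 * \<gamma> y ^ k2) (\<Psi> y)" for y
    unfolding \<Psi>1_def by (simp add: ST2[symmetric])
  have "\<Phi>1 y * H y - \<Psi>1 y * Q y = 0" for y
  proof (rule polyfam_cancel[where \<Gamma> = \<Gamma> and k = g and ?y0.0 = z1 and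
        \<Phi> = "\<lambda>y. \<Phi>1 y * H y - \<Psi>1 y * Q y", OF \<Gamma>])
    show "coeff (\<Gamma> z1) g \<noteq> 0" using z1 by (simp add: \<gamma>_def)
    show "polyfam I (max (n1 + a) (n2 + Suc d)) (\<lambda>y. \<Phi>1 y * H y - \<Psi>1 y * Q y)"
      by (intro polyfam_diff polyfam_mult \<Phi>1 \<Psi>1 H Q(1))
    fix y
    have "\<Gamma> y * (\<Phi>1 y * H y - \<Psi>1 y * Q y) = (\<Gamma> y * \<Phi>1 y) * H y - (\<Gamma> y * \<Psi>1 y) * Q y"
      by (simp add: algebra_simps)
    also have "\<dots> = 0" unfolding \<Gamma>\<Phi>1 \<Gamma>\<Psi>1 by (simp add: HQ)
    finally show "\<Gamma> y * (\<Phi>1 y * H y - \<Psi>1 y * Q y) = 0" .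
  qed
  then have rel1: "\<Phi>1 y * H y = \<Psi>1 y * Q y" for y by simp
  \<comment> \<open>A common factor of positive degree could be cancelled, leaving a denominator
    \<open>\<Phi>1\<close> of degree below \<open>e\<close>. The degrees are compared where
    \<open>\<gamma> y \<noteq> 0\<close>, and the vanishing of coefficients is then extended to all
    \<open>y\<close>.\<close>
  have "g = 0"
  proof (rule ccontr)
    assume "g \<noteq> 0"
    have small: "coeff (\<Phi>1 y) j = 0" if "\<gamma> y \<noteq> 0" "e \<le> j" for y j
    proof (cases "\<Phi>1 y = 0")
      case False
      have "\<Gamma> y \<noteq> 0" using that(1) by (auto simp: \<gamma>_def)
      have "g \<le> degree (\<Gamma> y)" using that(1) unfolding \<gamma>_def by (rule le_degree)
      moreover have "degree (\<Gamma> y) + degree (\<Phi>1 y) \<le> e"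
      proof -
        have "degree (\<Gamma> y) + degree (\<Phi>1 y) = degree (\<Gamma> y * \<Phi>1 y)"
          using \<open>\<Gamma> y \<noteq> 0\<close> False by (simp add: degree_mult_eq)
        also have "\<dots> \<le> degree (\<Phi> y)" unfolding \<Gamma>\<Phi>1 by (rule degree_smult_le)
        also have "\<dots> \<le> e" using polyfam_coeff_0[OF \<Phi>] by (intro degree_le) auto
        finally show ?thesis .
      qed
      ultimately have "degree (\<Phi>1 y) < j" using \<open>g \<noteq> 0\<close> that(2) by linarith
      then show ?thesis by (rule coeff_eq_0)
    qed simp
    have "coeff (\<Phi>1 y) j = 0" if "e \<le> j" for y j
    proof (rule polyfn_zero_prod[where I = I and f = \<gamma> and g = "\<lambda>y. coeff (\<Phi>1 y) j" and y = z1,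
          OF polyfn\<gamma> polyfam_coeff[OF \<Phi>1] _ z1])
      show "\<gamma> x * coeff (\<Phi>1 x) j = 0" for x using small[of x j] that by auto
    qed
    then have "polyfam I e \<Phi>1" using polyfam_coeff[OF \<Phi>1] by (simp add: polyfam_def)
    then have "\<Phi>1 y = 0" for y using minimal[OF _ \<Psi>1 rel1] by blast
    then have "Polynomial.smult (\<gamma> y ^ k1 * \<gamma> y ^ k2) (\<Phi> y) = 0" for y using \<Gamma>\<Phi>1[of y] by simp
    then have "\<gamma> y = 0 \<or> \<Phi> y = 0" for y by (metis mult_eq_0_iff power_not_zero smult_eq_0_iff)
    then have "\<gamma> y * coeff (\<Phi> y) e = 0" for y by (metis coeff_0 mult_zero_left mult_zero_right)
    then show False
      using polyfn_zero_prod[where I = I and f = \<gamma> and g = "\<lambda>y. coeff (\<Phi> y) e" and y = z1,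
          OF polyfn\<gamma> polyfam_coeff[OF \<Phi>] _ z1] z0 by blast
  qed
  have bezout: "poly (Polynomial.smult (coeff (\<Phi> y) e) (A y)) t * poly (\<Phi>' y) t +
      poly (B y) t * poly (\<Psi> y) t = \<gamma> y" for y t
  proof -
    have "poly (\<Gamma> y) t = \<gamma> y" using polyfam_poly[OF \<Gamma>, of y t] by (simp add: \<open>g = 0\<close> \<gamma>_def)
    moreover have "poly (\<Phi> y) t = coeff (\<Phi> y) e * poly (\<Phi>' y) t"
      by (subst \<Phi>'(3)) simp
    ultimately show ?thesis by (simp add: \<Gamma>_def mult_ac)
  qed

  \<comment> \<open>The factor \<open>q (Fv x)\<close>, not identically zero, is cancelled from
    \<open>HQ\<close> at the line point \<open>Fv x\<close>. Hence a zero of the denominator on the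
    image is a zero of the numerator.\<close>
  have num: "poly (\<Phi> (\<lambda>j. Fv x j - t * v j)) t * x i = poly (\<Psi> (\<lambda>j. Fv x j - t * v j)) t" for x t
  proof -
    have PFpoly: "polyfn I (\<lambda>y. poly (\<Xi> y) t)" if "polyfam I n \<Xi>" for \<Xi> n
      unfolding polyfam_poly[OF that] by (intro polyfn_sum polyfn_mult polyfn_const polyfam_coeff[OF that])
    define D where "D x = poly (\<Phi> (\<lambda>j. Fv x j - t * v j)) t * x i - poly (\<Psi> (\<lambda>j. Fv x j - t * v j)) t" for x
    have "polyfn I D"
      unfolding D_def[abs_def]
      by (intro polyfn_diff polyfn_mult polyfn_comp_Fv_shift[OF PFpoly[OF \<Phi>]] polyfn_comp_Fv_shift[OF PFpoly[OF \<Psi>]]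
          polyfn_var i)
    moreover have "q (Fv x) * D x = 0" for x
    proof -
      let ?y = "\<lambda>j. Fv x j - t * v j"
      have "poly (\<Phi> ?y) t * poly (H ?y) t = poly (\<Psi> ?y) t * poly (Q ?y) t"
        using arg_cong[OF HQ, of "\<lambda>p. poly p t" ?y] by simp
      then have "(q (Fv x) / \<tau>) * D x = 0"
        unfolding QF HF D_def by (simp add: algebra_simps)
      then show ?thesis using Q0(1) by simp
    qed
    ultimately have "D x = 0"
      using polyfn_zero_prod[where I = I and f = "\<lambda>x. q (Fv x)" and g = D and y = x1,
          OF polyfn_comp_Fv[OF q(1)] _ _ x1] by blast
    then show ?thesis by (simp add: D_def)
  qed
  have "e = 0"
  proof (rule denominator_degree_0[OF \<Phi>'(1,2) _ \<Psi> bezout polyfn\<gamma> z1])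
    fix x t assume "poly (\<Phi>' (\<lambda>i. Fv x i - t * v i)) t = 0"
    then have "poly (\<Phi> (\<lambda>i. Fv x i - t * v i)) t = 0" by (subst \<Phi>'(3)) simp
    then show "poly (\<Psi> (\<lambda>i. Fv x i - t * v i)) t = 0" using num[of x t] by simp
  qed

  \<comment> \<open>\<open>Q\<close> is monic, so this is genuine division with remainder. As
    \<open>\<Phi>\<close> is now constant in \<open>t\<close>, a nonzero multiple of the remainder
    is divisible by \<open>Q\<close> wherever that constant is nonzero, although its degree is below
    \<open>d\<close>.\<close>
  obtain k3 n3 S3 T3 where S3: "polyfam I n3 S3" and T3: "polyfam I d T3"
    and ST3: "\<And>y. H y = Q y * S3 y + T3 y"
    using pseudo_division[OF H Q(1)] by (auto simp: Q(2))
  have "T3 y = 0" for y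
  proof (rule polyfam_eq_0[where \<Phi> = T3 and f = "\<lambda>y. coeff (\<Phi> y) e" and ?y0.0 = z0,
        OF T3 polyfam_coeff[OF \<Phi>] z0])
    fix y assume nz: "coeff (\<Phi> y) e \<noteq> 0"
    define \<alpha> where "\<alpha> = coeff (\<Phi> y) e"
    have "\<Phi> y = [:\<alpha>:]"
      unfolding \<alpha>_def using polyfam_coeff_0[OF \<Phi>, of _ y] \<open>e = 0\<close>
      by (intro poly_eqI) (auto simp: coeff_pCons split: nat.split)
    then have eq: "Polynomial.smult \<alpha> (T3 y) = Q y * (\<Psi> y - Polynomial.smult \<alpha> (S3 y))"
      using HQ[of y] by (simp add: ST3 algebra_simps smult_add_right)
    show "T3 y = 0"
    proof (rule ccontr)
      assume "T3 y \<noteq> 0"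
      then have "Polynomial.smult \<alpha> (T3 y) \<noteq> 0" using nz by (simp add: \<alpha>_def)
      then have "d \<le> degree (Polynomial.smult \<alpha> (T3 y))"
        unfolding eq using le_degree[of "Q y" d] Q(2)[of y]
        by (auto simp: degree_mult_eq)
      then have "d \<le> degree (T3 y)" using degree_smult_le order_trans by blast
      then have "lead_coeff (T3 y) = 0" using polyfam_coeff_0[OF T3] by blast
      then show False using \<open>T3 y \<noteq> 0\<close> by simp
    qed
  qed
  then have HS: "H y = Q y * S3 y" for y using ST3 by simp
  \<comment> \<open>At \<open>t = 0\<close> the line point \<open>y + t v\<close> is
    \<open>y\<close> itself.\<close>
  define p where "p y = poly (S3 y) 0" for y
  have PFp: "polyfn I p"
    unfolding p_def[abs_def] polyfam_poly[OF S3] by (intro polyfn_sum polyfn_mult polyfn_const polyfam_coeff[OF S3])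
  have "q (Fv x) * (x i - p (Fv x)) = 0" for x
  proof -
    have "poly (H (Fv x)) 0 = poly (Q (Fv x)) 0 * p (Fv x)" by (simp add: HS p_def)
    then show ?thesis using HF[of x 0] QF[of x 0] Q0(1) by auto
  qed
  then have "x i - p (Fv x) = 0" for x
    using polyfn_zero_prod[where I = I and f = "\<lambda>x. q (Fv x)" and g = "\<lambda>x. x i - p (Fv x)" and y = x1,
        OF polyfn_comp_Fv[OF q(1)] polyfn_diff[OF polyfn_var[OF i] polyfn_comp_Fv[OF PFp]] _ x1] by blast
  then show ?thesis using PFp by (intro exI[of _ p]) auto
qed

end

section \<open>Druzkowski matrices and the Zariski topology\<close>

lemma poly_funI:
  fixes f :: "complex Matrix.vec \<Rightarrow> complex"
  assumes "finite K"
    and "\<And>x. x \<in> carrier_vec n \<Longrightarrow> f x = (\<Sum>k\<in>K. c k * (\<Prod>i<n. (x $ i) ^ \<epsilon> k i))"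
  shows "poly_fun n f"
  unfolding poly_fun_def
proof (intro exI[of _ "\<epsilon> ` K"] exI[of _ "\<lambda>e. \<Sum>k\<in>{k \<in> K. \<epsilon> k = e}. c k"] conjI ballI)
  fix x :: "complex Matrix.vec" assume "x \<in> carrier_vec n"
  then have "f x = (\<Sum>k\<in>K. c k * (\<Prod>i<n. (x $ i) ^ \<epsilon> k i))" by (rule assms(2))
  \<comment> \<open>Different \<open>k\<close> may have the same exponents; their coefficients are
    collected over the fibres of \<open>\<epsilon>\<close>.\<close>
  also have "\<dots> = (\<Sum>e\<in>\<epsilon> ` K. \<Sum>k\<in>{k \<in> K. \<epsilon> k = e}. c k * (\<Prod>i<n. (x $ i) ^ \<epsilon> k i))"
    by (rule sum.image_gen[OF assms(1)])
  also have "\<dots> = (\<Sum>e\<in>\<epsilon> ` K. (\<Sum>k\<in>{k \<in> K. \<epsilon> k = e}. c k) * (\<Prod>i<n. (x $ i) ^ e i))"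
    by (intro sum.cong refl) (simp add: sum_distrib_right)
  finally show "f x = (\<Sum>e\<in>\<epsilon> ` K. (\<Sum>k\<in>{k \<in> K. \<epsilon> k = e}. c k) * (\<Prod>i<n. (x $ i) ^ e i))" .
qed (use assms(1) in simp)

lemma poly_fun_const: "poly_fun n (\<lambda>x. c)"
  by (rule poly_funI[where K = "{()}" and c = "\<lambda>_. c" and \<epsilon> = "\<lambda>_ _. 0"]) auto

lemma poly_fun_coord: "i < n \<Longrightarrow> poly_fun n (\<lambda>x. x $ i)"
proof (rule poly_funI[where K = "{()}" and c = "\<lambda>_. 1" and \<epsilon> = "\<lambda>_ j. if j = i then 1 else 0"])
  fix x :: "complex Matrix.vec" assume "i < n"
  have "(\<Prod>j<n. x $ j ^ (if j = i then 1 else 0)) = (\<Prod>j<n. if j = i then x $ j else 1)"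
    by (intro prod.cong) auto
  then show "x $ i = (\<Sum>k\<in>{()}. 1 * (\<Prod>j<n. x $ j ^ (if j = i then 1 else 0)))"
    using \<open>i < n\<close> by simp
qed simp

lemma poly_fun_add:
  assumes "poly_fun n f" "poly_fun n g"
  shows "poly_fun n (\<lambda>x. f x + g x)"
proof -
  obtain E c where f: "finite E" "\<And>x. x \<in> carrier_vec n \<Longrightarrow> f x = (\<Sum>e\<in>E. c e * (\<Prod>i<n. (x $ i) ^ e i))"
    using assms(1) unfolding poly_fun_def by blast
  obtain D d where g: "finite D" "\<And>x. x \<in> carrier_vec n \<Longrightarrow> g x = (\<Sum>e\<in>D. d e * (\<Prod>i<n. (x $ i) ^ e i))"
    using assms(2) unfolding poly_fun_def by blast
  show ?thesis
    by (rule poly_funI[where K = "E <+> D" and c = "case_sum c d" and \<epsilon> = "case_sum id id"])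
      (use f g in \<open>simp_all add: sum.Plus o_def\<close>)
qed

lemma poly_fun_mult:
  assumes "poly_fun n f" "poly_fun n g"
  shows "poly_fun n (\<lambda>x. f x * g x)"
proof -
  obtain E c where f: "finite E" "\<And>x. x \<in> carrier_vec n \<Longrightarrow> f x = (\<Sum>e\<in>E. c e * (\<Prod>i<n. (x $ i) ^ e i))"
    using assms(1) unfolding poly_fun_def by blast
  obtain D d where g: "finite D" "\<And>x. x \<in> carrier_vec n \<Longrightarrow> g x = (\<Sum>e\<in>D. d e * (\<Prod>i<n. (x $ i) ^ e i))"
    using assms(2) unfolding poly_fun_def by blast
  show ?thesis
  proof (rule poly_funI[where K = "E \<times> D" and c = "\<lambda>(e, e'). c e * d e'" and \<epsilon> = "\<lambda>(e, e') i. e i + e' i"])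
    fix x :: "complex Matrix.vec" assume "x \<in> carrier_vec n"
    then have "f x * g x = (\<Sum>(e, e')\<in>E \<times> D. (c e * (\<Prod>i<n. (x $ i) ^ e i)) * (d e' * (\<Prod>i<n. (x $ i) ^ e' i)))"
      by (simp add: f g sum_product sum.cartesian_product)
    also have "\<dots> = (\<Sum>k\<in>E \<times> D. (case k of (e, e') \<Rightarrow> c e * d e') * (\<Prod>i<n. x $ i ^ (case k of (e, e') \<Rightarrow> \<lambda>i. e i + e' i) i))"
      by (intro sum.cong refl) (auto simp: power_add prod.distrib)
    finally show "f x * g x = \<dots>" .
  qed (use f g in simp)
qed

lemma poly_fun_sum: "(\<And>a. a \<in> A \<Longrightarrow> poly_fun n (f a)) \<Longrightarrow> poly_fun n (\<lambda>x. \<Sum>a\<in>A. f a x)"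
  by (induction A rule: infinite_finite_induct) (simp_all add: poly_fun_const poly_fun_add)

lemma poly_fun_prod: "(\<And>a. a \<in> A \<Longrightarrow> poly_fun n (f a)) \<Longrightarrow> poly_fun n (\<lambda>x. \<Prod>a\<in>A. f a x)"
  by (induction A rule: infinite_finite_induct) (simp_all add: poly_fun_const poly_fun_mult)

lemma poly_fun_power: "poly_fun n f \<Longrightarrow> poly_fun n (\<lambda>x. f x ^ k)"
  by (induction k) (simp_all add: poly_fun_const poly_fun_mult)

lemma poly_fun_cong: "poly_fun n f \<Longrightarrow> (\<And>x. x \<in> carrier_vec n \<Longrightarrow> f x = g x) \<Longrightarrow> poly_fun n g"
  unfolding poly_fun_def by simp

lemma det_mat:
  "Determinant.det (Matrix.mat n n a) = (\<Sum>p\<in>{p. p permutes {0..<n}}. signof p * (\<Prod>i = 0..<n. a (i, p i)))"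
  unfolding Determinant.det_def
  by (auto intro!: sum.cong prod.cong simp: permutes_in_image)

lemma poly_fun_det:
  assumes "\<And>i j. i < n \<Longrightarrow> j < n \<Longrightarrow> poly_fun N (a i j)"
  shows "poly_fun N (\<lambda>x. Determinant.det (Matrix.mat n n (\<lambda>(i, j). a i j x)))"
proof -
  have "poly_fun N (\<lambda>x. \<Sum>p\<in>{p. p permutes {0..<n}}. signof p * (\<Prod>i = 0..<n. a i (p i) x))"
    by (intro poly_fun_sum poly_fun_mult poly_fun_const poly_fun_prod assms)
      (use permutes_in_image in fastforce)+
  then show ?thesis unfolding det_mat by simp
qed

lemma polyfn_of_poly_fun: "poly_fun n f \<Longrightarrow> polyfn {..<n} (\<lambda>x. f (Matrix.vec n x))"
proof -
  assume "poly_fun n f"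
  then obtain E c where f: "\<And>x. x \<in> carrier_vec n \<Longrightarrow> f x = (\<Sum>e\<in>E. c e * (\<Prod>i<n. (x $ i) ^ e i))"
    unfolding poly_fun_def by blast
  have eq: "f (Matrix.vec n x) = (\<Sum>e\<in>E. c e * (\<Prod>i<n. (x i) ^ e i))" for x
    by (subst f) auto
  show ?thesis
    unfolding eq by (intro polyfn_sum polyfn_mult polyfn_prod polyfn_power polyfn_const polyfn_var)
qed

lemma poly_fun_of_PF: "polyfn {..<n} p \<Longrightarrow> poly_fun n (\<lambda>x. p (\<lambda>i. x $ i))"
  by (induction rule: polyfn_induct) (simp_all add: poly_fun_const poly_fun_coord poly_fun_add poly_fun_mult)

text \<open>Up to the factor \<open>3\<close>, which is absorbed into \<open>u\<close>, this is the Jacobian matrix of \<open>F\<^sub>A\<close> if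
  \<open>u = A x\<close>.\<close>
definition dmat :: "nat \<Rightarrow> complex Matrix.mat \<Rightarrow> (nat \<Rightarrow> complex) \<Rightarrow> complex Matrix.mat" where
  "dmat n A u = Matrix.mat n n (\<lambda>(i, j). of_bool (i = j) + (u i)\<^sup>2 * A $$ (i, j))"

definition app :: "nat \<Rightarrow> complex Matrix.mat \<Rightarrow> (nat \<Rightarrow> complex) \<Rightarrow> nat \<Rightarrow> complex" where
  "app n A x i = (\<Sum>j<n. A $$ (i, j) * x j)"

lemma mult_mat_vec_app:
  assumes "A \<in> carrier_mat n n" "x \<in> carrier_vec n" "i < n"
  shows "(A *\<^sub>v x) $ i = app n A (\<lambda>j. x $ j) i"
  using assms by (simp add: app_def scalar_prod_def atLeast0LessThan)

lemma app_lin: "app n A (\<lambda>j. a * x j + b * y j) i = a * app n A x i + b * app n A y i"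
  unfolding app_def by (simp add: algebra_simps sum.distrib sum_distrib_left)

lemma app_scale: "app n A (\<lambda>j. a * x j) i = a * app n A x i"
  unfolding app_def by (simp add: algebra_simps sum_distrib_left)

lemma app_cong: "(\<And>j. j < n \<Longrightarrow> x j = y j) \<Longrightarrow> app n A x i = app n A y i"
  unfolding app_def by (intro sum.cong) auto

lemma dmat_cong: "(\<And>j. j < n \<Longrightarrow> (u j)\<^sup>2 = (v j)\<^sup>2) \<Longrightarrow> dmat n A u = dmat n A v"
  unfolding dmat_def by (intro eq_matI) auto

lemma diag_dmat:
  assumes "A \<in> carrier_mat n n" "u \<in> carrier_vec n"
  shows "1\<^sub>m n + \<Delta>[u ^\<^sub>c 2] * A = dmat n A (\<lambda>i. u $ i)"
proof (rule eq_matI)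
  fix i j assume "i < dim_row (dmat n A (\<lambda>i. u $ i))" "j < dim_col (dmat n A (\<lambda>i. u $ i))"
  then have ij: "i < n" "j < n" by (auto simp: dmat_def)
  have B: "\<Delta>[u ^\<^sub>c 2] * A \<in> carrier_mat n n" "(\<Delta>[u ^\<^sub>c 2] * A) $$ (i, j) = (u $ i)\<^sup>2 * A $$ (i, j)"
    using assms ij
    by (simp_all add: diag_of_vec_def cw_pow_def mat_diag_mult_left[of A n n])
  then have "(1\<^sub>m n + \<Delta>[u ^\<^sub>c 2] * A) $$ (i, j) = of_bool (i = j) + (u $ i)\<^sup>2 * A $$ (i, j)"
    using ij by (simp del: index_mult_mat)
  then show "(1\<^sub>m n + \<Delta>[u ^\<^sub>c 2] * A) $$ (i, j) = dmat n A (\<lambda>i. u $ i) $$ (i, j)"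
    using ij by (simp add: dmat_def)
qed (use assms in \<open>auto simp: dmat_def diag_of_vec_def cw_pow_def carrier_matD[OF mat_diag_dim]\<close>)

text \<open>Absorbs the 3 of \<open>(t^3)' = 3 t^2\<close>: the Jacobian matrix of the cubic linear
  map at \<open>x\<close> is \<open>dmat\<close> at \<open>rt3 A x\<close>.\<close>

definition rt3 :: complex where "rt3 = complex_of_real (sqrt 3)"

lemma rt3: "rt3\<^sup>2 = 3" "rt3 \<noteq> 0"
proof -
  have "rt3\<^sup>2 = complex_of_real ((sqrt 3)\<^sup>2)" unfolding rt3_def by (simp only: of_real_power)
  then show "rt3\<^sup>2 = 3" by simp
  then show "rt3 \<noteq> 0" by auto
qed

lemma cubic_linear_index:
  assumes "A \<in> carrier_mat n n" "x \<in> carrier_vec n" "i < n"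
  shows "cubic_linear A x $ i = x $ i + app n A (\<lambda>j. x $ j) i ^ 3"
  using assms mult_mat_vec_app[OF assms] by (simp add: cubic_linear_def cw_pow_def)

lemma cubic_linear_carrier:
  assumes "A \<in> carrier_mat n n" "x \<in> carrier_vec n"
  shows "cubic_linear A x \<in> carrier_vec n"
  using assms by (simp add: cubic_linear_def cw_pow_def)

lemma jacobian_cubic_linear:
  assumes A: "A \<in> carrier_mat n n" and x: "x \<in> carrier_vec n"
  shows "jacobian n (cubic_linear A) x = dmat n A (\<lambda>i. rt3 * app n A (\<lambda>j. x $ j) i)"
proof (rule eq_matI)
  fix i j assume "i < dim_row (dmat n A (\<lambda>i. rt3 * app n A (\<lambda>j. x $ j) i))"
    "j < dim_col (dmat n A (\<lambda>i. rt3 * app n A (\<lambda>j. x $ j) i))"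
  then have ij: "i < n" "j < n" by (auto simp: dmat_def)
  define y where "y = app n A (\<lambda>j. x $ j) i"
  have "cubic_linear A (x + t \<cdot>\<^sub>v unit_vec n j) $ i =
      (x $ i + t * of_bool (i = j)) + (y + t * A $$ (i, j)) ^ 3" for t
  proof -
    have "app n A (\<lambda>k. (x + t \<cdot>\<^sub>v unit_vec n j) $ k) i =
        app n A (\<lambda>k. 1 * x $ k + t * of_bool (k = j)) i"
      using x ij by (intro app_cong) (auto simp: unit_vec_def)
    also have "\<dots> = y + t * A $$ (i, j)"
      unfolding app_lin y_def using ij by (simp add: app_def of_bool_def if_distrib cong: if_cong)
    finally show ?thesis
      using cubic_linear_index[OF A, of "x + t \<cdot>\<^sub>v unit_vec n j" i] x ij by (auto simp: unit_vec_def)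
  qed
  moreover have "((\<lambda>t. (x $ i + t * of_bool (i = j)) + (y + t * A $$ (i, j)) ^ 3)
      has_field_derivative of_bool (i = j) + 3 * y\<^sup>2 * A $$ (i, j)) (at 0)"
    by (auto intro!: derivative_eq_intros)
  ultimately have "deriv (\<lambda>t. cubic_linear A (x + t \<cdot>\<^sub>v unit_vec n j) $ i) 0 =
      of_bool (i = j) + 3 * y\<^sup>2 * A $$ (i, j)"
    by (simp add: DERIV_imp_deriv)
  then show "jacobian n (cubic_linear A) x $$ (i, j) =
      dmat n A (\<lambda>i. rt3 * app n A (\<lambda>j. x $ j) i) $$ (i, j)"
    using ij by (simp add: jacobian_def dmat_def y_def power_mult_distrib rt3)
qed (auto simp: jacobian_def dmat_def)

text \<open>Replacing \<open>x\<close> by \<open>x / rt3\<close>, a bijection of the space, removes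
  the factor 3 in front of the squares.\<close>

lemma druzkowski_iff:
  "druzkowski n A \<longleftrightarrow> A \<in> carrier_mat n n \<and> (\<forall>x. Determinant.det (dmat n A (app n A x)) = 1)"
proof (intro iffI conjI allI)
  assume D: "druzkowski n A"
  then show A: "A \<in> carrier_mat n n" by (simp add: druzkowski_def)
  fix x
  have "dmat n A (app n A x) = jacobian n (cubic_linear A) (Matrix.vec n (\<lambda>j. x j / rt3))"
    unfolding jacobian_cubic_linear[OF A vec_carrier]
  proof (rule dmat_cong)
    fix i
    have "app n A (\<lambda>j. Matrix.vec n (\<lambda>j. x j / rt3) $ j) i = app n A (\<lambda>j. (1 / rt3) * x j) i"
      by (intro app_cong) simp
    then show "(app n A x i)\<^sup>2 = (rt3 * app n A (\<lambda>j. Matrix.vec n (\<lambda>j. x j / rt3) $ j) i)\<^sup>2"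
      by (simp only: app_scale) (simp add: rt3)
  qed
  then show "Determinant.det (dmat n A (app n A x)) = 1" using D by (simp add: druzkowski_def)
next
  assume *: "A \<in> carrier_mat n n \<and> (\<forall>x. Determinant.det (dmat n A (app n A x)) = 1)"
  show "druzkowski n A"
    unfolding druzkowski_def
  proof (intro conjI ballI)
    fix x :: "complex Matrix.vec" assume x: "x \<in> carrier_vec n"
    have "(\<lambda>i. rt3 * app n A (\<lambda>j. x $ j) i) = app n A (\<lambda>j. rt3 * x $ j)"
      by (rule ext) (simp add: app_scale)
    then show "Determinant.det (jacobian n (cubic_linear A) x) = 1"
      using jacobian_cubic_linear[OF _ x] * by simp
  qed (use * in simp)
qed

text \<open>Replacing \<open>A\<close> by \<open>c A\<close> multiplies \<open>(A x)^2 A\<close> by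
  \<open>c^3 = (c * csqrt c)^2\<close>, which rescaling \<open>x\<close> by
  \<open>c * csqrt c\<close> absorbs.\<close>

lemma druzkowski_scale:
  assumes "druzkowski n A"
  shows "druzkowski n (c \<cdot>\<^sub>m A)"
proof -
  have A: "A \<in> carrier_mat n n" using assms by (simp add: druzkowski_def)
  have "dmat n (c \<cdot>\<^sub>m A) (app n (c \<cdot>\<^sub>m A) x) = dmat n A (app n A (\<lambda>j. (c * csqrt c) * x j))" for x
  proof (rule eq_matI)
    fix i j assume "i < dim_row (dmat n A (app n A (\<lambda>j. (c * csqrt c) * x j)))"
      "j < dim_col (dmat n A (app n A (\<lambda>j. (c * csqrt c) * x j)))"
    then have ij: "i < n" "j < n" by (auto simp: dmat_def)
    have "app n (c \<cdot>\<^sub>m A) x i = c * app n A x i"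
      using A ij by (simp add: app_def sum_distrib_left mult.assoc)
    then show "dmat n (c \<cdot>\<^sub>m A) (app n (c \<cdot>\<^sub>m A) x) $$ (i, j) =
        dmat n A (app n A (\<lambda>j. (c * csqrt c) * x j)) $$ (i, j)"
      using A ij by (simp add: dmat_def app_scale power_mult_distrib)
  qed (auto simp: dmat_def)
  then show ?thesis using assms A by (simp add: druzkowski_iff)
qed

lemma W_iff:
  "(y, z, A) \<in> W n \<longleftrightarrow> y \<in> carrier_vec n \<and> z \<in> carrier_vec n \<and> A \<in> carrier_mat n n \<and>
    (\<forall>s t. Determinant.det (dmat n A (\<lambda>i. s * z $ i + t * app n A (\<lambda>j. y $ j) i)) = 1) \<and>
    (\<forall>i<n. z $ i + app n A (\<lambda>j. (z $ j) ^ 3 + z $ j * (app n A (\<lambda>j. y $ j) j)\<^sup>2) i = 0)"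
proof -
  have D: "1\<^sub>m n + \<Delta>[(s \<cdot>\<^sub>v z + t \<cdot>\<^sub>v (A *\<^sub>v y)) ^\<^sub>c 2] * A =
      dmat n A (\<lambda>i. s * z $ i + t * app n A (\<lambda>j. y $ j) i)"
    if "y \<in> carrier_vec n" "z \<in> carrier_vec n" "A \<in> carrier_mat n n" for s t
  proof -
    have "s \<cdot>\<^sub>v z + t \<cdot>\<^sub>v (A *\<^sub>v y) \<in> carrier_vec n" using that by simp
    from diag_dmat[OF that(3) this]
    have "1\<^sub>m n + \<Delta>[(s \<cdot>\<^sub>v z + t \<cdot>\<^sub>v (A *\<^sub>v y)) ^\<^sub>c 2] * A =
        dmat n A (\<lambda>i. (s \<cdot>\<^sub>v z + t \<cdot>\<^sub>v (A *\<^sub>v y)) $ i)" .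
    also have "\<dots> = dmat n A (\<lambda>i. s * z $ i + t * app n A (\<lambda>j. y $ j) i)"
      by (rule dmat_cong) (use that mult_mat_vec_app[OF that(3,1)] in simp)
    finally show ?thesis .
  qed
  have E: "z + A *\<^sub>v (z ^\<^sub>c 3 + z *\<^sub>c (A *\<^sub>v y) ^\<^sub>c 2) = 0\<^sub>v n \<longleftrightarrow>
      (\<forall>i<n. z $ i + app n A (\<lambda>j. (z $ j) ^ 3 + z $ j * (app n A (\<lambda>j. y $ j) j)\<^sup>2) i = 0)"
    if "y \<in> carrier_vec n" "z \<in> carrier_vec n" "A \<in> carrier_mat n n"
  proof -
    define w where "w = z ^\<^sub>c 3 + z *\<^sub>c (A *\<^sub>v y) ^\<^sub>c 2"
    have w: "w \<in> carrier_vec n" using that by (simp add: w_def cw_pow_def cw_mult_def)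
    have "w $ j = (z $ j) ^ 3 + z $ j * (app n A (\<lambda>j. y $ j) j)\<^sup>2" if "j < n" for j
      using \<open>y \<in> _\<close> \<open>z \<in> _\<close> \<open>A \<in> _\<close> that mult_mat_vec_app[of A n y j]
      by (simp add: w_def cw_pow_def cw_mult_def)
    then have "(A *\<^sub>v w) $ i = app n A (\<lambda>j. (z $ j) ^ 3 + z $ j * (app n A (\<lambda>j. y $ j) j)\<^sup>2) i" if "i < n" for i
      using mult_mat_vec_app[OF \<open>A \<in> _\<close> w that] by (simp cong: app_cong)
    then have "z + A *\<^sub>v w = 0\<^sub>v n \<longleftrightarrow>
        (\<forall>i<n. z $ i + app n A (\<lambda>j. (z $ j) ^ 3 + z $ j * (app n A (\<lambda>j. y $ j) j)\<^sup>2) i = 0)"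
      using that w by (auto simp: vec_eq_iff)
    then show ?thesis by (simp add: w_def)
  qed
  show ?thesis unfolding W_def using D E by auto
qed

lemma W'_zero: "druzkowski n A \<Longrightarrow> y \<in> carrier_vec n \<Longrightarrow> (y, 0\<^sub>v n, A) \<in> W' n"
proof -
  assume D: "druzkowski n A" and y: "y \<in> carrier_vec n"
  then have A: "A \<in> carrier_mat n n" by (simp add: druzkowski_def)
  have "dmat n A (\<lambda>i. s * 0\<^sub>v n $ i + t * app n A (\<lambda>j. y $ j) i) = dmat n A (app n A (\<lambda>j. t * y $ j))" for s t
    by (rule dmat_cong) (simp add: app_scale)
  moreover have "app n A (\<lambda>j. (0\<^sub>v n $ j) ^ 3 + 0\<^sub>v n $ j * (app n A (\<lambda>j. y $ j) j)\<^sup>2) i = 0" for i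
    unfolding app_def by (intro sum.neutral) simp
  ultimately show ?thesis
    using D y A by (simp add: W'_def W_iff druzkowski_iff)
qed

text \<open>The substitution \<open>x = m \<plusminus> w\<close> with \<open>y = \<surd>3 m\<close> and \<open>z = A w\<close>.\<close>
lemma inj_if_W'_trivial:
  assumes D: "druzkowski n A"
    and W: "\<And>y z. (y, z, A) \<in> W' n \<Longrightarrow> z = 0\<^sub>v n"
    and eq: "\<And>i. i < n \<Longrightarrow> x1 i + app n A x1 i ^ 3 = x2 i + app n A x2 i ^ 3"
    and "i < n"
  shows "x1 i = x2 i"
proof -
  have A: "A \<in> carrier_mat n n" using D by (simp add: druzkowski_def)
  define u1 u2 where "u1 = app n A x1" and "u2 = app n A x2"
  define w where "w i = (1 / 2) * x1 i + (- 1 / 2) * x2 i" for i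
  \<comment> \<open>Half the sum of the colliding points, already multiplied by \<open>rt3\<close>,
    so that \<open>y\<close> is the vector of \<open>m\<close> itself.\<close>
  define m where "m i = (rt3 / 2) * x1 i + (rt3 / 2) * x2 i" for i
  have Aw: "app n A w i = (u1 i - u2 i) / 2" for i
    unfolding w_def app_lin u1_def u2_def by (simp add: diff_divide_distrib)
  have Am: "app n A m i = rt3 * (u1 i + u2 i) / 2" for i
    unfolding m_def app_lin u1_def u2_def by (simp add: add_divide_distrib distrib_left)
  define y z where "y = Matrix.vec n m" and "z = Matrix.vec n (app n A w)"
  have Ay: "app n A (\<lambda>j. y $ j) i = app n A m i" for i
    by (rule app_cong) (simp add: y_def)
  \<comment> \<open>With \<open>a = (u1 + u2) / 2\<close> and \<open>b = (u1 - u2) / 2\<close> one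
    has \<open>b^3 + 3 a^2 b = (u1^3 - u2^3) / 2\<close>, and the collision makes this
    \<open>- w\<close>.\<close>
  have id: "(app n A w j) ^ 3 + app n A w j * (app n A m j)\<^sup>2 = (- 1) * w j" if "j < n" for j
  proof -
    have sq: "(app n A m j)\<^sup>2 = 3 * ((u1 j + u2 j) / 2)\<^sup>2"
      unfolding Am by (simp add: power_mult_distrib power_divide rt3)
    then have "(app n A w j) ^ 3 + app n A w j * (app n A m j)\<^sup>2 = (u1 j ^ 3 - u2 j ^ 3) / 2"
      by (simp only: Aw sq) (simp add: field_simps power2_eq_square power3_eq_cube)
    also have "\<dots> = (- 1) * w j"
    proof -
      have "x1 j - x2 j = (x1 j + u1 j ^ 3) - (x2 j + u1 j ^ 3)" by simp
      also have "\<dots> = u2 j ^ 3 - u1 j ^ 3"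
        using eq[OF that] by (simp add: u1_def u2_def)
      finally have "w j = (1 / 2) * (u2 j ^ 3 - u1 j ^ 3)"
        by (simp add: w_def diff_divide_distrib[symmetric])
      then show ?thesis by (simp add: field_simps)
    qed
    finally show ?thesis .
  qed
  have "(y, z, A) \<in> W n"
    unfolding W_iff
  proof (intro conjI allI impI)
    fix s t
    have "dmat n A (\<lambda>i. s * z $ i + t * app n A (\<lambda>j. y $ j) i) = dmat n A (app n A (\<lambda>j. s * w j + t * m j))"
      by (rule dmat_cong) (simp add: app_lin Ay z_def)
    then show "Determinant.det (dmat n A (\<lambda>i. s * z $ i + t * app n A (\<lambda>j. y $ j) i)) = 1"
      using D by (simp add: druzkowski_iff)
  next
    fix i assume i: "i < n"
    have "app n A (\<lambda>j. (z $ j) ^ 3 + z $ j * (app n A (\<lambda>j. y $ j) j)\<^sup>2) i = app n A (\<lambda>j. (- 1) * w j) i"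
      by (rule app_cong) (simp add: z_def Ay id)
    then show "z $ i + app n A (\<lambda>j. (z $ j) ^ 3 + z $ j * (app n A (\<lambda>j. y $ j) j)\<^sup>2) i = 0"
      using i unfolding app_scale by (simp add: z_def)
  qed (use A in \<open>simp_all add: y_def z_def\<close>)
  then have "z = 0\<^sub>v n" using W D by (simp add: W'_def)
  then have "z $ i = 0" using \<open>i < n\<close> by simp
  \<comment> \<open>The equation \<open>A x1 = A x2\<close> makes the cubes equal, and then the
    collision gives \<open>x1 = x2\<close>.\<close>
  then have "u1 i = u2 i" using \<open>i < n\<close> by (simp add: z_def Aw)
  then show ?thesis using eq[OF \<open>i < n\<close>] by (simp add: u1_def u2_def)
qed

text \<open>The substitution reversed: \<open>w = - (z^3 + z (A y)^2)\<close> satisfies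
  \<open>A w = z\<close> by the equation of \<open>W\<close>, and the points
  \<open>y / rt3 + w\<close> and \<open>y / rt3 - w\<close> collide. Injectivity gives
  \<open>w = 0\<close>, hence \<open>z = 0\<close>.\<close>

lemma W'_trivial_if_inj:
  assumes inj: "\<And>x1 x2. x1 \<in> carrier_vec n \<Longrightarrow> x2 \<in> carrier_vec n \<Longrightarrow>
      cubic_linear A x1 = cubic_linear A x2 \<Longrightarrow> x1 = x2"
    and W: "(y, z, A) \<in> W' n"
  shows "z = 0\<^sub>v n"
proof -
  have A: "A \<in> carrier_mat n n" and y: "y \<in> carrier_vec n" and z: "z \<in> carrier_vec n"
    and eq: "\<And>i. i < n \<Longrightarrow> z $ i + app n A (\<lambda>j. (z $ j) ^ 3 + z $ j * (app n A (\<lambda>j. y $ j) j)\<^sup>2) i = 0"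
    using W by (auto simp: W'_def W_iff)
  define u where "u = app n A (\<lambda>j. y $ j)"
  define w where "w j = (- 1) * ((z $ j) ^ 3 + z $ j * (u j)\<^sup>2)" for j
  have Aw: "app n A w i = z $ i" if "i < n" for i
    unfolding w_def app_scale using eq[OF that] by (simp add: u_def add_eq_0_iff)
  define x where "x \<sigma> = Matrix.vec n (\<lambda>j. (1 / rt3) * y $ j + \<sigma> * w j)" for \<sigma>
  have x: "x \<sigma> \<in> carrier_vec n" for \<sigma> by (simp add: x_def)
  have Ax: "app n A (\<lambda>j. x \<sigma> $ j) i = u i / rt3 + \<sigma> * z $ i" if "i < n" for \<sigma> i
  proof -
    have "app n A (\<lambda>j. x \<sigma> $ j) i = app n A (\<lambda>j. (1 / rt3) * y $ j + \<sigma> * w j) i"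
      by (rule app_cong) (simp add: x_def)
    then show ?thesis using Aw[OF that] by (simp only: app_lin) (simp add: u_def)
  qed
  have "cubic_linear A (x 1) = cubic_linear A (x (- 1))"
  proof (rule eq_vecI)
    fix i assume "i < dim_vec (cubic_linear A (x (- 1)))"
    then have i: "i < n" using carrier_vecD[OF cubic_linear_carrier[OF A x[of "- 1"]]] by simp
    have "3 * (u i / rt3)\<^sup>2 = (u i)\<^sup>2" by (simp add: power_divide rt3)
    moreover have "(a + b) ^ 3 - (a - b) ^ 3 = 2 * (b ^ 3 + b * (3 * a\<^sup>2))" for a b :: complex
      by (simp add: power2_eq_square power3_eq_cube algebra_simps)
    ultimately have "(u i / rt3 + z $ i) ^ 3 - (u i / rt3 - z $ i) ^ 3 =
        2 * ((z $ i) ^ 3 + z $ i * (u i)\<^sup>2)" by metis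
    then show "cubic_linear A (x 1) $ i = cubic_linear A (x (- 1)) $ i"
      unfolding cubic_linear_index[OF A x i] Ax[OF i] using i
      by (simp add: x_def w_def algebra_simps)
  qed (simp add: carrier_vecD[OF cubic_linear_carrier[OF A x]])
  then have "x 1 = x (- 1)" by (rule inj[OF x x])
  have "w j = 0" if "j < n" for j
  proof -
    have "x 1 $ j = x (- 1) $ j" by (simp only: \<open>x 1 = x (- 1)\<close>)
    then have "2 * w j = 0" using that by (simp add: x_def)
    then show ?thesis by simp
  qed
  then have Aw0: "app n A w i = app n A (\<lambda>j. 0 * w j) i" for i by (intro app_cong) simp
  have "z $ i = 0" if "i < n" for i
  proof -
    have "app n A w i = 0" by (subst Aw0, subst app_scale) simp
    then show ?thesis using Aw[OF that] by simp
  qed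
  then show ?thesis using z by (intro eq_vecI) auto
qed

section \<open>The separating polynomial\<close>

definition coordA :: "nat \<Rightarrow> nat \<Rightarrow> nat \<Rightarrow> nat" where
  "coordA n i j = 2 * n + (i * n + j)"

definition sep :: "nat \<Rightarrow> complex Matrix.vec \<Rightarrow> complex" where
  "sep n p = Determinant.det (Matrix.mat n n (\<lambda>(i, j). of_bool (i = j) +
    ((\<Sum>k<n. p $ coordA n i k * p $ k)\<^sup>2 + (p $ (n + i))\<^sup>2) * p $ coordA n i j))"

lemma coordA_less: "i < n \<Longrightarrow> j < n \<Longrightarrow> coordA n i j < 2 * n + n * n"
proof -
  assume "i < n" "j < n"
  then have "i * n + j < Suc i * n" by simp
  also have "\<dots> \<le> n * n" using \<open>i < n\<close> by (intro mult_le_mono1) simp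
  finally show ?thesis by (simp add: coordA_def)
qed

lemma poly_fun_sep: "poly_fun (2 * n + n * n) (sep n)"
  unfolding sep_def[abs_def]
  by (intro poly_fun_det poly_fun_add poly_fun_const poly_fun_mult poly_fun_power poly_fun_sum
      poly_fun_coord) (auto simp: coordA_less)

lemma flatten_coords:
  assumes "y \<in> carrier_vec n" "z \<in> carrier_vec n" "i < n" "j < n"
  shows "flatten n (y, z, A) $ i = y $ i" "flatten n (y, z, A) $ (n + i) = z $ i"
    "flatten n (y, z, A) $ coordA n i j = A $$ (i, j)"
proof -
  have "i * n + j < n * n" using coordA_less[OF assms(3,4)] by (simp add: coordA_def)
  then show "flatten n (y, z, A) $ i = y $ i" "flatten n (y, z, A) $ (n + i) = z $ i"
    "flatten n (y, z, A) $ coordA n i j = A $$ (i, j)"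
    using assms by (auto simp: flatten_def coordA_def)
qed

lemma flatten_carrier:
  assumes "y \<in> carrier_vec n" "z \<in> carrier_vec n"
  shows "flatten n (y, z, A) \<in> carrier_vec (2 * n + n * n)"
  using assms by (intro carrier_vecI) (simp add: flatten_def)

text \<open>For \<open>z = 0\<close> the matrix is that of the determinant condition at
  \<open>s = 0\<close>, \<open>t = 1\<close>. Otherwise \<open>w = z^3 + z (A y)^2\<close> is in its
  kernel: \<open>A w = - z\<close> gives \<open>w + ((A y)^2 + z^2) A w = 0\<close>, and also
  \<open>w \<noteq> 0\<close>.\<close>

lemma sep_flatten:
  assumes "(y, z, A) \<in> W n"
  shows "sep n (flatten n (y, z, A)) = (if z = 0\<^sub>v n then 1 else 0)"
proof -
  have A: "A \<in> carrier_mat n n" and y: "y \<in> carrier_vec n" and z: "z \<in> carrier_vec n"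
    and det: "\<And>s t. Determinant.det (dmat n A (\<lambda>i. s * z $ i + t * app n A (\<lambda>j. y $ j) i)) = 1"
    and eq: "\<And>i. i < n \<Longrightarrow> z $ i + app n A (\<lambda>j. (z $ j) ^ 3 + z $ j * (app n A (\<lambda>j. y $ j) j)\<^sup>2) i = 0"
    using assms by (auto simp: W_iff)
  define u where "u = app n A (\<lambda>j. y $ j)"
  define M where "M = Matrix.mat n n (\<lambda>(i, j). of_bool (i = j) + ((u i)\<^sup>2 + (z $ i)\<^sup>2) * A $$ (i, j))"
  have M: "M \<in> carrier_mat n n" by (simp add: M_def)
  have "sep n (flatten n (y, z, A)) = Determinant.det M"
  proof -
    have "(\<Sum>k<n. flatten n (y, z, A) $ coordA n i k * flatten n (y, z, A) $ k) = u i" if "i < n" for i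
      unfolding u_def app_def using that y z by (intro sum.cong) (auto simp: flatten_coords)
    then show ?thesis
      unfolding sep_def M_def
      by (intro arg_cong[where f = Determinant.det] eq_matI) (auto simp: flatten_coords[OF y z])
  qed
  moreover have "Determinant.det M = 1" if "z = 0\<^sub>v n"
  proof -
    have "M = dmat n A (\<lambda>i. 0 * z $ i + 1 * app n A (\<lambda>j. y $ j) i)"
      unfolding M_def dmat_def using that by (intro eq_matI) (auto simp: u_def)
    then show ?thesis using det[of 0 1] by simp
  qed
  moreover have "Determinant.det M = 0" if "z \<noteq> 0\<^sub>v n"
  proof -
    define w where "w = Matrix.vec n (\<lambda>j. (z $ j) ^ 3 + z $ j * (u j)\<^sup>2)"
    have w: "w \<in> carrier_vec n" by (simp add: w_def)
    have Aw: "app n A (\<lambda>j. w $ j) i = - z $ i" if "i < n" for i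
    proof -
      have "app n A (\<lambda>j. w $ j) i = app n A (\<lambda>j. (z $ j) ^ 3 + z $ j * (u j)\<^sup>2) i"
        by (rule app_cong) (simp add: w_def)
      then show ?thesis using eq[OF that] by (simp add: u_def eq_neg_iff_add_eq_0 add.commute)
    qed
    have "w \<noteq> 0\<^sub>v n"
    proof
      assume "w = 0\<^sub>v n"
      then have "app n A (\<lambda>j. w $ j) i = app n A (\<lambda>j. 0 * u j) i" for i by (intro app_cong) simp
      then have "z $ i = 0" if "i < n" for i using Aw[OF that] by (simp only: app_scale) simp
      then have "z = 0\<^sub>v n" using z by (intro eq_vecI) auto
      then show False using \<open>z \<noteq> 0\<^sub>v n\<close> by simp
    qed
    moreover have "M *\<^sub>v w = 0\<^sub>v n"
    proof (rule eq_vecI)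
      fix i assume "i < dim_vec (0\<^sub>v n :: complex Matrix.vec)"
      then have i: "i < n" by simp
      have "(M *\<^sub>v w) $ i = (\<Sum>j<n. M $$ (i, j) * w $ j)"
        using mult_mat_vec_app[OF M w i] by (simp add: app_def)
      also have "\<dots> = (\<Sum>j<n. of_bool (i = j) * w $ j) + ((u i)\<^sup>2 + (z $ i)\<^sup>2) * app n A (\<lambda>j. w $ j) i"
        using i by (simp add: M_def app_def distrib_right sum.distrib sum_distrib_left mult.assoc)
      also have "(\<Sum>j<n. of_bool (i = j) * w $ j) = w $ i"
        using i by (simp add: of_bool_def if_distrib[of "\<lambda>a. a * _"] cong: if_cong)
      also have "w $ i + ((u i)\<^sup>2 + (z $ i)\<^sup>2) * app n A (\<lambda>j. w $ j) i = 0"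
        unfolding Aw[OF i] using i
        by (simp add: w_def power3_eq_cube power2_eq_square algebra_simps)
      finally show "(M *\<^sub>v w) $ i = 0\<^sub>v n $ i" using i by simp
    qed (use M in simp)
    ultimately show ?thesis using det_0_iff_vec_prod_zero[OF M] w by blast
  qed
  ultimately show ?thesis by simp
qed

section \<open>Connectedness in the Zariski topology\<close>

lemma zariski_open: "poly_fun N f \<Longrightarrow> openin (zariski N) {x \<in> carrier_vec N. f x \<noteq> 0}"
  unfolding zariski_def by (rule topology_generated_by_Basis) blast

lemma topspace_zariski: "topspace (zariski N) = carrier_vec N"
proof
  show "topspace (zariski N) \<subseteq> carrier_vec N"
    unfolding zariski_def topology_generated_by_topspace by blast
  have "openin (zariski N) {x \<in> carrier_vec N. (1::complex) \<noteq> 0}"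
    by (rule zariski_open[OF poly_fun_const])
  then show "carrier_vec N \<subseteq> topspace (zariski N)"
    using openin_subset by fastforce
qed

text \<open>The nonvanishing loci of \<open>f\<close> and \<open>f - 1\<close> would separate
  \<open>S\<close>.\<close>

lemma zariski_connected_const:
  assumes S: "connectedin (zariski N) S" and f: "poly_fun N f" and f01: "\<And>x. x \<in> S \<Longrightarrow> f x = 0 \<or> f x = 1"
    and "a \<in> S" "b \<in> S" "f b = 1"
  shows "f a = 1"
proof (rule ccontr)
  assume "f a \<noteq> 1"
  then have "f a = 0" using f01 \<open>a \<in> S\<close> by blast
  have SN: "S \<subseteq> carrier_vec N" using S connectedin_subset_topspace topspace_zariski by metis
  define U1 U2 where "U1 = {x \<in> carrier_vec N. f x \<noteq> 0}" and "U2 = {x \<in> carrier_vec N. f x + (- 1) \<noteq> 0}"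
  have "openin (zariski N) U1" "openin (zariski N) U2"
    unfolding U1_def U2_def by (intro zariski_open f poly_fun_add poly_fun_const)+
  moreover have "S \<subseteq> U1 \<union> U2" using SN by (auto simp: U1_def U2_def)
  moreover have "U1 \<inter> U2 \<inter> S = {}" using f01 by (force simp: U1_def U2_def)
  moreover have "b \<in> U1 \<inter> S" "a \<in> U2 \<inter> S"
    using \<open>a \<in> S\<close> \<open>b \<in> S\<close> \<open>f b = 1\<close> \<open>f a = 0\<close> SN by (auto simp: U1_def U2_def)
  ultimately show False using S unfolding connectedin by blast
qed

text \<open>Each orbit \<open>c p\<close> is the image of the Euclidean plane of scalars under a map
  continuous into the Zariski topology, hence connected, and all orbits contain the origin.\<close>

lemma zariski_connected_star:
  assumes S: "S \<subseteq> carrier_vec N" "\<And>c p. p \<in> S \<Longrightarrow> c \<cdot>\<^sub>v p \<in> S"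
  shows "connectedin (zariski N) S"
proof -
  have line: "connectedin (zariski N) (range (\<lambda>c. c \<cdot>\<^sub>v p))" if "p \<in> S" for p
  proof -
    have p: "p \<in> carrier_vec N" using that S(1) by blast
    have "continuous_map euclidean (zariski N) (\<lambda>c. c \<cdot>\<^sub>v p)"
      unfolding zariski_def
    proof (rule continuous_on_generated_topo)
      fix U assume "U \<in> {{x \<in> carrier_vec N. f x \<noteq> 0} | f. poly_fun N f}"
      then obtain f where f: "poly_fun N f" "U = {x \<in> carrier_vec N. f x \<noteq> 0}" by blast
      obtain E k where fE: "\<And>x. x \<in> carrier_vec N \<Longrightarrow> f x = (\<Sum>e\<in>E. k e * (\<Prod>i<N. (x $ i) ^ e i))"
        using f(1) unfolding poly_fun_def by blast
      have "f (c \<cdot>\<^sub>v p) = (\<Sum>e\<in>E. k e * (\<Prod>i<N. (c * p $ i) ^ e i))" for c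
        using p by (subst fE) auto
      then have "(\<lambda>c. c \<cdot>\<^sub>v p) -` U = {c. (\<Sum>e\<in>E. k e * (\<Prod>i<N. (c * p $ i) ^ e i)) \<noteq> 0}"
        using p by (auto simp: f(2))
      moreover have "open \<dots>" by (intro open_Collect_neq continuous_intros)
      ultimately show "openin euclidean ((\<lambda>c. c \<cdot>\<^sub>v p) -` U \<inter> topspace euclidean)" by simp
    next
      show "(\<lambda>c. c \<cdot>\<^sub>v p) ` topspace euclidean \<subseteq> \<Union> {{x \<in> carrier_vec N. f x \<noteq> 0} | f. poly_fun N f}"
        using p topspace_zariski[of N] unfolding zariski_def topology_generated_by_topspace by auto
    qed
    from connectedin_continuous_map_image[OF this, of UNIV] show ?thesis
      by (simp add: connected_UNIV)
  qed
  show ?thesis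
  proof (cases "S = {}")
    case False
    have zero: "0\<^sub>v N \<in> range (\<lambda>c. c \<cdot>\<^sub>v p)" if "p \<in> S" for p
    proof -
      have "0 \<cdot>\<^sub>v p = 0\<^sub>v N" using that S(1) by (intro eq_vecI) auto
      then show ?thesis by (metis rangeI)
    qed
    have "connectedin (zariski N) (\<Union>p\<in>S. range (\<lambda>c. c \<cdot>\<^sub>v p))"
    proof (rule connectedin_Union)
      have "0\<^sub>v N \<in> (\<Inter>p\<in>S. range (\<lambda>c. c \<cdot>\<^sub>v p))" using zero by blast
      then show "(\<Inter>p\<in>S. range (\<lambda>c. c \<cdot>\<^sub>v p)) \<noteq> {}" by blast
    qed (use line in blast)
    moreover have "(\<Union>p\<in>S. range (\<lambda>c. c \<cdot>\<^sub>v p)) = S"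
    proof
      show "S \<subseteq> (\<Union>p\<in>S. range (\<lambda>c. c \<cdot>\<^sub>v p))"
      proof
        fix p assume "p \<in> S"
        moreover have "1 \<cdot>\<^sub>v p = p" by simp
        ultimately show "p \<in> (\<Union>p\<in>S. range (\<lambda>c. c \<cdot>\<^sub>v p))" by (metis UN_I rangeI)
      qed
    qed (use S(2) in auto)
    ultimately show ?thesis by simp
  qed simp
qed

lemma druzkowski_0: "druzkowski n (0\<^sub>m n n)"
proof -
  have "dmat n (0\<^sub>m n n) u = 1\<^sub>m n" for u
    unfolding dmat_def by (intro eq_matI) auto
  then show ?thesis by (simp add: druzkowski_iff)
qed

text \<open>Stated for any \<open>S\<close> between \<open>W' n\<close> and \<open>W n\<close>, so
  that one argument covers both; \<open>S\<close> contains the origin, where \<open>sep\<close> is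
  1.\<close>

lemma trivial_if_connected:
  assumes "variety_connected n S" "W' n \<subseteq> S" "S \<subseteq> W n" "(y, z, A) \<in> S"
  shows "z = 0\<^sub>v n"
proof -
  have zero: "(0\<^sub>v n, 0\<^sub>v n, 0\<^sub>m n n) \<in> S"
    using W'_zero[OF druzkowski_0] assms(2) by auto
  have sep_S: "sep n (flatten n (y, z, A)) = (if z = 0\<^sub>v n then 1 else 0)" if "(y, z, A) \<in> S" for y z A
    using sep_flatten[of y z A n] assms(3) that by blast
  have "sep n (flatten n (y, z, A)) = 1"
  proof (rule zariski_connected_const[OF _ poly_fun_sep])
    show "connectedin (zariski (2 * n + n * n)) (flatten n ` S)"
      using assms(1) by (simp add: variety_connected_def)
    show "flatten n (y, z, A) \<in> flatten n ` S" using assms(4) by blast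
    show "flatten n (0\<^sub>v n, 0\<^sub>v n, 0\<^sub>m n n) \<in> flatten n ` S" using zero by blast
    show "sep n (flatten n (0\<^sub>v n, 0\<^sub>v n, 0\<^sub>m n n)) = 1" using sep_S[OF zero] by simp
    fix p assume "p \<in> flatten n ` S"
    then obtain y z A where "p = flatten n (y, z, A)" "(y, z, A) \<in> S" by auto
    then show "sep n p = 0 \<or> sep n p = 1" using sep_S by simp
  qed
  then show ?thesis using sep_S[OF assms(4)] by (simp split: if_splits)
qed

lemma W'_connected_if_trivial:
  assumes "\<And>y z A. (y, z, A) \<in> W' n \<Longrightarrow> z = 0\<^sub>v n"
  shows "variety_connected n (W' n)"
  unfolding variety_connected_def
proof (rule zariski_connected_star)
  have car: "y \<in> carrier_vec n" "z \<in> carrier_vec n" if "(y, z, A) \<in> W' n" for y z A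
    using that by (auto simp: W'_def W_iff)
  then show "flatten n ` W' n \<subseteq> carrier_vec (2 * n + n * n)"
    using flatten_carrier by auto
  fix c p assume "p \<in> flatten n ` W' n"
  then obtain y z A where yzA: "p = flatten n (y, z, A)" "(y, z, A) \<in> W' n" by force
  then have "z = 0\<^sub>v n" using assms by blast
  then have p: "p = flatten n (y, 0\<^sub>v n, A)" and W: "(y, 0\<^sub>v n, A) \<in> W' n"
    using yzA by simp_all
  have y: "y \<in> carrier_vec n" and D: "druzkowski n A" using W by (auto simp: W'_def W_iff)
  then have A: "A \<in> carrier_mat n n" by (simp add: druzkowski_def)
  \<comment> \<open>Scaling the flattened point scales \<open>y\<close> and \<open>A\<close>
    simultaneously, and Druzkowski matrices are stable under scaling.\<close>
  have "c \<cdot>\<^sub>v p = flatten n (c \<cdot>\<^sub>v y, 0\<^sub>v n, c \<cdot>\<^sub>m A)"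
  proof (rule eq_vecI)
    show "dim_vec (c \<cdot>\<^sub>v p) = dim_vec (flatten n (c \<cdot>\<^sub>v y, 0\<^sub>v n, c \<cdot>\<^sub>m A))"
      using y by (simp add: p flatten_def)
    fix k assume "k < dim_vec (flatten n (c \<cdot>\<^sub>v y, 0\<^sub>v n, c \<cdot>\<^sub>m A))"
    then have k: "k < n + (n + n * n)" using y by (simp add: flatten_def)
    have "l div n < n" "l mod n < n" if "l < n * n" for l
      using that by (auto simp: less_mult_imp_div_less) (metis mod_less_divisor mult_is_0 not_gr0 not_less0)
    then show "(c \<cdot>\<^sub>v p) $ k = flatten n (c \<cdot>\<^sub>v y, 0\<^sub>v n, c \<cdot>\<^sub>m A) $ k"
      using k y A by (auto simp: p flatten_def)
  qed
  moreover have "(c \<cdot>\<^sub>v y, 0\<^sub>v n, c \<cdot>\<^sub>m A) \<in> W' n"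
    using y by (intro W'_zero druzkowski_scale D) simp
  ultimately show "c \<cdot>\<^sub>v p \<in> flatten n ` W' n" by blast
qed

lemma invertible_mat_iff_det:
  fixes A :: "complex Matrix.mat"
  assumes A: "A \<in> carrier_mat n n"
  shows "invertible_mat A \<longleftrightarrow> Determinant.det A \<noteq> 0"
proof
  assume "invertible_mat A"
  then obtain B where B: "A * B = 1\<^sub>m n" "B * A = 1\<^sub>m (dim_row B)"
    using A unfolding invertible_mat_def inverts_mat_def by auto
  have "dim_col B = n" using arg_cong[OF B(1), of dim_col] by simp
  moreover have "dim_row B = n" using arg_cong[OF B(2), of dim_col] A by simp
  ultimately have "B \<in> carrier_mat n n" by auto
  then have "Determinant.det A * Determinant.det B = 1"
    using det_mult[OF A] B(1) det_one by metis
  then show "Determinant.det A \<noteq> 0" by auto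
next
  assume nz: "Determinant.det A \<noteq> 0"
  define B where "B = (1 / Determinant.det A) \<cdot>\<^sub>m adj_mat A"
  have "A * B = 1\<^sub>m n" "B * A = 1\<^sub>m n" "B \<in> carrier_mat n n"
    using adj_mat[OF A] nz
    by (auto simp: B_def mult_smult_distrib[OF A] mult_smult_assoc_mat[OF adj_mat(1)[OF A] A])
  then show "invertible_mat A"
    using A unfolding invertible_mat_def inverts_mat_def by auto
qed

lemma W'_trivial_if_JC:
  assumes JC: "JC n" and W: "(y, z, A) \<in> W' n"
  shows "z = 0\<^sub>v n"
proof (rule W'_trivial_if_inj[OF _ W])
  have D: "druzkowski n A" using W by (simp add: W'_def)
  then have A: "A \<in> carrier_mat n n" by (simp add: druzkowski_def)
  have "poly_map n (cubic_linear A)"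
    unfolding poly_map_def
  proof (intro conjI ballI allI impI)
    fix i assume i: "i < n"
    have "poly_fun n (\<lambda>x. x $ i + (\<Sum>j<n. A $$ (i, j) * x $ j) ^ 3)"
      using i by (intro poly_fun_add poly_fun_power poly_fun_sum poly_fun_mult poly_fun_const poly_fun_coord) auto
    then show "poly_fun n (\<lambda>x. cubic_linear A x $ i)"
      by (rule poly_fun_cong) (simp add: cubic_linear_index[OF A _ i] app_def)
  qed (rule cubic_linear_carrier[OF A])
  moreover have "invertible_mat (jacobian n (cubic_linear A) x)" if "x \<in> carrier_vec n" for x
  proof -
    have "jacobian n (cubic_linear A) x \<in> carrier_mat n n" by (simp add: jacobian_def)
    then show ?thesis using invertible_mat_iff_det D that by (simp add: druzkowski_def)
  qed
  ultimately obtain G where "\<forall>x\<in>carrier_vec n. G (cubic_linear A x) = x"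
    using JC[unfolded JC_def, rule_format, of "cubic_linear A"] by blast
  then show "x1 = x2" if "x1 \<in> carrier_vec n" "x2 \<in> carrier_vec n"
    "cubic_linear A x1 = cubic_linear A x2" for x1 x2
    using that by metis
qed

section \<open>Equivalence with the Jacobian conjecture\<close>

lemma (in injective_Keller) polynomial_inverse:
  "\<exists>p. (\<forall>i\<in>I. polyfn I (p i) \<and> (\<forall>x. p i (Fv x) = x i)) \<and> (\<forall>i\<in>I. \<forall>y. F i (\<lambda>j. p j y) = y i)"
proof -
  obtain q where q: "polyfn I q" "\<exists>y. q y \<noteq> 0" "\<forall>i\<in>I. growth q i" using growth_all by blast
  then interpret injective_Keller_growth I F q by unfold_locales auto
  obtain y0 where y0: "q y0 \<noteq> 0" using q(2) by blast
  have "\<exists>p. polyfn I p \<and> (\<forall>x. p (Fv x) = x i)" if i: "i \<in> I" for i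
  proof -
    obtain h where "polyfn I h" "\<And>x. q (Fv x) * x i = h (Fv x)" using rational_inverse[OF i] by blast
    then show ?thesis
      using polynomial_inverse_coordinate[where q = q and ?y0.0 = y0 and h = h and i = i] q(1) y0 i
      by blast
  qed
  then obtain p where p: "\<And>i. i \<in> I \<Longrightarrow> polyfn I (p i)" "\<And>i x. i \<in> I \<Longrightarrow> p i (Fv x) = x i"
    by metis
  have "F i (\<lambda>j. p j y) = y i" if i: "i \<in> I" for i y
  proof -
    \<comment> \<open>\<open>p\<close> inverts \<open>F\<close> on the left, so the difference
      vanishes on the image of \<open>F\<close> and therefore everywhere.\<close>
    have "F i (\<lambda>j. p j y) - y i = 0"
    proof (rule zero_if_zero_on_img[where f = "\<lambda>y. F i (\<lambda>j. p j y) - y i"])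
      show "polyfn I (\<lambda>y. F i (\<lambda>j. p j y) - y i)"
        by (intro polyfn_diff polyfn_var i polyfn_subst[where f = "F i" and g = p and I = I] PFF p(1))
      fix x
      have "F i (\<lambda>j. p j (Fv x)) = F i x" by (rule polyfn_cong[OF PFF[OF i]]) (rule p(2))
      then show "F i (\<lambda>j. p j (Fv x)) - Fv x i = 0" by (simp add: Fv_def)
    qed
    then show ?thesis by simp
  qed
  then show ?thesis using p by blast
qed

lemma JC_if_Keller_inj:
  assumes KI: "\<And>d. Keller_inj TYPE(nat) d"
  shows "JC n"
  unfolding JC_def
proof (intro allI impI)
  fix F assume F: "poly_map n F" and jac: "\<forall>x\<in>carrier_vec n. invertible_mat (jacobian n F x)"
  define f where "f i x = F (Matrix.vec n x) $ i" for i x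
  have PFf: "polyfn {..<n} (f i)" if "i \<in> {..<n}" for i
    using F that polyfn_of_poly_fun[of n "\<lambda>x. F x $ i"] by (auto simp: f_def[abs_def] poly_map_def)
  have K: "Keller {..<n} f"
    unfolding Keller_def
  proof (intro allI impI)
    fix x v assume d0: "\<forall>r\<in>{..<n}. dir_deriv (f r) x v = 0"
    define J where "J = jacobian n F (Matrix.vec n x)"
    have J: "J \<in> carrier_mat n n" by (simp add: J_def jacobian_def)
    have J_dd: "J $$ (i, j) = dir_deriv (f i) x (\<lambda>k. if k = j then 1 else 0)" if "i < n" "j < n" for i j
    proof -
      have "Matrix.vec n x + t \<cdot>\<^sub>v unit_vec n j = Matrix.vec n (\<lambda>k. x k + t * (if k = j then 1 else 0))" for t
        using that by (intro eq_vecI) (auto simp: unit_vec_def)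
      then show ?thesis using that by (simp add: J_def jacobian_def dir_deriv_def f_def)
    qed
    have "J *\<^sub>v Matrix.vec n v = 0\<^sub>v n"
    proof (rule eq_vecI)
      fix i assume "i < dim_vec (0\<^sub>v n :: complex Matrix.vec)"
      then have i: "i < n" by simp
      have "(J *\<^sub>v Matrix.vec n v) $ i = app n J (\<lambda>j. Matrix.vec n v $ j) i"
        by (rule mult_mat_vec_app[OF J vec_carrier i])
      also have "\<dots> = (\<Sum>j<n. v j * dir_deriv (f i) x (\<lambda>k. if k = j then 1 else 0))"
        unfolding app_def using i by (intro sum.cong) (auto simp: J_dd)
      also have "\<dots> = dir_deriv (f i) x v"
        using dir_deriv_linear[OF finite_lessThan PFf, of i x v] i by simp
      finally show "(J *\<^sub>v Matrix.vec n v) $ i = 0\<^sub>v n $ i" using d0 i by simp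
    qed (use J in simp)
    moreover have "Determinant.det J \<noteq> 0"
      using jac invertible_mat_iff_det[OF J] by (simp add: J_def)
    ultimately have "Matrix.vec n v = 0\<^sub>v n"
      using det_0_iff_vec_prod_zero[OF J] vec_carrier by blast
    then show "\<forall>i\<in>{..<n}. v i = 0"
      by (metis index_vec index_zero_vec(1) lessThan_iff)
  qed
  obtain d where d: "\<forall>i\<in>{..<n}. poly_deg {..<n} d (f i)"
    using polyfn_PD_common[of "{..<n}" "{..<n}" f] PFf by auto
  have "Inj {..<n} f" using d K by (intro Keller_injD[OF KI[of d]]) auto
  then interpret injective_Keller "{..<n}" f
    using PFf K by unfold_locales auto
  obtain p where p: "\<And>i. i < n \<Longrightarrow> polyfn {..<n} (p i)" "\<And>i x. i < n \<Longrightarrow> p i (Fv x) = x i"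
    "\<And>i y. i < n \<Longrightarrow> f i (\<lambda>j. p j y) = y i"
    using polynomial_inverse by blast
  define G where "G y = Matrix.vec n (\<lambda>i. p i (\<lambda>k. y $ k))" for y
  have eta: "Matrix.vec n (\<lambda>i. x $ i) = x" if "x \<in> carrier_vec n" for x :: "complex Matrix.vec"
    using that by (intro eq_vecI) auto
  have F_car: "F x \<in> carrier_vec n" if "x \<in> carrier_vec n" for x
    using F that by (simp add: poly_map_def)
  show "\<exists>G. poly_map n G \<and> (\<forall>x\<in>carrier_vec n. G (F x) = x \<and> F (G x) = x)"
  proof (intro exI[of _ G] conjI ballI)
    show "poly_map n G"
      unfolding poly_map_def G_def using poly_fun_of_PF[OF p(1)] by simp
  next
    fix x :: "complex Matrix.vec" assume x: "x \<in> carrier_vec n"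
    have Fv_x: "Fv (\<lambda>i. x $ i) k = F x $ k" for k by (simp add: Fv_def f_def eta[OF x])
    show "G (F x) = x"
    proof (rule eq_vecI)
      fix i assume "i < dim_vec x"
      then have i: "i < n" using x by simp
      have "G (F x) $ i = p i (Fv (\<lambda>i. x $ i))" using i by (simp add: G_def Fv_x[abs_def])
      then show "G (F x) $ i = x $ i" using p(2)[OF i] by simp
    qed (use x in \<open>simp add: G_def\<close>)
    have "G x \<in> carrier_vec n" by (simp add: G_def)
    show "F (G x) = x"
    proof (rule eq_vecI)
      fix i assume "i < dim_vec x"
      then have i: "i < n" using x by simp
      show "F (G x) $ i = x $ i" using p(3)[OF i, of "\<lambda>k. x $ k"] by (simp add: G_def f_def)
    qed (use x F_car[OF \<open>G x \<in> carrier_vec n\<close>] in auto)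
  qed
qed

text \<open>The trivial kernel makes the determinant a nonvanishing polynomial in \<open>x\<close>,
  hence constant, and its value at the origin is 1.\<close>

lemma druzkowski_if_Keller:
  assumes K: "Keller {..<n} (\<lambda>r x. x r + (\<Sum>i<n. a r i * x i) ^ 3)"
  shows "druzkowski n (Matrix.mat n n (\<lambda>(i, j). a i j))"
proof -
  define A where "A = Matrix.mat n n (\<lambda>(i, j). a i j)"
  have A: "A \<in> carrier_mat n n" by (simp add: A_def)
  have app_A: "app n A x i = (\<Sum>j<n. a i j * x j)" if "i < n" for x i
    using that by (simp add: app_def A_def)
  define D where "D x = Determinant.det (dmat n A (app n A x))" for x
  have dir_deriv_eq: "dir_deriv (\<lambda>x. x r + (\<Sum>i<n. a r i * x i) ^ 3) x v = v r + 3 * (app n A x r)\<^sup>2 * app n A v r"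
    if "r < n" for r x v
    using that by (simp add: dir_deriv_add[where I = "{..<n}"] polyfn_lin_cube dir_deriv_lin_cube app_A)
  have "D x \<noteq> 0" for x
  proof
    assume "D x = 0"
    have M: "dmat n A (app n A x) \<in> carrier_mat n n" by (simp add: dmat_def)
    obtain v where v: "v \<in> carrier_vec n" "v \<noteq> 0\<^sub>v n" "dmat n A (app n A x) *\<^sub>v v = 0\<^sub>v n"
      using \<open>D x = 0\<close> det_0_iff_vec_prod_zero[OF M] unfolding D_def by blast
    \<comment> \<open>Rescaling by \<open>1 / rt3\<close> turns the square in \<open>dmat\<close>
      into the factor 3 of the derivative of a cube.\<close>
    define x' where "x' j = (1 / rt3) * x j" for j
    have "dir_deriv (\<lambda>x. x r + (\<Sum>i<n. a r i * x i) ^ 3) x' (\<lambda>j. v $ j) = 0" if r: "r \<in> {..<n}" for r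
    proof -
      have r: "r < n" using r by simp
      have "0 = (dmat n A (app n A x) *\<^sub>v v) $ r" using v(3) r by simp
      also have "\<dots> = app n (dmat n A (app n A x)) (\<lambda>j. v $ j) r"
        by (rule mult_mat_vec_app[OF M v(1) r])
      also have "\<dots> = (\<Sum>j<n. (of_bool (r = j) + (app n A x r)\<^sup>2 * A $$ (r, j)) * v $ j)"
        unfolding app_def[of n "dmat n A (app n A x)"] using r
        by (intro sum.cong) (auto simp: dmat_def)
      also have "\<dots> = (\<Sum>j<n. of_bool (r = j) * v $ j) + (app n A x r)\<^sup>2 * app n A (\<lambda>j. v $ j) r"
        by (simp add: app_def[of n A "\<lambda>j. v $ j"] distrib_right sum.distrib sum_distrib_left mult.assoc)
      also have "(\<Sum>j<n. of_bool (r = j) * v $ j) = v $ r"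
        using r by (simp add: of_bool_def if_distrib[of "\<lambda>a. a * _"] cong: if_cong)
      also have "(app n A x r)\<^sup>2 = 3 * (app n A x' r)\<^sup>2"
        unfolding x'_def app_scale by (simp add: power_divide rt3)
      finally show ?thesis unfolding dir_deriv_eq[OF r] by simp
    qed
    then have "v $ j = 0" if "j < n" for j
      using KellerD[OF K, of x' "\<lambda>j. v $ j" j] that by blast
    then have "v = 0\<^sub>v n" using v(1) by (intro eq_vecI) auto
    then show False using v(2) by simp
  qed
  moreover have "polyfn {..<n} D"
  proof -
    have "polyfn {..<n} (\<lambda>x. \<Sum>p\<in>{p. p permutes {0..<n}}. signof p *
        (\<Prod>i = 0..<n. of_bool (i = p i) + (\<Sum>j<n. A $$ (i, j) * x j)\<^sup>2 * A $$ (i, p i)))"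
      by (intro polyfn_sum polyfn_mult polyfn_prod polyfn_add polyfn_power polyfn_const polyfn_var)
    then show ?thesis unfolding D_def[abs_def] dmat_def det_mat app_def by simp
  qed
  ultimately have "D x = D (\<lambda>_. 0)" for x
    using polyfn_nonvanishing_const[of "{..<n}" D x "\<lambda>_. 0"] by blast
  moreover have "D (\<lambda>_. 0) = 1"
  proof -
    have "dmat n A (app n A (\<lambda>_. 0)) = 1\<^sub>m n"
      unfolding dmat_def app_def by (intro eq_matI) auto
    then show ?thesis by (simp add: D_def)
  qed
  ultimately show ?thesis using A unfolding A_def[symmetric] by (simp add: druzkowski_iff D_def)
qed

lemma JC_infinity_if_W'_trivial:
  assumes W: "\<And>n y z A. (y, z, A) \<in> W' n \<Longrightarrow> z = 0\<^sub>v n"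
  shows JC_infinity
  unfolding JC_infinity_def
proof (intro allI JC_if_Keller_inj Keller_inj_if_Druz)
  fix n :: nat and a :: "nat \<Rightarrow> nat \<Rightarrow> complex"
  assume K: "Keller {..<n} (\<lambda>r x. x r + (\<Sum>i<n. a r i * x i) ^ 3)"
  define A where "A = Matrix.mat n n (\<lambda>(i, j). a i j)"
  have D: "druzkowski n A" unfolding A_def by (rule druzkowski_if_Keller[OF K])
  have app_A: "app n A x i = (\<Sum>j<n. a i j * x j)" if "i < n" for x i
    using that by (simp add: app_def A_def)
  show "Inj {..<n} (\<lambda>r x. x r + (\<Sum>i<n. a r i * x i) ^ 3)"
    unfolding Inj_def
  proof (intro allI impI ballI)
    fix x y i
    assume eq: "\<forall>r\<in>{..<n}. x r + (\<Sum>i<n. a r i * x i) ^ 3 = y r + (\<Sum>i<n. a r i * y i) ^ 3"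
      and i: "i \<in> {..<n}"
    show "x i = y i"
    proof (rule inj_if_W'_trivial[OF D W])
      show "x j + app n A x j ^ 3 = y j + app n A y j ^ 3" if "j < n" for j
        using eq that by (simp add: app_A)
      show "i < n" using i by simp
    qed
  qed
qed

theorem theorem1p14:
  shows "(JC_infinity \<longleftrightarrow> (\<forall>n. variety_connected n (W' n))) \<and>
    ((\<forall>n. variety_connected n (W n)) \<longrightarrow> JC_infinity)"
proof (intro conjI impI iffI allI)
  have W'W: "W' n \<subseteq> W n" for n by (auto simp: W'_def)
  show "variety_connected n (W' n)" if JC_infinity for n
    using that by (intro W'_connected_if_trivial W'_trivial_if_JC) (auto simp: JC_infinity_def)
  show JC_infinity if "\<forall>n. variety_connected n (W' n)"
    using that W'W by (intro JC_infinity_if_W'_trivial) (metis trivial_if_connected order_refl)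
  show JC_infinity if "\<forall>n. variety_connected n (W n)"
    using that W'W by (intro JC_infinity_if_W'_trivial) (metis trivial_if_connected order_refl subsetD)
qed

end
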